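(* Let $p\in[-1,1]$ be a nonzero real number, let $\mathcal A,\mathcal B$ be unital $C^*$-algebras and let $\phi:\mathcal A^{++}\to \mathcal B^{++}$ be a continuous bijective map. Then $\phi$ satisfies \[ \phi(A\,\mathfrak{m}_p\, B)=\phi(A)\,\mathfrak{m}_p\, \phi(B)\quad\text{for all } A,B\in \mathcal A^{++} \] if and only if there are a Jordan *-isomorphism $J:\mathcal A\to \mathcal B$ and an element $D\in \mathcal B^{++}$ such that \[ \phi(A)=D\,J(A)\,D\quad\text{for all } A\in \mathcal A^{++}. \]
   Context: All $C^*$-algebras are complex and unital. For a $C^*$-algebra $\mathcal A$, $\mathcal A^{+}$ denotes the set of self-adjoint elements with nonnegative spectrum, and $\mathcal A^{++}$ (the positive definite cone) denotes the set of invertible elements of $\mathcal A^{+}$. Real powers of elements of $\mathcal A^{++}$ are defined by continuous functional calculus. Continuity of $\phi$ is with respect to the norm topologies. For nonzero $p\in[-1,1]$, the Kubo-Ando $p$th power mean on $\mathcal A^{++}$ is \[ A\,\mathfrak{m}_p\, B=A^{\frac12}\left(\frac{I+(A^{-\frac12} B A^{-\frac12})^p}{2}\right)^{\frac1p} A^{\frac12},\quad A,B\in \mathcal A^{++}, \] where $I$ is the unit (and likewise on $\mathcal B^{++}$). A Jordan *-isomorphism $J:\mathcal A\to\mathcal B$ is a bijective (complex-)linear map satisfying $J(AB+BA)=J(A)J(B)+J(B)J(A)$ and $J(A^* )=J(A)^*$ for all $A,B\in\mathcal A$. *)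

theory Defs
  imports "HOL-Analysis.Analysis"
begin

text \<open>The norm axioms inherited from \<open>real_normed_algebra_1\<close> include \<open>norm 1 = 1\<close>, so the zero
  algebra is not counted as a unital C*-algebra.\<close>

class cstar_algebra = real_normed_algebra_1 + banach +
  fixes scaleC :: "complex \<Rightarrow> 'a \<Rightarrow> 'a" (infixr "*\<^sub>C" 75)
    and star :: "'a \<Rightarrow> 'a"
  assumes scaleC_add_right: "c *\<^sub>C (x + y) = c *\<^sub>C x + c *\<^sub>C y"
    and scaleC_add_left: "(c + d) *\<^sub>C x = c *\<^sub>C x + d *\<^sub>C x"
    and scaleC_scaleC: "c *\<^sub>C d *\<^sub>C x = (c * d) *\<^sub>C x"
    and scaleC_of_real: "complex_of_real r *\<^sub>C x = r *\<^sub>R x"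
    and mult_scaleC_left: "(c *\<^sub>C x) * y = c *\<^sub>C (x * y)"
    and mult_scaleC_right: "x * (c *\<^sub>C y) = c *\<^sub>C (x * y)"
    and norm_scaleC: "norm (c *\<^sub>C x) = cmod c * norm x"
    and star_star: "star (star x) = x"
    and star_add: "star (x + y) = star x + star y"
    and star_scaleC: "star (c *\<^sub>C x) = cnj c *\<^sub>C star x"
    and star_mult: "star (x * y) = star y * star x"
    and cstar_identity: "norm (star x * x) = (norm x)\<^sup>2"

instantiation complex :: cstar_algebra
begin

definition scaleC_complex :: "complex \<Rightarrow> complex \<Rightarrow> complex"
  where "scaleC_complex c x = c * x"

definition star_complex :: "complex \<Rightarrow> complex"
  where "star_complex = cnj"

instance
  by standard
    (simp_all add: scaleC_complex_def star_complex_def algebra_simps norm_mult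
      scaleR_conv_of_real power2_eq_square)

end

definition invertible_elem :: "'a::cstar_algebra \<Rightarrow> bool"
  where "invertible_elem x \<longleftrightarrow> (\<exists>y. x * y = 1 \<and> y * x = 1)"

definition spectrum :: "'a::cstar_algebra \<Rightarrow> complex set"
  where "spectrum x = {c. \<not> invertible_elem (x - c *\<^sub>C 1)}"

definition pos_cone :: "'a::cstar_algebra set"
  where "pos_cone = {x. star x = x \<and> (\<forall>c\<in>spectrum x. \<exists>r\<ge>0. c = complex_of_real r)}"

definition pos_def_cone :: "'a::cstar_algebra set"
  where "pos_def_cone = {x \<in> pos_cone. invertible_elem x}"

text \<open>\<open>functional_calculus x \<Phi>\<close> says that \<open>\<Phi>\<close> is the isometric unital *-homomorphism from the
  continuous functions on the spectrum of \<open>x\<close> to the algebra that sends the identity function to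
  \<open>x\<close>. Continuous functions on the spectrum are represented by total functions; the isometry
  condition, applied to a difference, makes \<open>\<Phi> f\<close> depend only on the values of \<open>f\<close> on the spectrum.
  For normal \<open>x\<close> such a \<open>\<Phi>\<close> exists and is unique on functions continuous on the spectrum.\<close>

definition functional_calculus ::
    "'a::cstar_algebra \<Rightarrow> ((complex \<Rightarrow> complex) \<Rightarrow> 'a) \<Rightarrow> bool"
  where "functional_calculus x \<Phi> \<longleftrightarrow>
    \<Phi> (\<lambda>z. 1) = 1 \<and> \<Phi> (\<lambda>z. z) = x \<and>
    (\<forall>f g. continuous_on (spectrum x) f \<and> continuous_on (spectrum x) g \<longrightarrow>
      \<Phi> (\<lambda>z. f z + g z) = \<Phi> f + \<Phi> g \<and>
      \<Phi> (\<lambda>z. f z * g z) = \<Phi> f * \<Phi> g) \<and>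
    (\<forall>f. continuous_on (spectrum x) f \<longrightarrow>
      (\<forall>c. \<Phi> (\<lambda>z. c * f z) = c *\<^sub>C \<Phi> f) \<and>
      \<Phi> (\<lambda>z. cnj (f z)) = star (\<Phi> f) \<and>
      norm (\<Phi> f) = (SUP z\<in>spectrum x. cmod (f z)))"

definition cfc :: "(complex \<Rightarrow> complex) \<Rightarrow> 'a::cstar_algebra \<Rightarrow> 'a"
  where "cfc f x = (SOME \<Phi>. functional_calculus x \<Phi>) f"

text \<open>Meant for positive definite \<open>x\<close>, whose spectrum lies in the positive reals, so that \<open>Re z\<close> below
  is just \<open>z\<close>.\<close>

definition real_power :: "'a::cstar_algebra \<Rightarrow> real \<Rightarrow> 'a"
  where "real_power x r = cfc (\<lambda>z. complex_of_real (Re z powr r)) x"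

definition power_mean :: "real \<Rightarrow> 'a::cstar_algebra \<Rightarrow> 'a \<Rightarrow> 'a"
  where "power_mean p A B =
    real_power A (1/2) *
    real_power
      ((1/2) *\<^sub>R (1 + real_power (real_power A (-1/2) * B * real_power A (-1/2)) p)) (1/p) *
    real_power A (1/2)"

definition jordan_star_iso :: "('a::cstar_algebra \<Rightarrow> 'b::cstar_algebra) \<Rightarrow> bool"
  where "jordan_star_iso J \<longleftrightarrow>
    bij J \<and>
    (\<forall>A B. J (A + B) = J A + J B) \<and>
    (\<forall>c A. J (c *\<^sub>C A) = c *\<^sub>C J A) \<and>
    (\<forall>A B. J (A * B + B * A) = J A * J B + J B * J A) \<and>
    (\<forall>A. J (star A) = star (J A))"

end

theory Submission
  imports Defs "HOL-Computational_Algebra.Fundamental_Theorem_Algebra"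
begin

text \<open>After the inversion \<open>A \<mapsto> A\<^sup>-\<^sup>1\<close>, which turns \<open>p\<close> into \<open>-p\<close>, let \<open>p > 0\<close>. The means
  \<open>A m\<^sub>p X\<close> of a fixed \<open>A\<close> are exactly the elements strictly above \<open>c A\<close>, where
  \<open>c = 2\<^sup>-\<^sup>1\<^sup>/\<^sup>p\<close>. Hence a mean preserving bijection \<open>\<phi>\<close> is an order isomorphism with
  \<open>\<phi> (c A) = c \<phi> A\<close>, because \<open>c A\<close> is the infimum of that set. Suppose \<open>\<phi> 1 = 1\<close>.
  Then \<open>F B = \<phi> (B\<^sup>1\<^sup>/\<^sup>p)\<^sup>p\<close> satisfies \<open>F (1 + B) = 1 + F B\<close> and \<open>F (B/2) = F B / 2\<close>;
  this fixes \<open>\<phi>\<close> on dyadic and, by monotonicity, on all scalars, and renormalising at other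
  base points makes \<open>\<phi>\<close> homogeneous. Being monotone and homogeneous, \<open>\<phi>\<close> is Lipschitz near
  \<open>1\<close>, and \<open>F\<close> turns out to be its derivative there. The mean has derivative
  \<open>(X + Y)/2\<close> at \<open>(1, 1)\<close>, so \<open>F\<close> is additive, and by Kadison's theorem on unital order
  isomorphisms it is the restriction of a Jordan *-isomorphism \<open>J\<close>. As \<open>J\<close> respects powers,
  \<open>\<phi> A = (J A\<^sup>p)\<^sup>1\<^sup>/\<^sup>p = J A\<close>.\<close>

section \<open>Scalars, involution and inverses\<close>

text \<open>The equation linearises only when one argument is the unit: the mean of \<open>1\<close>
  and \<open>R\<close> is \<open>((1 + R^p)/2)^(1/p)\<close>. Conjugating \<open>\<phi>\<close> with
  the p-th power therefore yields additivity against \<open>1\<close>, but says nothing directly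
  about the sum of two elements that do not commute. Two facts about the mean get round this. It is
  invariant under congruences \<open>X \<mapsto> D X D\<close>, so what is proved at the unit can be
  carried to every base point. And its tangent at the unit is the same for all \<open>p\<close>, so
  that additivity, invisible in the equation itself, appears to first order. What is missing then is
  differentiability of \<open>\<phi>\<close>: explicit curves through the unit have known images,
  and the order structure controls every other curve with the same tangent. The order enters through
  a scalar fact: as \<open>t\<close> decreases to 0, the mean of the numbers 1 and \<open>t\<close>
  decreases to 2^(-1/p) without reaching it, whence the strict inequality that describes the means
  of a fixed element.\<close>

lemma scaleC_one [simp]: "1 *\<^sub>C (x::'a::cstar_algebra) = x"
  using scaleC_of_real[of 1 x] by simp

lemma scaleC_zero_left [simp]: "0 *\<^sub>C (x::'a::cstar_algebra) = 0"
  using scaleC_of_real[of 0 x] by simp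

lemma scaleC_zero_right [simp]: "c *\<^sub>C (0::'a::cstar_algebra) = 0"
  using scaleC_add_right[of c 0 "0::'a"] by simp

lemma scaleC_minus_right: "c *\<^sub>C (- x) = - (c *\<^sub>C (x::'a::cstar_algebra))"
  using scaleC_add_right[of c x "- x"] by (simp add: eq_neg_iff_add_eq_0 add.commute)

lemma scaleC_minus_left: "(- c) *\<^sub>C x = - (c *\<^sub>C (x::'a::cstar_algebra))"
  using scaleC_add_left[of c "- c" x] by (simp add: eq_neg_iff_add_eq_0 add.commute)

lemma scaleC_diff_right: "c *\<^sub>C (x - y) = c *\<^sub>C x - c *\<^sub>C (y::'a::cstar_algebra)"
  using scaleC_add_right[of c x "- y"] by (simp add: scaleC_minus_right)

lemma scaleC_scaleR: "c *\<^sub>C (r *\<^sub>R x) = r *\<^sub>R (c *\<^sub>C (x::'a::cstar_algebra))"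
  by (simp add: scaleC_of_real[symmetric] scaleC_scaleC mult.commute)

lemma bounded_bilinear_scaleC: "bounded_bilinear (\<lambda>c x::'a::cstar_algebra. c *\<^sub>C x)"
proof
  show "\<exists>K. \<forall>c (x::'a). norm (c *\<^sub>C x) \<le> norm c * norm x * K"
    by (intro exI[of _ 1]) (simp add: norm_scaleC)
  show "(r *\<^sub>R c) *\<^sub>C x = r *\<^sub>R (c *\<^sub>C x)" for r c and x :: 'a
    by (simp only: scaleR_conv_of_real[where 'a=complex] scaleC_scaleC[symmetric] scaleC_of_real)
qed (simp_all add: scaleC_add_left scaleC_add_right scaleC_scaleR)

lemmas tendsto_scaleC [tendsto_intros] =
  bounded_bilinear.tendsto[OF bounded_bilinear_scaleC]

lemma star_scaleR: "star (r *\<^sub>R x) = r *\<^sub>R star (x::'a::cstar_algebra)"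
  using star_scaleC[of "complex_of_real r" x] by (simp add: scaleC_of_real)

lemma star_zero [simp]: "star (0::'a::cstar_algebra) = 0"
  using star_scaleR[of 0 "0::'a"] by simp

lemma star_minus: "star (- x) = - star (x::'a::cstar_algebra)"
  using star_scaleR[of "-1" x] by simp

lemma star_diff: "star (x - y) = star x - star (y::'a::cstar_algebra)"
  using star_add[of x "- y"] by (simp add: star_minus)

lemma star_one [simp]: "star (1::'a::cstar_algebra) = 1"
  by (metis mult_1_left mult_1_right star_mult star_star)

lemma star_power: "star (x ^ n) = star (x::'a::cstar_algebra) ^ n"
  by (induction n) (simp_all add: star_mult power_commutes)

lemma norm_star: "norm (star x) = norm (x::'a::cstar_algebra)"
proof -
  have le: "norm y \<le> norm (star y)" for y :: 'a
  proof (cases "y = 0")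
    case False
    have "norm y * norm y \<le> norm (star y) * norm y"
      using norm_mult_ineq[of "star y" y] by (simp add: cstar_identity power2_eq_square)
    then show ?thesis using False by simp
  qed simp
  show ?thesis using le[of x] le[of "star x"] by (simp add: star_star)
qed

lemma bounded_linear_star: "bounded_linear (star :: 'a::cstar_algebra \<Rightarrow> 'a)"
  by (rule bounded_linear_intro[where K=1]) (simp_all add: star_add star_scaleR norm_star)

lemmas tendsto_star [tendsto_intros] = bounded_linear.tendsto[OF bounded_linear_star]

lemma norm_square_selfadj: "star x = x \<Longrightarrow> norm (x * x) = (norm (x::'a::cstar_algebra))\<^sup>2"
  using cstar_identity[of x] by simp

definition cinv :: "'a::cstar_algebra \<Rightarrow> 'a"
  where "cinv x = (SOME y. x * y = 1 \<and> y * x = 1)"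

lemma cinv_right: "invertible_elem x \<Longrightarrow> x * cinv x = 1"
  and cinv_left: "invertible_elem x \<Longrightarrow> cinv x * x = 1"
  unfolding invertible_elem_def cinv_def by (metis (mono_tags, lifting) someI_ex)+

lemma invertibleI: "x * y = 1 \<Longrightarrow> y * x = 1 \<Longrightarrow> invertible_elem x"
  unfolding invertible_elem_def by blast

lemma left_right_inverse_eq: "z * x = 1 \<Longrightarrow> x * y = 1 \<Longrightarrow> z = (y::'a::monoid_mult)"
  by (metis mult.assoc mult_1_left mult_1_right)

lemma cinv_unique: "x * y = 1 \<Longrightarrow> y * x = 1 \<Longrightarrow> cinv x = y"
  using cinv_left invertibleI left_right_inverse_eq by metis

lemma invertible_one [simp]: "invertible_elem 1"
  by (rule invertibleI[of _ 1]) auto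

lemma not_invertible_zero [simp]: "\<not> invertible_elem (0::'a::cstar_algebra)"
  unfolding invertible_elem_def by simp

lemma cinv_one [simp]: "cinv 1 = 1"
  by (rule cinv_unique) auto

lemma invertible_mult: "invertible_elem x \<Longrightarrow> invertible_elem y \<Longrightarrow> invertible_elem (x * y)"
  by (rule invertibleI[of _ "cinv y * cinv x"])
    (metis cinv_left cinv_right mult.assoc mult_1_right)+

lemma cinv_mult: "invertible_elem x \<Longrightarrow> invertible_elem y \<Longrightarrow> cinv (x * y) = cinv y * cinv x"
  by (rule cinv_unique) (metis cinv_left cinv_right mult.assoc mult_1_right)+

lemma cinv_cinv: "invertible_elem x \<Longrightarrow> cinv (cinv x) = x"
  using cinv_left cinv_right cinv_unique by blast

lemma invertible_star: "invertible_elem x \<Longrightarrow> invertible_elem (star x)"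
  by (rule invertibleI[of _ "star (cinv x)"])
    (simp_all add: star_mult[symmetric] cinv_left cinv_right)

lemma invertible_scaleC_iff:
  "c \<noteq> 0 \<Longrightarrow> invertible_elem (c *\<^sub>C x) \<longleftrightarrow> invertible_elem (x::'a::cstar_algebra)"
proof -
  have *: "invertible_elem (c *\<^sub>C x)" if "c \<noteq> 0" "invertible_elem x" for c and x :: 'a
    by (rule invertibleI[of _ "inverse c *\<^sub>C cinv x"])
      (use that in \<open>simp_all add: mult_scaleC_left mult_scaleC_right scaleC_scaleC
        cinv_left cinv_right\<close>)
  show "c \<noteq> 0 \<Longrightarrow> ?thesis"
    using *[of c x] *[of "inverse c" "c *\<^sub>C x"] by (auto simp: scaleC_scaleC)
qed

text \<open>With \<open>z\<close> inverse to the product, \<open>y * z\<close> is a right inverse of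
  \<open>x\<close> and, by commutation, \<open>z * y\<close> a left inverse; the two then coincide.
  This lets a polynomial in an element inherit non-invertibility from a linear factor.\<close>

lemma invertible_commuting_factor:
  assumes "x * y = y * x" "invertible_elem (x * y)"
  shows "invertible_elem x"
proof -
  define z where "z = cinv (x * y)"
  have 1: "x * (y * z) = 1" using cinv_right[OF assms(2)] by (simp add: z_def mult.assoc)
  have "z * y * x = 1" using cinv_left[OF assms(2)] assms(1) by (simp add: z_def mult.assoc)
  with 1 show ?thesis using left_right_inverse_eq[of "z * y" x "y * z"] invertibleI by metis
qed

section \<open>Neumann series and continuity of inversion\<close>

text \<open>The geometric series of \<open>x\<close> inverts \<open>1 - x\<close>; completeness
  makes it converge.\<close>

lemma invertible_one_minus:
  fixes x :: "'a::cstar_algebra"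
  assumes "norm x < 1"
  shows "invertible_elem (1 - x)"
proof -
  have sum: "summable (\<lambda>n. x ^ n)"
  proof (rule summable_comparison_test)
    show "\<exists>N. \<forall>n\<ge>N. norm (x ^ n) \<le> norm x ^ n" using norm_power_ineq by blast
    show "summable (\<lambda>n. norm x ^ n)" using assms by (simp add: summable_geometric)
  qed
  define s where "s = (\<Sum>n. x ^ n)"
  have s: "s = 1 + (\<Sum>n. x ^ Suc n)"
    using suminf_split_head[OF sum] by (simp add: s_def)
  have "(\<Sum>n. x ^ Suc n) = x * s" "(\<Sum>n. x ^ Suc n) = s * x"
    using suminf_mult[OF sum, of x] suminf_mult2[OF sum, of x]
    by (simp_all add: s_def power_commutes)
  then have "s - x * s = 1" "s - s * x = 1" using s by (simp_all add: algebra_simps)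
  then show ?thesis by (intro invertibleI[of _ s]) (simp_all add: algebra_simps)
qed

text \<open>With \<open>y = cinv x\<close>, write \<open>w = x * (1 - y * (x - w))\<close>; the
  bound 1/2 makes the second factor invertible. The resolvent identity
  \<open>v - y = v * (x - w) * y\<close> first shows that \<open>v = cinv w\<close> has at most
  twice the norm of \<open>y\<close>, and inserting this bound into the same identity gives the
  estimate.\<close>

lemma
  fixes x w :: "'a::cstar_algebra"
  assumes x: "invertible_elem x" and w: "norm (w - x) * norm (cinv x) \<le> 1/2"
  shows invertible_near: "invertible_elem w"
    and cinv_near: "norm (cinv w - cinv x) \<le> 2 * (norm (cinv x))\<^sup>2 * norm (w - x)"
proof -
  define y where "y = cinv x"
  have xy: "x * y = 1" "y * x = 1" using x by (simp_all add: y_def cinv_left cinv_right)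
  have "norm (y * (x - w)) \<le> 1/2"
    using norm_mult_ineq[of y "x - w"] w by (simp add: y_def mult.commute norm_minus_commute)
  then have "invertible_elem (1 - y * (x - w))" by (intro invertible_one_minus) simp
  moreover have "w = x * (1 - y * (x - w))"
    using xy(1) by (simp add: right_diff_distrib mult.assoc[symmetric])
  ultimately show inv: "invertible_elem w" using x invertible_mult by metis
  define v where "v = cinv w"
  have wv: "w * v = 1" "v * w = 1" using inv by (simp_all add: v_def cinv_left cinv_right)
  have vy: "v - y = v * (x - w) * y"
    using xy wv by (simp add: algebra_simps)
  have d: "norm (v - y) \<le> norm v * (norm (w - x) * norm y)"
  proof -
    have "norm (v * (x - w) * y) \<le> norm v * norm (x - w) * norm y"
      by (meson norm_mult_ineq mult_right_mono norm_ge_zero order_trans)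
    then show ?thesis by (simp add: vy norm_minus_commute mult.assoc)
  qed
  also have "\<dots> \<le> norm v * (1/2)" using w by (intro mult_left_mono) (auto simp: y_def)
  finally have "norm v \<le> 2 * norm y" using norm_triangle_ineq2[of v y] by simp
  then have "norm v * (norm (w - x) * norm y) \<le> 2 * norm y * (norm (w - x) * norm y)"
    by (intro mult_right_mono) auto
  with d have "norm (v - y) \<le> 2 * norm y * (norm (w - x) * norm y)" by simp
  then show "norm (cinv w - cinv x) \<le> 2 * (norm (cinv x))\<^sup>2 * norm (w - x)"
    by (simp add: v_def y_def power2_eq_square mult_ac)
qed

lemma eventually_near_invertible:
  fixes x :: "'a::cstar_algebra"
  assumes x: "invertible_elem x"
  shows "\<forall>\<^sub>F w in nhds x. norm (w - x) * norm (cinv x) \<le> 1/2"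
proof -
  have "((\<lambda>w. norm (w - x) * norm (cinv x)) \<longlongrightarrow> norm (x - x) * norm (cinv x)) (nhds x)"
    by (intro tendsto_intros filterlim_ident)
  then have "\<forall>\<^sub>F w in nhds x. norm (w - x) * norm (cinv x) < 1/2"
    by (rule order_tendstoD) simp
  then show ?thesis by eventually_elim simp
qed

lemma eventually_invertible:
  "invertible_elem x \<Longrightarrow> \<forall>\<^sub>F w in nhds x. invertible_elem (w::'a::cstar_algebra)"
  using eventually_near_invertible by (rule eventually_mono) (auto intro: invertible_near)

lemma isCont_cinv:
  fixes x :: "'a::cstar_algebra"
  assumes x: "invertible_elem x"
  shows "isCont cinv x"
proof -
  have "((\<lambda>w. cinv w - cinv x) \<longlongrightarrow> 0) (at x)"
  proof (rule Lim_null_comparison)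
    have "\<forall>\<^sub>F w in at x. norm (w - x) * norm (cinv x) \<le> 1/2"
      using eventually_near_invertible[OF x] by (simp add: eventually_nhds_conv_at)
    then show "\<forall>\<^sub>F w in at x. norm (cinv w - cinv x) \<le> 2 * (norm (cinv x))\<^sup>2 * norm (w - x)"
      by eventually_elim (rule cinv_near[OF x])
    have "((\<lambda>w. 2 * (norm (cinv x))\<^sup>2 * norm (w - x)) \<longlongrightarrow> 2 * (norm (cinv x))\<^sup>2 * norm (x - x)) (at x)"
      by (intro tendsto_intros)
    then show "((\<lambda>w. 2 * (norm (cinv x))\<^sup>2 * norm (w - x)) \<longlongrightarrow> 0) (at x)" by simp
  qed
  then show ?thesis by (simp add: isCont_def LIM_zero_iff)
qed

section \<open>The spectrum of a self-adjoint element\<close>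

lemma spectrum_iff: "c \<in> spectrum x \<longleftrightarrow> \<not> invertible_elem (x - c *\<^sub>C 1)"
  by (simp add: spectrum_def)

lemma spectrum_norm_le:
  fixes x :: "'a::cstar_algebra"
  assumes "c \<in> spectrum x"
  shows "cmod c \<le> norm x"
proof (rule ccontr)
  assume *: "\<not> ?thesis"
  then have c: "c \<noteq> 0" by auto
  have "inverse (cmod c) * norm x < 1"
    using * c by (simp add: field_simps)
  then have "norm (inverse c *\<^sub>C x) < 1"
    by (simp add: norm_scaleC norm_inverse)
  then have "invertible_elem ((- c) *\<^sub>C (1 - inverse c *\<^sub>C x))"
    using c by (subst invertible_scaleC_iff) (auto intro: invertible_one_minus)
  also have "(- c) *\<^sub>C (1 - inverse c *\<^sub>C x) = x - c *\<^sub>C 1"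
    using c by (simp add: scaleC_minus_left scaleC_diff_right scaleC_scaleC)
  finally show False using assms by (simp add: spectrum_iff)
qed

lemma closed_spectrum: "closed (spectrum (x::'a::cstar_algebra))"
proof -
  have "\<forall>\<^sub>F d in nhds c. d \<in> - spectrum x" if "c \<in> - spectrum x" for c
  proof -
    from that have "invertible_elem (x - c *\<^sub>C 1)" by (simp add: spectrum_iff)
    then have "\<forall>\<^sub>F w in nhds (x - c *\<^sub>C 1). invertible_elem w" by (rule eventually_invertible)
    moreover have "((\<lambda>d. x - d *\<^sub>C 1) \<longlongrightarrow> x - c *\<^sub>C 1) (nhds c)"
      by (intro tendsto_intros filterlim_ident)
    ultimately have "\<forall>\<^sub>F d in nhds c. invertible_elem (x - d *\<^sub>C 1)"
      by (simp add: filterlim_iff)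
    then show ?thesis by (simp add: spectrum_iff)
  qed
  then have "open (- spectrum x)"
    unfolding open_subopen[of "- spectrum x"] eventually_nhds by (meson subsetI)
  then show ?thesis by (simp add: closed_def)
qed

lemma compact_spectrum: "compact (spectrum (x::'a::cstar_algebra))"
  using spectrum_norm_le closed_spectrum
  by (auto simp: compact_eq_bounded_closed bounded_iff)

text \<open>Arens' shift: adding the scalar \<open>\<i> t\<close> moves \<open>c\<close> to a point
  whose squared modulus is \<open>t^2 + 2 t Im c + (cmod c)^2\<close>, while the C*-identity bounds
  the squared norm of the shifted element by \<open>t^2 + (norm h)^2\<close>. The squares of
  \<open>t\<close> cancel, and a linear function of \<open>t\<close> that is bounded above must have
  slope zero.\<close>

lemma spectrum_real:
  fixes h :: "'a::cstar_algebra"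
  assumes h: "star h = h" and c: "c \<in> spectrum h"
  shows "Im c = 0"
proof (rule ccontr)
  assume im: "Im c \<noteq> 0"
  have le: "(cmod c)\<^sup>2 + 2 * Im c * t \<le> (norm h)\<^sup>2" for t
  proof -
    define w where "w = \<i> * complex_of_real t"
    have "c + w \<in> spectrum (h + w *\<^sub>C 1)"
      using c by (simp add: spectrum_iff scaleC_add_left)
    then have "(cmod (c + w))\<^sup>2 \<le> (norm (h + w *\<^sub>C 1))\<^sup>2"
      by (intro power_mono spectrum_norm_le) auto
    also have "(norm (h + w *\<^sub>C 1))\<^sup>2 = norm (star (h + w *\<^sub>C 1) * (h + w *\<^sub>C 1))"
      by (simp add: cstar_identity)
    also have "star (h + w *\<^sub>C 1) = h + (- w) *\<^sub>C 1"
      by (simp add: h star_add star_scaleC w_def)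
    also have "(h + (- w) *\<^sub>C 1) * (h + w *\<^sub>C 1) = h * h + (complex_of_real (t\<^sup>2)) *\<^sub>C 1"
    proof -
      have "(h + (- w) *\<^sub>C 1) * (h + w *\<^sub>C 1) = h * h + (- (w * w)) *\<^sub>C 1"
        by (simp add: algebra_simps mult_scaleC_left mult_scaleC_right scaleC_minus_left
            scaleC_diff_right scaleC_scaleC)
      also have "- (w * w) = complex_of_real (t\<^sup>2)" by (simp add: w_def complex_eq_iff power2_eq_square)
      finally show ?thesis .
    qed
    also have "norm \<dots> \<le> (norm h)\<^sup>2 + t\<^sup>2"
      by (rule order_trans[OF norm_triangle_ineq])
        (simp add: norm_square_selfadj h norm_scaleC norm_power)
    finally show ?thesis
      by (simp add: w_def cmod_power2) (simp add: power2_eq_square algebra_simps)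
  qed
  \<comment> \<open>This value of \<open>t\<close> makes the linear term equal to
    \<open>(norm h)^2 + 1\<close>, just beyond the bound.\<close>
  have "Im c * (((norm h)\<^sup>2 + 1) / (2 * Im c)) = ((norm h)\<^sup>2 + 1) / 2"
    using im by simp
  then have "(cmod c)\<^sup>2 + (norm h)\<^sup>2 + 1 \<le> (norm h)\<^sup>2"
    using le[of "((norm h)\<^sup>2 + 1) / (2 * Im c)"] by (simp only: mult.assoc) (simp add: im add_divide_distrib)
  then show False using zero_le_power2[of "cmod c"] by linarith
qed

text \<open>Rickart's elementary argument: \<open>(1 - z\<^sup>2 g\<^sup>2)\<^sup>-\<^sup>1\<close> is the mean of \<open>(1 - z g)\<^sup>-\<^sup>1\<close> and
  \<open>(1 + z g)\<^sup>-\<^sup>1\<close>, so a bound that is uniform on the unit circle survives repeated squaring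
  of \<open>g\<close>.\<close>

lemma resolvent_square:
  fixes u :: "'a::cstar_algebra"
  assumes "invertible_elem (1 - u)" "invertible_elem (1 + u)"
  shows "invertible_elem (1 - u * u)"
    and "cinv (1 - u * u) = (1/2) *\<^sub>R (cinv (1 - u) + cinv (1 + u))"
proof -
  have f: "1 - u * u = (1 - u) * (1 + u)" "1 - u * u = (1 + u) * (1 - u)"
    by (simp_all add: algebra_simps)
  show "invertible_elem (1 - u * u)" using f assms invertible_mult by metis
  have "(1 - u * u) * (cinv (1 - u) + cinv (1 + u)) = 2 *\<^sub>R 1"
  proof -
    have "(1 - u * u) * cinv (1 - u) = 1 + u"
      unfolding f(2) by (simp add: mult.assoc cinv_right assms)
    moreover have "(1 - u * u) * cinv (1 + u) = 1 - u"
      unfolding f(1) by (simp add: mult.assoc cinv_right assms)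
    ultimately show ?thesis by (simp add: distrib_left scaleR_2)
  qed
  moreover have "(cinv (1 - u) + cinv (1 + u)) * (1 - u * u) = 2 *\<^sub>R 1"
  proof -
    have "cinv (1 - u) * (1 - u * u) = 1 + u"
      unfolding f(1) by (simp add: mult.assoc[symmetric] cinv_left assms)
    moreover have "cinv (1 + u) * (1 - u * u) = 1 - u"
      unfolding f(2) by (simp add: mult.assoc[symmetric] cinv_left assms)
    ultimately show ?thesis by (simp add: distrib_right scaleR_2)
  qed
  ultimately show "cinv (1 - u * u) = (1/2) *\<^sub>R (cinv (1 - u) + cinv (1 + u))"
    by (intro cinv_unique) simp_all
qed

lemma resolvent_doubling:
  fixes g :: "'a::cstar_algebra" and r e :: real
  assumes "\<And>z. cmod z = 1 \<Longrightarrow> invertible_elem (1 - z *\<^sub>C g)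
      \<and> invertible_elem (1 - (r *\<^sub>R z) *\<^sub>C g)
      \<and> norm (cinv (1 - z *\<^sub>C g) - cinv (1 - (r *\<^sub>R z) *\<^sub>C g)) \<le> e"
  and z: "cmod z = 1"
  shows "invertible_elem (1 - z *\<^sub>C (g * g)) \<and> invertible_elem (1 - ((r\<^sup>2) *\<^sub>R z) *\<^sub>C (g * g))
      \<and> norm (cinv (1 - z *\<^sub>C (g * g)) - cinv (1 - ((r\<^sup>2) *\<^sub>R z) *\<^sub>C (g * g))) \<le> e"
proof -
  \<comment> \<open>Both square roots \<open>w\<close> and \<open>- w\<close> lie on the unit
    circle, so the assumed bound controls both terms of the mean in \<open>resolvent_square\<close>;
    the factor \<open>r\<close> is squared together with \<open>g\<close>.\<close>
  define w where "w = csqrt z"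
  have w: "w * w = z" "cmod w = 1"
    using z by (simp_all add: w_def power2_eq_square[symmetric])
  define a b where "a = w *\<^sub>C g" and "b = (r *\<^sub>R w) *\<^sub>C g"
  have aa: "a * a = z *\<^sub>C (g * g)" and bb: "b * b = ((r\<^sup>2) *\<^sub>R z) *\<^sub>C (g * g)"
    by (simp_all add: a_def b_def mult_scaleC_left mult_scaleC_right scaleC_scaleC w(1)[symmetric]
      power2_eq_square scaleR_conv_of_real mult_ac)
  have p: "invertible_elem (1 - a)" "invertible_elem (1 - b)" "norm (cinv (1 - a) - cinv (1 - b)) \<le> e"
    using assms(1)[of w] w by (auto simp: a_def b_def)
  have m: "invertible_elem (1 + a)" "invertible_elem (1 + b)" "norm (cinv (1 + a) - cinv (1 + b)) \<le> e"
    using assms(1)[of "- w"] w by (auto simp: a_def b_def scaleC_minus_left)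
  have "cinv (1 - a * a) - cinv (1 - b * b)
      = (1/2) *\<^sub>R ((cinv (1 - a) - cinv (1 - b)) + (cinv (1 + a) - cinv (1 + b)))"
    using p m by (simp add: resolvent_square algebra_simps)
  moreover have "norm \<dots> \<le> e"
    using norm_triangle_ineq[of "cinv (1 - a) - cinv (1 - b)" "cinv (1 + a) - cinv (1 + b)"] p(3) m(3)
    by simp
  ultimately show ?thesis using p m unfolding aa[symmetric] bb[symmetric]
    by (simp add: resolvent_square)
qed

text \<open>After scaling to norm 1 it suffices that \<open>1 - z g\<close> fails to be invertible
  for some \<open>z\<close> in the closed disc. Otherwise the resolvent is uniformly continuous
  there, so its values at \<open>z\<close> and \<open>r z\<close> are close for some
  \<open>r < 1\<close>, uniformly on the circle. Doubling keeps this bound for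
  \<open>g^(2^m)\<close> and \<open>r^(2^m)\<close>. Once \<open>r^(2^m)\<close> is tiny the second
  resolvent is near 1, hence so is the first, which forces \<open>g^(2^m)\<close> to have norm below
  1; but the C*-identity keeps that norm equal to 1.\<close>

lemma norm_in_spectrum:
  fixes h :: "'a::cstar_algebra"
  assumes h: "star h = h"
  shows "\<exists>c\<in>spectrum h. cmod c = norm h"
proof (cases "h = 0")
  case True
  then show ?thesis by (intro bexI[of _ 0]) (auto simp: spectrum_iff)
next
  case False
  define g where "g = (1 / norm h) *\<^sub>R h"
  have g: "norm g = 1" "star g = g" using False h by (simp_all add: g_def star_scaleR)
  have gp: "norm (g ^ (2 ^ m)) = 1" for m :: nat
  proof (induction m)
    case (Suc m)
    have "g ^ (2 ^ Suc m) = g ^ (2 ^ m) * g ^ (2 ^ m)" by (simp add: mult_2 power_add)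
    then show ?case using Suc norm_square_selfadj[of "g ^ (2 ^ m)"] g by (simp add: star_power)
  qed (simp add: g)
  have "\<exists>z. cmod z \<le> 1 \<and> \<not> invertible_elem (1 - z *\<^sub>C g)"
  proof (rule ccontr)
    assume "\<not> ?thesis"
    then have inv: "invertible_elem (1 - z *\<^sub>C g)" if "cmod z \<le> 1" for z using that by blast
    define f where "f z = cinv (1 - z *\<^sub>C g)" for z
    have "continuous_on (cball 0 1) f"
    proof (intro continuous_at_imp_continuous_on ballI)
      fix z :: complex assume "z \<in> cball 0 1"
      then have "invertible_elem (1 - z *\<^sub>C g)" using inv by simp
      then have "isCont cinv (1 - z *\<^sub>C g)" by (rule isCont_cinv)
      moreover have "isCont (\<lambda>z. 1 - z *\<^sub>C g) z"
        unfolding isCont_def by (intro tendsto_intros)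
      ultimately show "isCont f z" unfolding f_def using isCont_o2 by blast
    qed
    then have "uniformly_continuous_on (cball 0 1) f"
      by (rule compact_uniformly_continuous) simp
    then obtain d where d: "d > 0"
      "\<And>x y. cmod x \<le> 1 \<Longrightarrow> cmod y \<le> 1 \<Longrightarrow> dist y x < d \<Longrightarrow> dist (f y) (f x) < 1/6"
      unfolding uniformly_continuous_on_def by (metis mem_cball_0 zero_less_divide_1_iff zero_less_numeral)
    \<comment> \<open>Halving \<open>min 1 d\<close> keeps \<open>r\<close> strictly between 0 and 1
      and \<open>r z\<close> within \<open>d\<close> of \<open>z\<close> on the circle.\<close>
    define r where "r = 1 - min 1 d / 2"
    have r: "0 < r" "r < 1" "1 - r < d" using d by (auto simp: r_def min_def)
    have "\<And>z. cmod z = 1 \<Longrightarrow> invertible_elem (1 - z *\<^sub>C g ^ (2 ^ m))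
        \<and> invertible_elem (1 - ((r ^ (2 ^ m)) *\<^sub>R z) *\<^sub>C g ^ (2 ^ m))
        \<and> norm (cinv (1 - z *\<^sub>C g ^ (2 ^ m)) - cinv (1 - ((r ^ (2 ^ m)) *\<^sub>R z) *\<^sub>C g ^ (2 ^ m))) \<le> 1/6"
      for m :: nat
    proof (induction m)
      case 0
      have "z - r *\<^sub>R z = (1 - r) *\<^sub>R z" by (simp add: algebra_simps)
      then have "dist z (r *\<^sub>R z) = 1 - r" using 0 r by (simp add: dist_norm)
      moreover have "cmod (r *\<^sub>R z) \<le> 1" using 0 r by simp
      ultimately have "dist (f z) (f (r *\<^sub>R z)) < 1/6" using d(2)[of "r *\<^sub>R z" z] 0 r by simp
      then show ?case using inv[of z] inv[of "r *\<^sub>R z"] 0 r by (simp add: f_def dist_norm)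
    next
      case (Suc m)
      have e: "g ^ (2 ^ Suc m) = g ^ (2 ^ m) * g ^ (2 ^ m)" "r ^ (2 ^ Suc m) = (r ^ (2 ^ m))\<^sup>2"
        by (simp_all add: mult_2 power_add power2_eq_square)
      show ?case unfolding e by (rule resolvent_doubling[OF Suc.IH Suc.prems])
    qed
    moreover have "((r ^ n) *\<^sub>R 1) *\<^sub>C x = (r ^ n) *\<^sub>R x" for n and x :: 'a
      by (simp only: scaleR_conv_of_real mult_1_right scaleC_of_real)
    ultimately have main: "invertible_elem (1 - g ^ (2 ^ m))"
      "norm (cinv (1 - g ^ (2 ^ m)) - cinv (1 - (r ^ (2 ^ m)) *\<^sub>R g ^ (2 ^ m))) \<le> 1/6" for m :: nat
      by (metis norm_one scaleC_one)+
    have "(\<lambda>n. r ^ n) \<longlonglongrightarrow> 0" using r by (simp add: LIMSEQ_power_zero)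
    then have "\<forall>\<^sub>F n in sequentially. r ^ n < 1/12" by (rule order_tendstoD) simp
    then obtain m0 where m0: "\<And>n. n \<ge> m0 \<Longrightarrow> r ^ n < 1/12"
      by (auto simp: eventually_sequentially)
    define m where "m = m0"
    \<comment> \<open>The exponent \<open>2 ^ m\<close> is at least \<open>m0\<close>. The estimate
      \<open>cinv_near\<close> at 1 doubles 1/12 to 1/6; together with the 1/6 preserved by doubling
      this gives 1/3, and the contradiction will be \<open>norm k\<close> at most 1/3 + 1/3.\<close>
    have rm: "r ^ (2 ^ m) < 1/12" using m0[of "2 ^ m"] by (simp add: m_def less_imp_le)
    define k v where "k = g ^ (2 ^ m)" and "v = cinv (1 - (r ^ (2 ^ m)) *\<^sub>R k)"
    have k: "norm k = 1" using gp by (simp add: k_def)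
    have kr: "norm ((1 - (r ^ (2 ^ m)) *\<^sub>R k) - 1) \<le> 1/12"
      using rm r k by simp
    then have "norm (v - 1) \<le> 2 * (1/12)"
      using cinv_near[of 1 "1 - (r ^ (2 ^ m)) *\<^sub>R k"] by (simp add: v_def)
    moreover have "norm (cinv (1 - k) - v) \<le> 1/6" using main(2) by (simp add: v_def k_def)
    ultimately have e: "norm (cinv (1 - k) - 1) \<le> 1/3"
      using norm_triangle_ineq[of "cinv (1 - k) - v" "v - 1"] by simp
    have "cinv (1 - k) * (1 - k) = 1" using main(1) by (simp add: k_def cinv_left)
    then have "k = (cinv (1 - k) - 1) - (cinv (1 - k) - 1) * k"
      by (simp add: algebra_simps)
    then have "norm k \<le> norm (cinv (1 - k) - 1) + norm ((cinv (1 - k) - 1) * k)"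
      using norm_triangle_ineq4[of "cinv (1 - k) - 1" "(cinv (1 - k) - 1) * k"] by simp
    moreover have "norm ((cinv (1 - k) - 1) * k) \<le> norm (cinv (1 - k) - 1) * norm k"
      by (rule norm_mult_ineq)
    ultimately have "norm k \<le> norm (cinv (1 - k) - 1) + norm (cinv (1 - k) - 1) * norm k"
      by simp
    then show False using e k by simp
  qed
  then obtain z where z: "cmod z \<le> 1" "\<not> invertible_elem (1 - z *\<^sub>C g)" by blast
  then have z0: "z \<noteq> 0" by auto
  define c where "c = complex_of_real (norm h) / z"
  have c0: "c \<noteq> 0" using z0 False by (simp add: c_def)
  have "h - c *\<^sub>C 1 = (- c) *\<^sub>C (1 - z *\<^sub>C g)"
  proof -
    have "c *\<^sub>C z *\<^sub>C g = complex_of_real (norm h) *\<^sub>C g" using z0 by (simp add: c_def scaleC_scaleC)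
    also have "\<dots> = h" using False by (simp add: scaleC_of_real g_def)
    finally show ?thesis by (simp add: scaleC_minus_left scaleC_diff_right)
  qed
  then have "c \<in> spectrum h" using z(2) c0 by (simp add: spectrum_iff invertible_scaleC_iff)
  moreover have "cmod c \<ge> norm h" using z(1) z0
    by (simp add: c_def norm_divide field_simps mult_left_le)
  ultimately show ?thesis using spectrum_norm_le[of c h] by force
qed

lemma spectrum_nonempty: "star h = h \<Longrightarrow> spectrum (h::'a::cstar_algebra) \<noteq> {}"
  using norm_in_spectrum by blast

section \<open>Continuous functional calculus\<close>

definition poly_at :: "complex poly \<Rightarrow> 'a::cstar_algebra \<Rightarrow> 'a"
  where "poly_at p x = fold_coeffs (\<lambda>a y. a *\<^sub>C 1 + x * y) p 0"

lemma poly_at_0 [simp]: "poly_at 0 x = 0"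
  by (simp add: poly_at_def)

lemma poly_at_pCons [simp]: "poly_at (pCons a p) x = a *\<^sub>C 1 + x * poly_at p x"
  by (cases "p = 0 \<and> a = 0") (auto simp: poly_at_def)

lemma poly_at_add: "poly_at (p + q) x = poly_at p x + poly_at q x"
  by (induction p q rule: poly_induct2) (simp_all add: scaleC_add_left algebra_simps)

lemma poly_at_smult: "poly_at (smult c p) x = c *\<^sub>C poly_at p x"
  by (induction p) (simp_all add: scaleC_add_right mult_scaleC_right scaleC_scaleC)

lemma poly_at_diff: "poly_at (p - q) x = poly_at p x - poly_at q x"
  using poly_at_add[of "p - q" q x] by (simp add: algebra_simps)

lemma poly_at_commute: "x * poly_at p x = poly_at p x * x"
  by (induction p)
    (simp_all add: mult_scaleC_left mult_scaleC_right distrib_left distrib_right, metis mult.assoc)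

lemma poly_at_mult: "poly_at (p * q) x = poly_at p x * poly_at q x"
  by (induction p)
    (simp_all add: poly_at_add poly_at_smult mult_scaleC_left distrib_right mult.assoc)

lemma poly_at_cnj:
  "star x = x \<Longrightarrow> poly_at (map_poly cnj p) x = star (poly_at p x)"
  by (induction p)
    (simp_all add: map_poly_pCons star_add star_scaleC star_mult poly_at_commute[symmetric],
      metis poly_at_commute star_mult star_star)

lemma poly_map_cnj: "poly (map_poly cnj p) (cnj z) = cnj (poly p z)"
  by (induction p) (simp_all add: map_poly_pCons)

lemma poly_at_factor:
  "poly_at p x - poly p c *\<^sub>C 1 = (x - c *\<^sub>C 1) * poly_at (synthetic_div p c) x"
proof -
  have "poly_at p x = poly_at ([:- c, 1:] * synthetic_div p c + [:poly p c:]) x"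
    by (simp only: synthetic_div_correct')
  then show ?thesis
    by (simp only: poly_at_add poly_at_mult) (simp add: scaleC_minus_left)
qed

lemma poly_in_spectrum:
  assumes "c \<in> spectrum x"
  shows "poly p c \<in> spectrum (poly_at p x)"
proof -
  have "(x - c *\<^sub>C 1) * poly_at q x = poly_at q x * (x - c *\<^sub>C 1)" for q
    by (simp add: algebra_simps poly_at_commute mult_scaleC_left mult_scaleC_right)
  then show ?thesis
    using assms invertible_commuting_factor by (metis poly_at_factor spectrum_iff)
qed

text \<open>Over the complex numbers \<open>p\<close> splits into linear factors. If no root were a
  spectral point, \<open>poly_at p x\<close> would be a product of invertible elements.\<close>

lemma root_in_spectrum:
  assumes "p \<noteq> 0" "\<not> invertible_elem (poly_at p x)"
  shows "\<exists>c\<in>spectrum x. poly p c = 0"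
  using assms
proof (induction "degree p" arbitrary: p)
  case 0
  then obtain a where "p = [:a:]" "a \<noteq> 0" by (metis degree_eq_zeroE pCons_0_0)
  then show ?case using 0 invertible_scaleC_iff[of a "1::'a"] by simp
next
  case (Suc n)
  have "\<not> constant (poly p)" using Suc.hyps(2) by (simp add: constant_degree)
  then obtain c where c: "poly p c = 0" using fundamental_theorem_of_algebra by blast
  define q where "q = synthetic_div p c"
  have pq: "p = [:- c, 1:] * q" using synthetic_div_correct'[of c p] c by (simp add: q_def)
  have eq: "poly_at p x = (x - c *\<^sub>C 1) * poly_at q x"
    using poly_at_factor[of p x c] c by (simp add: q_def)
  show ?case
  proof (cases "c \<in> spectrum x")
    case False
    then have "\<not> invertible_elem (poly_at q x)"
      using eq Suc.prems(2) invertible_mult spectrum_iff by metis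
    moreover have "q \<noteq> 0" using pq Suc.prems(1) by auto
    moreover have "n = degree q" using Suc.hyps(2) by (simp add: q_def degree_synthetic_div)
    ultimately obtain d where "d \<in> spectrum x" "poly q d = 0" using Suc.hyps(1) by blast
    then show ?thesis using pq by auto
  qed (use c in auto)
qed

lemma spectrum_poly_at:
  assumes "star x = x"
  shows "spectrum (poly_at p x) = poly p ` spectrum x"
proof
  show "poly p ` spectrum x \<subseteq> spectrum (poly_at p x)" using poly_in_spectrum by blast
  show "spectrum (poly_at p x) \<subseteq> poly p ` spectrum x"
  proof
    fix m assume m: "m \<in> spectrum (poly_at p x)"
    show "m \<in> poly p ` spectrum x"
    proof (cases "p = [:m:]")
      \<comment> \<open>Here \<open>p - [:m:]\<close> is the zero polynomial, to which
        \<open>root_in_spectrum\<close> does not apply; any point of the nonempty spectrum does the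
        job.\<close>
      case True
      then show ?thesis using spectrum_nonempty[OF assms] by auto
    next
      case False
      then have "\<exists>c\<in>spectrum x. poly (p - [:m:]) c = 0"
        using m by (intro root_in_spectrum) (auto simp: spectrum_iff poly_at_diff)
      then show ?thesis by force
    qed
  qed
qed

text \<open>A complex polynomial in \<open>x\<close> need not be self-adjoint, so
  \<open>norm_in_spectrum\<close> is applied to \<open>star (poly_at p x) * poly_at p x\<close>.
  This is again a polynomial in \<open>x\<close>, and on the real spectrum its values are the
  squared moduli of those of \<open>p\<close>.\<close>

lemma norm_poly_at_attained:
  fixes x :: "'a::cstar_algebra"
  assumes x: "star x = x"
  shows "\<exists>c\<in>spectrum x. norm (poly_at p x) = cmod (poly p c)"
proof -
  let ?q = "map_poly cnj p * p"
  have q: "poly_at ?q x = star (poly_at p x) * poly_at p x"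
    using x by (simp add: poly_at_mult poly_at_cnj)
  have "star (poly_at ?q x) = poly_at ?q x" by (simp add: q star_mult star_star)
  from norm_in_spectrum[OF this] obtain c where
    c: "c \<in> spectrum x" "cmod (poly ?q c) = norm (poly_at ?q x)"
    using spectrum_poly_at[OF x, of ?q] by auto
  have "cnj c = c" using spectrum_real[OF x c(1)] by (simp add: complex_eq_iff)
  then have "poly (map_poly cnj p) c = cnj (poly p c)" using poly_map_cnj[of p c] by simp
  then have "(cmod (poly p c))\<^sup>2 = (norm (poly_at p x))\<^sup>2"
    using c(2) by (simp add: q cstar_identity norm_mult power2_eq_square)
  then show ?thesis using c(1) power2_eq_imp_eq[of "cmod (poly p c)"] by force
qed

section \<open>Uniform limits of polynomials on the spectrum\<close>

text \<open>The graph of the continuous functional calculus, kept as a relation: algebraic laws then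
  follow by combining approximating sequences, before existence and uniqueness of the value are
  settled.\<close>

definition poly_limit_at :: "'a::cstar_algebra \<Rightarrow> (complex \<Rightarrow> complex) \<Rightarrow> 'a \<Rightarrow> bool"
  where "poly_limit_at x f y \<longleftrightarrow>
    (\<exists>P. uniform_limit (spectrum x) (\<lambda>n. poly (P n)) f sequentially
       \<and> (\<lambda>n. poly_at (P n) x) \<longlonglongrightarrow> y)"

lemma poly_limit_at_norm_ge:
  assumes "poly_limit_at x f y" "c \<in> spectrum x"
  shows "cmod (f c) \<le> norm y"
proof -
  obtain P where P: "uniform_limit (spectrum x) (\<lambda>n. poly (P n)) f sequentially"
    "(\<lambda>n. poly_at (P n) x) \<longlonglongrightarrow> y"
    using assms(1) by (auto simp: poly_limit_at_def)
  have "(\<lambda>n. poly (P n) c) \<longlonglongrightarrow> f c" using P(1) assms(2) by (rule tendsto_uniform_limitI)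
  then show ?thesis
    by (intro tendsto_le[OF _ tendsto_norm[OF P(2)] tendsto_norm])
      (auto intro!: always_eventually spectrum_norm_le poly_in_spectrum assms(2))
qed

lemma poly_limit_at_norm_le:
  assumes x: "star x = x" and "poly_limit_at x f y" "\<And>c. c \<in> spectrum x \<Longrightarrow> cmod (f c) \<le> B"
  shows "norm y \<le> B"
proof (rule field_le_epsilon)
  fix e :: real assume e: "e > 0"
  obtain P where P: "uniform_limit (spectrum x) (\<lambda>n. poly (P n)) f sequentially"
    "(\<lambda>n. poly_at (P n) x) \<longlonglongrightarrow> y"
    using assms(2) by (auto simp: poly_limit_at_def)
  have "\<forall>\<^sub>F n in sequentially. norm (poly_at (P n) x) \<le> B + e"
    using uniform_limitD[OF P(1) e]
  proof eventually_elim
    case (elim n)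
    obtain c where c: "c \<in> spectrum x" "norm (poly_at (P n) x) = cmod (poly (P n) c)"
      using norm_poly_at_attained[OF x] by blast
    then show ?case
      using elim assms(3)[OF c(1)] norm_triangle_ineq2[of "poly (P n) c" "f c"]
      by (force simp: dist_norm)
  qed
  then show "norm y \<le> B + e" using tendsto_norm[OF P(2)] tendsto_upperbound by force
qed

lemma poly_fun_add: "poly (p + q) = (\<lambda>c. poly p c + poly q c)"
  and poly_fun_mult: "poly (p * q) = (\<lambda>c. poly p c * poly q c)"
  and poly_fun_const: "poly [:a:] = (\<lambda>_. a)"
  by (auto simp: fun_eq_iff)

lemma poly_limit_at_add:
  assumes "poly_limit_at x f y" "poly_limit_at x g z"
  shows "poly_limit_at x (\<lambda>c. f c + g c) (y + z)"
proof -
  obtain P Q where "uniform_limit (spectrum x) (\<lambda>n. poly (P n)) f sequentially"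
    "(\<lambda>n. poly_at (P n) x) \<longlonglongrightarrow> y" "uniform_limit (spectrum x) (\<lambda>n. poly (Q n)) g sequentially"
    "(\<lambda>n. poly_at (Q n) x) \<longlonglongrightarrow> z"
    using assms by (auto simp: poly_limit_at_def)
  then show ?thesis unfolding poly_limit_at_def
    by (intro exI[of _ "\<lambda>n. P n + Q n"]) (auto simp: poly_at_add poly_fun_add intro!: uniform_limit_add tendsto_add)
qed

lemma poly_limit_at_mult:
  assumes "poly_limit_at x f y" "poly_limit_at x g z"
  shows "poly_limit_at x (\<lambda>c. f c * g c) (y * z)"
proof -
  obtain P Q where "uniform_limit (spectrum x) (\<lambda>n. poly (P n)) f sequentially"
    "(\<lambda>n. poly_at (P n) x) \<longlonglongrightarrow> y" "uniform_limit (spectrum x) (\<lambda>n. poly (Q n)) g sequentially"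
    "(\<lambda>n. poly_at (Q n) x) \<longlonglongrightarrow> z"
    using assms by (auto simp: poly_limit_at_def)
  \<comment> \<open>A product of uniform limits converges uniformly only if the factors are bounded;
    here the norms of \<open>y\<close> and \<open>z\<close> are the bounds.\<close>
  moreover have "bounded (f ` spectrum x)" "bounded (g ` spectrum x)"
    using poly_limit_at_norm_ge assms unfolding bounded_iff by blast+
  ultimately show ?thesis unfolding poly_limit_at_def
    by (intro exI[of _ "\<lambda>n. P n * Q n"]) (auto simp: poly_at_mult poly_fun_mult intro!: uniform_lim_mult tendsto_mult)
qed

lemma poly_limit_at_poly: "poly_limit_at x (poly p) (poly_at p x)"
  unfolding poly_limit_at_def
  by (intro exI[of _ "\<lambda>_. p"]) (auto intro: uniform_limit_const)

lemma poly_limit_at_const: "poly_limit_at x (\<lambda>_. c) (c *\<^sub>C 1)"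
  using poly_limit_at_poly[of x "[:c:]"] by (simp add: poly_fun_const)

lemma poly_limit_at_id: "poly_limit_at x (\<lambda>z. z) x"
proof -
  have "poly [:0, 1:] = (\<lambda>z::complex. z)" by (simp add: fun_eq_iff)
  then show ?thesis using poly_limit_at_poly[of x "[:0, 1:]"] by simp
qed

lemma poly_limit_at_scaleC:
  "poly_limit_at x f y \<Longrightarrow> poly_limit_at x (\<lambda>z. c * f z) (c *\<^sub>C y)"
  using poly_limit_at_mult[OF poly_limit_at_const[of x c]] by (force simp: mult_scaleC_left)

lemma poly_limit_at_cnj:
  assumes x: "star x = x" and "poly_limit_at x f y"
  shows "poly_limit_at x (\<lambda>z. cnj (f z)) (star y)"
proof -
  obtain P where P: "uniform_limit (spectrum x) (\<lambda>n. poly (P n)) f sequentially"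
    "(\<lambda>n. poly_at (P n) x) \<longlonglongrightarrow> y"
    using assms by (auto simp: poly_limit_at_def)
  have "dist (poly (map_poly cnj p) c) (cnj (f c)) = dist (poly p c) (f c)"
    if "c \<in> spectrum x" for p c
  proof -
    have "cnj c = c" using spectrum_real[OF x that] by (simp add: complex_eq_iff)
    then have "poly (map_poly cnj p) c = cnj (poly p c)" using poly_map_cnj[of p c] by simp
    then show ?thesis by (metis complex_cnj_diff complex_mod_cnj dist_norm)
  qed
  then have "uniform_limit (spectrum x) (\<lambda>n. poly (map_poly cnj (P n))) (\<lambda>z. cnj (f z)) sequentially"
    using P(1) unfolding uniform_limit_iff by simp
  moreover have "(\<lambda>n. poly_at (map_poly cnj (P n)) x) \<longlonglongrightarrow> star y"
    using tendsto_star[OF P(2)] by (simp add: poly_at_cnj x)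
  ultimately show ?thesis unfolding poly_limit_at_def by (intro exI conjI)
qed

lemma poly_limit_at_unique:
  assumes "star x = x" "poly_limit_at x f y" "poly_limit_at x f z"
  shows "y = z"
proof -
  have "poly_limit_at x (\<lambda>c. f c + (-1) * f c) (y + (-1) *\<^sub>C z)"
    by (intro poly_limit_at_add poly_limit_at_scaleC assms)
  then have "norm (y + (-1) *\<^sub>C z) \<le> 0" by (rule poly_limit_at_norm_le[OF assms(1)]) simp
  then show ?thesis by (simp add: scaleC_minus_left)
qed

text \<open>Since \<open>S\<close> lies on the real axis, the real Weierstrass theorem applies to
  the real and the imaginary part of \<open>f\<close> separately, each to within
  \<open>e / 2\<close>.\<close>

lemma Weierstrass_complex_poly:
  fixes S :: "complex set"
  assumes S: "compact S" "\<And>c. c \<in> S \<Longrightarrow> Im c = 0" and f: "continuous_on S f" and e: "e > 0"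
  shows "\<exists>p. \<forall>c\<in>S. cmod (poly p c - f c) < e"
proof -
  have real: "\<exists>p. \<forall>c\<in>S. cmod (poly p c - complex_of_real (g c)) < e / 2"
    if g: "continuous_on S g" for g :: "complex \<Rightarrow> real"
  proof -
    have cg: "continuous_on (Re ` S) (\<lambda>t. g (complex_of_real t))"
    proof (rule continuous_on_compose2[OF g])
      show "complex_of_real ` Re ` S \<subseteq> S"
        using S(2) by (auto simp: complex_of_real_def complex_eq_iff) (metis complex.collapse)
    qed (intro continuous_intros)
    have "compact (Re ` S)" by (intro compact_continuous_image continuous_intros S(1))
    then obtain h where h: "real_polynomial_function h"
      "\<And>t. t \<in> Re ` S \<Longrightarrow> \<bar>g (complex_of_real t) - h t\<bar> < e / 2"
      using Stone_Weierstrass_real_polynomial_function[OF _ cg] e by (metis half_gt_zero)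
    then obtain a n where a: "h = (\<lambda>t. \<Sum>i\<le>n. a i * t ^ i)"
      using real_polynomial_function_iff_sum by blast
    define p where "p = (\<Sum>i\<le>n. monom (complex_of_real (a i)) i)"
    have "cmod (poly p c - complex_of_real (g c)) < e / 2" if c: "c \<in> S" for c
    proof -
      have cr: "complex_of_real (Re c) = c" using S(2)[OF c] by (simp add: complex_eq_iff)
      have "poly p (complex_of_real t) = complex_of_real (h t)" for t
        by (simp add: p_def a poly_sum poly_monom)
      from this[of "Re c"] have "poly p c = complex_of_real (h (Re c))" by (simp add: cr)
      then have "cmod (poly p c - complex_of_real (g c)) = \<bar>g c - h (Re c)\<bar>"
        by (metis abs_minus_commute norm_of_real of_real_diff)
      also have "\<dots> < e / 2" using h(2)[of "Re c"] c by (simp add: cr)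
      finally show ?thesis .
    qed
    then show ?thesis by blast
  qed
  obtain p where p: "\<forall>c\<in>S. cmod (poly p c - complex_of_real (Re (f c))) < e / 2"
    using real[of "\<lambda>c. Re (f c)"] f by (auto intro: continuous_intros)
  obtain q where q: "\<forall>c\<in>S. cmod (poly q c - complex_of_real (Im (f c))) < e / 2"
    using real[of "\<lambda>c. Im (f c)"] f by (auto intro: continuous_intros)
  have "cmod (poly (p + smult \<i> q) c - f c) < e" if c: "c \<in> S" for c
  proof -
    have "poly (p + smult \<i> q) c - f c
        = (poly p c - complex_of_real (Re (f c))) + \<i> * (poly q c - complex_of_real (Im (f c)))"
      by (simp add: complex_eq_iff)
    also have "cmod \<dots> < e / 2 + e / 2"
      by (rule order_le_less_trans[OF norm_triangle_ineq])
        (use bspec[OF p c] bspec[OF q c] in \<open>simp add: norm_mult\<close>)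
    finally show ?thesis by simp
  qed
  then show ?thesis by blast
qed

text \<open>The norm of a polynomial in \<open>x\<close> is attained on the spectrum, so uniform
  convergence there makes the values at \<open>x\<close> a Cauchy sequence.\<close>

lemma poly_limit_at_exists:
  fixes x :: "'a::cstar_algebra"
  assumes x: "star x = x" and f: "continuous_on (spectrum x) f"
  shows "\<exists>y. poly_limit_at x f y"
proof -
  have "\<forall>n. \<exists>p. \<forall>c\<in>spectrum x. cmod (poly p c - f c) < inverse (real (Suc n))"
    using Weierstrass_complex_poly[OF compact_spectrum spectrum_real[OF x] f] by simp
  then obtain P where P: "\<And>n c. c \<in> spectrum x \<Longrightarrow> cmod (poly (P n) c - f c) < inverse (real (Suc n))"
    by metis
  have ul: "uniform_limit (spectrum x) (\<lambda>n. poly (P n)) f sequentially"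
  proof (rule uniform_limitI)
    fix e :: real assume "e > 0"
    then obtain N where N: "inverse (real (Suc N)) < e" using reals_Archimedean by blast
    have "inverse (real (Suc n)) < e" if "n \<ge> N" for n
      using that N by (meson le_imp_inverse_le of_nat_0_less_iff of_nat_le_iff order_le_less_trans
          Suc_le_mono zero_less_Suc)
    then show "\<forall>\<^sub>F n in sequentially. \<forall>c\<in>spectrum x. dist (poly (P n) c) (f c) < e"
      using P unfolding eventually_sequentially dist_norm by (meson order_less_trans)
  qed
  have "Cauchy (\<lambda>n. poly_at (P n) x)"
  proof (rule metric_CauchyI)
    fix e :: real assume "e > 0"
    then have "e / 2 > 0" by simp
    from uniform_limitD[OF ul this] obtain N where
      N: "\<And>n c. n \<ge> N \<Longrightarrow> c \<in> spectrum x \<Longrightarrow> dist (poly (P n) c) (f c) < e / 2"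
      unfolding eventually_sequentially by blast
    have "dist (poly_at (P m) x) (poly_at (P n) x) < e" if "m \<ge> N" "n \<ge> N" for m n
    proof -
      obtain c where c: "c \<in> spectrum x"
        "norm (poly_at (P m - P n) x) = cmod (poly (P m - P n) c)"
        using norm_poly_at_attained[OF x] by blast
      have "dist (poly (P m) c) (poly (P n) c) < e"
        using dist_triangle_half_l N that c(1) by metis
      then show ?thesis using c(2) by (simp add: poly_at_diff dist_norm)
    qed
    then show "\<exists>M. \<forall>m\<ge>M. \<forall>n\<ge>M. dist (poly_at (P m) x) (poly_at (P n) x) < e" by blast
  qed
  then obtain y where "(\<lambda>n. poly_at (P n) x) \<longlonglongrightarrow> y" using Cauchy_convergent convergent_def by blast
  then show ?thesis using ul unfolding poly_limit_at_def by blast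
qed

lemma poly_limit_at_norm_SUP:
  assumes x: "star x = x" and y: "poly_limit_at x f y"
  shows "norm y = (SUP z\<in>spectrum x. cmod (f z))"
proof (rule antisym)
  have bdd: "bdd_above ((\<lambda>z. cmod (f z)) ` spectrum x)"
    using poly_limit_at_norm_ge[OF y] by (auto intro!: bdd_aboveI2)
  show "norm y \<le> (SUP z\<in>spectrum x. cmod (f z))"
    using bdd by (intro poly_limit_at_norm_le[OF x y] cSUP_upper)
  show "(SUP z\<in>spectrum x. cmod (f z)) \<le> norm y"
    using poly_limit_at_norm_ge[OF y] spectrum_nonempty[OF x] by (intro cSUP_least)
qed

section \<open>Existence and uniqueness of the functional calculus\<close>

lemma functional_calculus_exists:
  fixes x :: "'a::cstar_algebra"
  assumes x: "star x = x"
  shows "\<exists>\<Phi>. functional_calculus x \<Phi>"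
proof -
  define \<Phi> where "\<Phi> f = (SOME y. poly_limit_at x f y)" for f
  have \<Phi>: "poly_limit_at x f (\<Phi> f)" if "continuous_on (spectrum x) f" for f
    unfolding \<Phi>_def using poly_limit_at_exists[OF x that] by (rule someI_ex)
  have eq: "\<Phi> f = y" if "poly_limit_at x f y" for f y
    unfolding \<Phi>_def by (rule poly_limit_at_unique[OF x someI[of "poly_limit_at x f", OF that] that])
  have "functional_calculus x \<Phi>"
    unfolding functional_calculus_def
  proof (intro conjI allI impI)
    show "\<Phi> (\<lambda>z. 1) = 1" using eq[OF poly_limit_at_const[of x 1]] by simp
    show "\<Phi> (\<lambda>z. z) = x" by (rule eq[OF poly_limit_at_id])
  qed (auto intro!: eq poly_limit_at_add poly_limit_at_mult poly_limit_at_scaleC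
      poly_limit_at_cnj[OF x] poly_limit_at_norm_SUP[OF x] \<Phi>)
  then show ?thesis by blast
qed

lemma
  assumes \<Phi>: "functional_calculus x \<Phi>"
  shows functional_calculus_one: "\<Phi> (\<lambda>z. 1) = 1"
    and functional_calculus_id: "\<Phi> (\<lambda>z. z) = x"
    and functional_calculus_add: "continuous_on (spectrum x) f \<Longrightarrow> continuous_on (spectrum x) g \<Longrightarrow>
      \<Phi> (\<lambda>z. f z + g z) = \<Phi> f + \<Phi> g"
    and functional_calculus_mult: "continuous_on (spectrum x) f \<Longrightarrow> continuous_on (spectrum x) g \<Longrightarrow>
      \<Phi> (\<lambda>z. f z * g z) = \<Phi> f * \<Phi> g"
    and functional_calculus_scaleC: "continuous_on (spectrum x) f \<Longrightarrow> \<Phi> (\<lambda>z. c * f z) = c *\<^sub>C \<Phi> f"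
    and functional_calculus_star: "continuous_on (spectrum x) f \<Longrightarrow> \<Phi> (\<lambda>z. cnj (f z)) = star (\<Phi> f)"
    and functional_calculus_norm:
      "continuous_on (spectrum x) f \<Longrightarrow> norm (\<Phi> f) = (SUP z\<in>spectrum x. cmod (f z))"
  using \<Phi> unfolding functional_calculus_def by blast+

lemma functional_calculus_poly:
  assumes \<Phi>: "functional_calculus x \<Phi>"
  shows "\<Phi> (poly p) = poly_at p x"
proof (induction p)
  case 0
  have "\<Phi> (\<lambda>z. 0 * z) = 0 *\<^sub>C \<Phi> (\<lambda>z. z)"
    by (rule functional_calculus_scaleC[OF \<Phi>]) (rule continuous_on_id)
  then show ?case by simp
next
  case (pCons a p)
  have c: "continuous_on (spectrum x) (\<lambda>z. 1 :: complex)" "continuous_on (spectrum x) (\<lambda>z. a * 1)"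
    "continuous_on (spectrum x) (poly p)" "continuous_on (spectrum x) (\<lambda>z. z)"
    "continuous_on (spectrum x) (\<lambda>z. z * poly p z)"
    by (intro continuous_intros)+
  show ?case
    using functional_calculus_scaleC[OF \<Phi> c(1), of a] functional_calculus_mult[OF \<Phi> c(4,3)]
      functional_calculus_add[OF \<Phi> c(2,5)]
    by (simp add: pCons.IH functional_calculus_one[OF \<Phi>] functional_calculus_id[OF \<Phi>])
qed

text \<open>The axioms fix \<Phi> on polynomials, and the isometry condition, applied to
  \<open>f\<close> minus a polynomial, fixes it on their uniform limits. Hence the choice hidden in
  \<open>cfc\<close> does not affect values at continuous functions.\<close>

lemma functional_calculus_poly_limit:
  fixes x :: "'a::cstar_algebra"
  assumes x: "star x = x" and \<Phi>: "functional_calculus x \<Phi>" and f: "continuous_on (spectrum x) f"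
  shows "poly_limit_at x f (\<Phi> f)"
proof -
  obtain y where "poly_limit_at x f y" using poly_limit_at_exists[OF x f] ..
  then obtain P where P: "uniform_limit (spectrum x) (\<lambda>n. poly (P n)) f sequentially"
    unfolding poly_limit_at_def by blast
  have diff: "norm (\<Phi> f - \<Phi> g) = (SUP z\<in>spectrum x. cmod (f z - g z))"
    if g: "continuous_on (spectrum x) g" for g
  proof -
    have g': "continuous_on (spectrum x) (\<lambda>z. (-1) * g z)" by (intro continuous_intros g)
    have "\<Phi> (\<lambda>z. (-1) * g z) = (-1) *\<^sub>C \<Phi> g"
      by (rule functional_calculus_scaleC[OF \<Phi> g])
    moreover have "\<Phi> (\<lambda>z. f z + (-1) * g z) = \<Phi> f + \<Phi> (\<lambda>z. (-1) * g z)"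
      by (rule functional_calculus_add[OF \<Phi> f g'])
    ultimately have "\<Phi> f - \<Phi> g = \<Phi> (\<lambda>z. f z + (-1) * g z)"
      by (simp add: scaleC_minus_left)
    moreover have "continuous_on (spectrum x) (\<lambda>z. f z + (-1) * g z)" by (intro continuous_intros f g)
    ultimately show ?thesis using functional_calculus_norm[OF \<Phi>] by simp
  qed
  have "(\<lambda>n. poly_at (P n) x) \<longlonglongrightarrow> \<Phi> f"
  proof (rule tendstoI)
    fix e :: real assume e: "e > 0"
    then have "e / 2 > 0" by simp
    from uniform_limitD[OF P this] show "\<forall>\<^sub>F n in sequentially. dist (poly_at (P n) x) (\<Phi> f) < e"
    proof eventually_elim
      case (elim n)
      have "norm (\<Phi> f - \<Phi> (poly (P n))) = (SUP z\<in>spectrum x. cmod (f z - poly (P n) z))"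
        by (intro diff continuous_intros)
      also have "\<dots> \<le> e / 2"
        using elim spectrum_nonempty[OF x] by (intro cSUP_least) (auto simp: dist_norm norm_minus_commute less_imp_le)
      finally show ?case using e by (simp add: functional_calculus_poly[OF \<Phi>] dist_norm norm_minus_commute)
    qed
  qed
  then show ?thesis using P unfolding poly_limit_at_def by blast
qed

lemma functional_calculus_cfc: "star x = x \<Longrightarrow> functional_calculus x (\<lambda>f. cfc f x)"
  unfolding cfc_def using functional_calculus_exists someI_ex[of "functional_calculus x"] by force

lemma poly_limit_at_cfc:
  "star x = x \<Longrightarrow> continuous_on (spectrum x) f \<Longrightarrow> poly_limit_at x f (cfc f x)"
  using functional_calculus_poly_limit[OF _ functional_calculus_cfc] by blast

lemma cfc_eqI:
  "star x = x \<Longrightarrow> continuous_on (spectrum x) f \<Longrightarrow> poly_limit_at x f y \<Longrightarrow> cfc f x = y"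
  using poly_limit_at_cfc poly_limit_at_unique by metis

lemma poly_limit_at_cong:
  "poly_limit_at x f y \<Longrightarrow> (\<And>c. c \<in> spectrum x \<Longrightarrow> f c = g c) \<Longrightarrow> poly_limit_at x g y"
  unfolding poly_limit_at_def uniform_limit_iff by simp

lemma cfc_cong:
  assumes "star x = x" "continuous_on (spectrum x) f" "\<And>c. c \<in> spectrum x \<Longrightarrow> f c = g c"
  shows "cfc f x = cfc g x"
proof -
  have "continuous_on (spectrum x) g" using assms continuous_on_cong by metis
  then show ?thesis
    using cfc_eqI[OF assms(1)] poly_limit_at_cong[OF poly_limit_at_cfc] assms by metis
qed

text \<open>If \<open>c\<close> is not a value of \<open>f\<close>, the reciprocal of
  \<open>f - c\<close> is continuous on the spectrum and provides the inverse. Conversely,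
  invertibility of \<open>cfc f x - f c\<close> would spread to the approximating
  \<open>poly_at (P n) x - poly (P n) c\<close>, which are never invertible.\<close>

lemma spectrum_cfc:
  fixes x :: "'a::cstar_algebra"
  assumes x: "star x = x" and f: "continuous_on (spectrum x) f"
  shows "spectrum (cfc f x) = f ` spectrum x"
proof
  note lim = poly_limit_at_cfc[OF x f]
  have shift: "poly_limit_at x (\<lambda>z. f z - c) (cfc f x - c *\<^sub>C 1)" for c
    using poly_limit_at_add[OF lim poly_limit_at_const[of x "- c"]] by (simp add: scaleC_minus_left)
  show "spectrum (cfc f x) \<subseteq> f ` spectrum x"
  proof
    fix c assume c: "c \<in> spectrum (cfc f x)"
    show "c \<in> f ` spectrum x"
    proof (rule ccontr)
      assume nc: "c \<notin> f ` spectrum x"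
      then have ne: "f z - c \<noteq> 0" if "z \<in> spectrum x" for z using that by auto
      define g where "g z = inverse (f z - c)" for z
      have g: "continuous_on (spectrum x) g"
        unfolding g_def using ne by (intro continuous_intros f) auto
      note l = poly_limit_at_mult[OF shift[of c] poly_limit_at_cfc[OF x g]]
        poly_limit_at_mult[OF poly_limit_at_cfc[OF x g] shift[of c]]
      have "poly_limit_at x (\<lambda>_. 1) ((cfc f x - c *\<^sub>C 1) * cfc g x)"
        by (rule poly_limit_at_cong[OF l(1)]) (use ne in \<open>simp add: g_def\<close>)
      moreover have "poly_limit_at x (\<lambda>_. 1) (cfc g x * (cfc f x - c *\<^sub>C 1))"
        by (rule poly_limit_at_cong[OF l(2)]) (use ne in \<open>simp add: g_def\<close>)
      ultimately have "invertible_elem (cfc f x - c *\<^sub>C 1)"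
        using poly_limit_at_unique[OF x] poly_limit_at_const[of x 1]
        by (intro invertibleI[of _ "cfc g x"]) (metis scaleC_one)+
      then show False using c by (simp add: spectrum_iff)
    qed
  qed
  show "f ` spectrum x \<subseteq> spectrum (cfc f x)"
  proof (rule image_subsetI, rule ccontr)
    fix c assume c: "c \<in> spectrum x" and "f c \<notin> spectrum (cfc f x)"
    then have "invertible_elem (cfc f x - f c *\<^sub>C 1)" by (simp add: spectrum_iff)
    then have ev: "\<forall>\<^sub>F w in nhds (cfc f x - f c *\<^sub>C 1). invertible_elem w"
      by (rule eventually_invertible)
    obtain P where P: "uniform_limit (spectrum x) (\<lambda>n. poly (P n)) f sequentially"
      "(\<lambda>n. poly_at (P n) x) \<longlonglongrightarrow> cfc f x"
      using lim unfolding poly_limit_at_def by blast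
    have "(\<lambda>n. poly (P n) c) \<longlonglongrightarrow> f c" using P(1) c by (rule tendsto_uniform_limitI)
    then have "(\<lambda>n. poly_at (P n) x - poly (P n) c *\<^sub>C 1) \<longlonglongrightarrow> cfc f x - f c *\<^sub>C 1"
      by (intro tendsto_intros P)
    with ev have "\<forall>\<^sub>F n in sequentially. invertible_elem (poly_at (P n) x - poly (P n) c *\<^sub>C 1)"
      by (simp add: filterlim_iff)
    moreover have "\<not> invertible_elem (poly_at (P n) x - poly (P n) c *\<^sub>C 1)" for n
      using poly_in_spectrum[OF c] by (simp add: spectrum_iff)
    ultimately show False by simp
  qed
qed

text \<open>The map sending \<open>h\<close> to the calculus of \<open>h\<close> after
  \<open>f\<close> satisfies the axioms of a functional calculus for \<open>cfc f x\<close>, whose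
  spectrum is the image under \<open>f\<close>; uniqueness does the rest.\<close>

lemma cfc_compose:
  fixes x :: "'a::cstar_algebra"
  assumes x: "star x = x" and f: "continuous_on (spectrum x) f" and y: "star (cfc f x) = cfc f x"
    and g: "continuous_on (f ` spectrum x) g"
  shows "cfc g (cfc f x) = cfc (\<lambda>z. g (f z)) x"
proof -
  let ?\<Phi> = "\<lambda>h. cfc (\<lambda>z. h (f z)) x"
  note \<sigma> = spectrum_cfc[OF x f]
  have fc: "functional_calculus x (\<lambda>f. cfc f x)" by (rule functional_calculus_cfc[OF x])
  have comp: "continuous_on (spectrum x) (\<lambda>z. h (f z))" if "continuous_on (f ` spectrum x) h"
    for h :: "complex \<Rightarrow> complex"
    using continuous_on_compose2[OF that f] by blast
  have "functional_calculus (cfc f x) ?\<Phi>"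
    unfolding functional_calculus_def \<sigma> image_image
  proof (intro conjI allI impI)
    fix h k :: "complex \<Rightarrow> complex"
    assume "continuous_on (f ` spectrum x) h \<and> continuous_on (f ` spectrum x) k"
    then have "continuous_on (spectrum x) (\<lambda>z. h (f z))" "continuous_on (spectrum x) (\<lambda>z. k (f z))"
      using comp[of h] comp[of k] by simp_all
    then show "cfc (\<lambda>z. h (f z) + k (f z)) x = cfc (\<lambda>z. h (f z)) x + cfc (\<lambda>z. k (f z)) x"
      "cfc (\<lambda>z. h (f z) * k (f z)) x = cfc (\<lambda>z. h (f z)) x * cfc (\<lambda>z. k (f z)) x"
      by (rule functional_calculus_add[OF fc] functional_calculus_mult[OF fc])+
  next
    fix h :: "complex \<Rightarrow> complex" and c
    assume "continuous_on (f ` spectrum x) h"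
    then have "continuous_on (spectrum x) (\<lambda>z. h (f z))" by (rule comp)
    then show "cfc (\<lambda>z. c * h (f z)) x = c *\<^sub>C cfc (\<lambda>z. h (f z)) x"
      "cfc (\<lambda>z. cnj (h (f z))) x = star (cfc (\<lambda>z. h (f z)) x)"
      "norm (cfc (\<lambda>z. h (f z)) x) = (SUP z\<in>spectrum x. cmod (h (f z)))"
      by (rule functional_calculus_scaleC[OF fc] functional_calculus_star[OF fc]
          functional_calculus_norm[OF fc])+
  qed (simp_all add: functional_calculus_one[OF fc])
  from functional_calculus_poly_limit[OF y this, of g] show ?thesis
    using cfc_eqI[OF y] g unfolding \<sigma> by blast
qed

section \<open>Real functional calculus and positivity\<close>

text \<open>Meant for self-adjoint elements: their spectrum is real, and this is the same set read
  as a set of real numbers (\<open>rspec_iff\<close>).\<close>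

definition rspec :: "'a::cstar_algebra \<Rightarrow> real set"
  where "rspec x = Re ` spectrum x"

definition rcfc :: "(real \<Rightarrow> real) \<Rightarrow> 'a::cstar_algebra \<Rightarrow> 'a"
  where "rcfc g x = cfc (\<lambda>z. complex_of_real (g (Re z))) x"

context
  fixes x :: "'a::cstar_algebra"
  assumes x: "star x = x"
begin

lemma spectrum_of_real_Re: "c \<in> spectrum x \<Longrightarrow> complex_of_real (Re c) = c"
  using spectrum_real[OF x] by (simp add: complex_eq_iff)

lemma rspec_iff: "t \<in> rspec x \<longleftrightarrow> complex_of_real t \<in> spectrum x"
  unfolding rspec_def by (metis Re_complex_of_real image_iff spectrum_of_real_Re)

lemma rspec_nonempty: "rspec x \<noteq> {}"
  using spectrum_nonempty[OF x] by (simp add: rspec_def)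

lemma rspec_norm_le: "t \<in> rspec x \<Longrightarrow> \<bar>t\<bar> \<le> norm x"
  using spectrum_norm_le[of "complex_of_real t" x] by (simp add: rspec_iff)

lemma compact_rspec: "compact (rspec x)"
  unfolding rspec_def by (intro compact_continuous_image continuous_intros compact_spectrum)

lemma norm_in_rspec: "norm x \<in> rspec x \<or> - norm x \<in> rspec x"
proof -
  obtain c where c: "c \<in> spectrum x" "cmod c = norm x" using norm_in_spectrum[OF x] by blast
  have "\<bar>Re c\<bar> = norm x" using c spectrum_of_real_Re[OF c(1)] by (metis norm_of_real)
  then have "Re c = norm x \<or> Re c = - norm x" by linarith
  moreover have "Re c \<in> rspec x" using c(1) by (simp add: rspec_def)
  ultimately show ?thesis by metis
qed

lemma invertible_iff_rspec: "invertible_elem x \<longleftrightarrow> 0 \<notin> rspec x"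
  by (simp add: rspec_iff spectrum_iff)

lemma continuous_rspec:
  "continuous_on (rspec x) g \<Longrightarrow> continuous_on (spectrum x) (\<lambda>z. complex_of_real (g (Re z)))"
  unfolding rspec_def by (intro continuous_intros continuous_on_compose2[of _ g _ Re]) auto

lemma rcfc_cong:
  "continuous_on (rspec x) g \<Longrightarrow> (\<And>t. t \<in> rspec x \<Longrightarrow> g t = h t) \<Longrightarrow> rcfc g x = rcfc h x"
  unfolding rcfc_def by (rule cfc_cong[OF x continuous_rspec]) (auto simp: rspec_def)

lemma rcfc_add: "continuous_on (rspec x) g \<Longrightarrow> continuous_on (rspec x) h \<Longrightarrow>
    rcfc (\<lambda>t. g t + h t) x = rcfc g x + rcfc h x"
  unfolding rcfc_def
  using functional_calculus_add[OF functional_calculus_cfc[OF x] continuous_rspec continuous_rspec]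
  by simp

lemma rcfc_mult: "continuous_on (rspec x) g \<Longrightarrow> continuous_on (rspec x) h \<Longrightarrow>
    rcfc (\<lambda>t. g t * h t) x = rcfc g x * rcfc h x"
  unfolding rcfc_def
  using functional_calculus_mult[OF functional_calculus_cfc[OF x] continuous_rspec continuous_rspec]
  by simp

lemma rcfc_scaleR: "continuous_on (rspec x) g \<Longrightarrow> rcfc (\<lambda>t. c * g t) x = c *\<^sub>R rcfc g x"
  unfolding rcfc_def
  using functional_calculus_scaleC[OF functional_calculus_cfc[OF x] continuous_rspec, of g "complex_of_real c"]
  by (simp add: scaleC_of_real)

lemma rcfc_diff:
  assumes "continuous_on (rspec x) g" "continuous_on (rspec x) h"
  shows "rcfc (\<lambda>t. g t - h t) x = rcfc g x - rcfc h x"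
proof -
  have "continuous_on (rspec x) (\<lambda>t. g t - h t)" by (intro continuous_intros assms)
  from rcfc_add[OF this assms(2)] show ?thesis by simp
qed

lemma rcfc_const: "rcfc (\<lambda>_. c) x = c *\<^sub>R 1"
proof -
  have "rcfc (\<lambda>_. 1) x = 1"
    unfolding rcfc_def using functional_calculus_one[OF functional_calculus_cfc[OF x]] by simp
  then show ?thesis using rcfc_scaleR[of "\<lambda>_. 1" c] by (simp add: continuous_on_const)
qed

lemma rcfc_id: "rcfc (\<lambda>t. t) x = x"
proof -
  have "rcfc (\<lambda>t. t) x = cfc (\<lambda>z. z) x"
    unfolding rcfc_def
    by (rule cfc_cong[OF x]) (auto intro!: continuous_intros simp: spectrum_of_real_Re)
  then show ?thesis using functional_calculus_id[OF functional_calculus_cfc[OF x]] by simp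
qed

lemma rcfc_star: "continuous_on (rspec x) g \<Longrightarrow> star (rcfc g x) = rcfc g x"
  unfolding rcfc_def
  using functional_calculus_star[OF functional_calculus_cfc[OF x] continuous_rspec, of g] by simp

lemma rspec_rcfc: "continuous_on (rspec x) g \<Longrightarrow> rspec (rcfc g x) = g ` rspec x"
  unfolding rcfc_def rspec_def
  using spectrum_cfc[OF x continuous_rspec, of g] by (simp add: image_image rspec_def)

lemma rcfc_compose:
  assumes g: "continuous_on (rspec x) g" and h: "continuous_on (g ` rspec x) h"
  shows "rcfc h (rcfc g x) = rcfc (\<lambda>t. h (g t)) x"
proof -
  let ?g = "\<lambda>z. complex_of_real (g (Re z))"
  have "continuous_on (?g ` spectrum x) (\<lambda>z. complex_of_real (h (Re z)))"
    by (intro continuous_intros continuous_on_compose2[OF h]) (auto simp: rspec_def)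
  from cfc_compose[OF x continuous_rspec[OF g] _ this] rcfc_star[OF g]
  show ?thesis by (simp add: rcfc_def)
qed

lemma rcfc_norm_le:
  assumes g: "continuous_on (rspec x) g" "\<And>t. t \<in> rspec x \<Longrightarrow> \<bar>g t\<bar> \<le> B"
  shows "norm (rcfc g x) \<le> B"
  unfolding rcfc_def
  by (rule poly_limit_at_norm_le[OF x poly_limit_at_cfc[OF x continuous_rspec[OF g(1)]]])
    (auto simp: rspec_def intro: g(2)[unfolded rspec_def])

lemma rcfc_affine: "rcfc (\<lambda>t. a * t + b) x = a *\<^sub>R x + b *\<^sub>R 1"
  by (simp add: rcfc_add rcfc_scaleR rcfc_id rcfc_const continuous_intros)

lemma rspec_affine: "rspec (a *\<^sub>R x + b *\<^sub>R 1) = (\<lambda>t. a * t + b) ` rspec x"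
  unfolding rcfc_affine[symmetric] by (rule rspec_rcfc) (intro continuous_intros)

end

lemma rcfc_sum:
  assumes x: "star x = x" and "finite I" "\<And>i. i \<in> I \<Longrightarrow> continuous_on (rspec x) (g i)"
  shows "rcfc (\<lambda>t. \<Sum>i\<in>I. g i t) x = (\<Sum>i\<in>I. rcfc (g i) x)"
  using assms(2,3)
  by (induction I rule: finite_induct)
    (simp_all add: rcfc_const[OF x] rcfc_add[OF x] continuous_on_sum)

section \<open>The positive cone and the order\<close>

lemma pos_cone_iff: "x \<in> pos_cone \<longleftrightarrow> star x = x \<and> (\<forall>t\<in>rspec x. t \<ge> 0)"
proof (cases "star x = x")
  case True
  then show ?thesis
    unfolding pos_cone_def rspec_def
    by (auto, metis spectrum_of_real_Re[OF True])
qed (simp add: pos_cone_def)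

lemma pos_def_cone_iff: "x \<in> pos_def_cone \<longleftrightarrow> star x = x \<and> (\<forall>t\<in>rspec x. t > 0)"
proof (cases "star x = x")
  case True
  then show ?thesis
    by (auto simp: pos_def_cone_def pos_cone_iff invertible_iff_rspec less_le)
qed (simp add: pos_def_cone_def pos_cone_def)

lemma pos_star: "x \<in> pos_cone \<Longrightarrow> star x = x"
  and pos_def_star: "x \<in> pos_def_cone \<Longrightarrow> star x = x"
  and pos_def_pos: "x \<in> pos_def_cone \<Longrightarrow> x \<in> pos_cone"
  and pos_def_invertible: "x \<in> pos_def_cone \<Longrightarrow> invertible_elem x"
  by (auto simp: pos_cone_def pos_def_cone_def)

lemma rcfc_pos:
  "star x = x \<Longrightarrow> continuous_on (rspec x) g \<Longrightarrow> (\<And>t. t \<in> rspec x \<Longrightarrow> g t \<ge> 0) \<Longrightarrow> rcfc g x \<in> pos_cone"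
  by (auto simp: pos_cone_iff rcfc_star rspec_rcfc)

lemma rcfc_pos_def:
  "star x = x \<Longrightarrow> continuous_on (rspec x) g \<Longrightarrow> (\<And>t. t \<in> rspec x \<Longrightarrow> g t > 0) \<Longrightarrow> rcfc g x \<in> pos_def_cone"
  by (auto simp: pos_def_cone_iff rcfc_star rspec_rcfc)

lemma selfadj_scaleR_one: "star (t *\<^sub>R (1::'a::cstar_algebra)) = t *\<^sub>R 1"
  by (simp add: star_scaleR)

lemma rspec_one: "rspec (t *\<^sub>R (1::'a::cstar_algebra)) = {t}"
proof -
  have "rspec (0 *\<^sub>R (1::'a) + t *\<^sub>R 1) = (\<lambda>s. 0 * s + t) ` rspec (1::'a)"
    by (rule rspec_affine) simp
  then show ?thesis using rspec_nonempty[of "1::'a"] by (auto simp: image_constant_conv)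
qed

lemma scaleR_one_pos: "t \<ge> 0 \<Longrightarrow> t *\<^sub>R 1 \<in> pos_cone"
  and scaleR_one_pos_def: "t > 0 \<Longrightarrow> t *\<^sub>R 1 \<in> pos_def_cone"
  by (simp_all add: pos_cone_iff pos_def_cone_iff rspec_one selfadj_scaleR_one)

lemma one_pos_def [simp]: "1 \<in> pos_def_cone"
  using scaleR_one_pos_def[of 1] by simp

text \<open>The spectrum lies in the interval from \<open>- t\<close> to \<open>t\<close>, and a
  point \<open>s\<close> of it is nonnegative exactly when \<open>t - s\<close> is at most
  \<open>t\<close>. Positivity becomes a norm condition, so the triangle inequality yields closure
  under addition even for elements that do not commute.\<close>

lemma pos_iff_norm:
  fixes x :: "'a::cstar_algebra"
  assumes x: "star x = x" and t: "norm x \<le> t"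
  shows "x \<in> pos_cone \<longleftrightarrow> norm (t *\<^sub>R 1 - x) \<le> t"
proof -
  have sp: "rspec (t *\<^sub>R 1 - x) = (\<lambda>s. t - s) ` rspec x"
    using rspec_affine[OF x, of "-1" t] by simp
  have sa: "star (t *\<^sub>R 1 - x) = t *\<^sub>R 1 - x" by (simp add: star_diff x star_scaleR)
  show ?thesis
  proof
    assume pos: "x \<in> pos_cone"
    have "\<bar>t - s\<bar> \<le> t" if "s \<in> rspec x" for s
      using that pos rspec_norm_le[OF x that] t by (auto simp: pos_cone_iff)
    then show "norm (t *\<^sub>R 1 - x) \<le> t" using norm_in_rspec[OF sa] unfolding sp by fastforce
  next
    assume n: "norm (t *\<^sub>R 1 - x) \<le> t"
    have "s \<ge> 0" if "s \<in> rspec x" for s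
    proof -
      have "\<bar>t - s\<bar> \<le> norm (t *\<^sub>R 1 - x)" using that by (intro rspec_norm_le[OF sa]) (auto simp: sp)
      then show ?thesis using n by linarith
    qed
    then show "x \<in> pos_cone" using x by (simp add: pos_cone_iff)
  qed
qed

lemma pos_add:
  assumes "x \<in> pos_cone" "y \<in> pos_cone"
  shows "x + y \<in> pos_cone"
proof -
  have n: "norm (norm x *\<^sub>R 1 - x) \<le> norm x" "norm (norm y *\<^sub>R 1 - y) \<le> norm y"
    using assms pos_iff_norm[OF pos_star] by blast+
  have "(norm x + norm y) *\<^sub>R 1 - (x + y) = (norm x *\<^sub>R 1 - x) + (norm y *\<^sub>R 1 - y)"
    by (simp add: algebra_simps)
  also have "norm \<dots> \<le> norm x + norm y"
    by (rule order_trans[OF norm_triangle_ineq add_mono[OF n]])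
  finally show ?thesis
    using pos_iff_norm[of "x + y" "norm x + norm y"] assms
    by (simp add: star_add pos_star norm_triangle_ineq)
qed

lemma pos_zero [simp]: "0 \<in> pos_cone"
  using scaleR_one_pos[of 0] by simp

lemma pos_scaleR: "x \<in> pos_cone \<Longrightarrow> t \<ge> 0 \<Longrightarrow> t *\<^sub>R x \<in> pos_cone"
  using rspec_affine[of x t 0] by (auto simp: pos_cone_iff star_scaleR)

lemma pos_def_scaleR: "x \<in> pos_def_cone \<Longrightarrow> t > 0 \<Longrightarrow> t *\<^sub>R x \<in> pos_def_cone"
  using rspec_affine[of x t 0] by (auto simp: pos_def_cone_iff star_scaleR)

lemma pos_sum: "(\<And>i. i \<in> I \<Longrightarrow> f i \<in> pos_cone) \<Longrightarrow> (\<Sum>i\<in>I. f i) \<in> pos_cone"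
  by (induction I rule: infinite_finite_induct) (auto intro: pos_add)

lemma pos_add_scaleR_one: "x \<in> pos_cone \<Longrightarrow> t > 0 \<Longrightarrow> x + t *\<^sub>R 1 \<in> pos_def_cone"
  using rspec_affine[of x 1 t] by (auto simp: pos_cone_iff pos_def_cone_iff star_add star_scaleR)

lemma pos_def_lower_bound:
  assumes x: "x \<in> pos_def_cone"
  shows "\<exists>e>0. x - e *\<^sub>R 1 \<in> pos_cone"
proof -
  note sx = pos_def_star[OF x]
  obtain e where e: "e \<in> rspec x" "\<And>t. t \<in> rspec x \<Longrightarrow> e \<le> t"
    using compact_attains_inf[OF compact_rspec[OF sx] rspec_nonempty[OF sx]] by blast
  then have "x - e *\<^sub>R 1 \<in> pos_cone"
    using rspec_affine[OF sx, of 1 "- e"] sx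
    by (auto simp: pos_cone_iff star_diff star_scaleR)
  moreover have "e > 0" using e(1) x by (simp add: pos_def_cone_iff)
  ultimately show ?thesis by blast
qed

lemma pos_add_pos_def: "x \<in> pos_cone \<Longrightarrow> y \<in> pos_def_cone \<Longrightarrow> x + y \<in> pos_def_cone"
  using pos_def_lower_bound[of y] pos_add_scaleR_one pos_add
  by (metis add_diff_eq diff_add_cancel)

lemma pos_def_add: "x \<in> pos_def_cone \<Longrightarrow> y \<in> pos_def_cone \<Longrightarrow> x + y \<in> pos_def_cone"
  by (simp add: pos_add_pos_def pos_def_pos)

lemma pos_closed_eps:
  assumes "\<And>e. e > 0 \<Longrightarrow> x + e *\<^sub>R 1 \<in> pos_cone"
  shows "x \<in> pos_cone"
proof -
  have x: "star x = x" using pos_star[OF assms[of 1]] by (simp add: star_add)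
  have "t \<ge> 0" if t: "t \<in> rspec x" for t
  proof (rule field_le_epsilon)
    fix e :: real assume "e > 0"
    then show "0 \<le> t + e" using assms[of e] rspec_affine[OF x, of 1 e] t by (auto simp: pos_cone_iff)
  qed
  then show ?thesis by (simp add: pos_cone_iff x)
qed

lemma pos_antisym:
  fixes x :: "'a::cstar_algebra"
  assumes "x \<in> pos_cone" "- x \<in> pos_cone"
  shows "x = 0"
proof -
  have x: "star x = x" using assms(1) by (rule pos_star)
  have "rspec (- x) = uminus ` rspec x" using rspec_affine[OF x, of "-1" 0] by simp
  then have "rspec x \<subseteq> {0}" using assms by (force simp: pos_cone_iff)
  then have "norm x = 0" using norm_in_rspec[OF x] by auto
  then show ?thesis by simp
qed

lemma selfadj_le_norm:
  fixes x :: "'a::cstar_algebra"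
  assumes x: "star x = x" and t: "norm x \<le> t"
  shows "t *\<^sub>R 1 - x \<in> pos_cone" "x + t *\<^sub>R 1 \<in> pos_cone"
proof -
  have "\<bar>s\<bar> \<le> t" if "s \<in> rspec x" for s using rspec_norm_le[OF x that] t by simp
  then show "t *\<^sub>R 1 - x \<in> pos_cone" "x + t *\<^sub>R 1 \<in> pos_cone"
    using rspec_affine[OF x, of "-1" t] rspec_affine[OF x, of 1 t] x
    by (force simp: pos_cone_iff star_diff star_add star_scaleR)+
qed

lemma norm_le_of_order:
  fixes x :: "'a::cstar_algebra"
  assumes "t *\<^sub>R 1 - x \<in> pos_cone" "x + t *\<^sub>R 1 \<in> pos_cone"
  shows "norm x \<le> t"
proof -
  have x: "star x = x" using pos_star[OF assms(2)] by (simp add: star_add star_scaleR)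
  have "\<bar>s\<bar> \<le> t" if "s \<in> rspec x" for s
    using assms rspec_affine[OF x, of "-1" t] rspec_affine[OF x, of 1 t] that
    by (force simp: pos_cone_iff)
  then show ?thesis using norm_in_rspec[OF x] by fastforce
qed

section \<open>Positivity of \<open>star a * a\<close>\<close>

text \<open>The inverse \<open>1 + b * c * a\<close> comes from the formal series 1 + b (1 + ab +
  abab + ...) a, with \<open>c\<close> standing for the sum in the middle.\<close>

lemma invertible_one_minus_swap:
  assumes "invertible_elem (1 - a * b)"
  shows "invertible_elem (1 - b * (a::'a::cstar_algebra))"
proof -
  define c where "c = cinv (1 - a * b)"
  have c: "a * b * c = c - 1" "c * (a * b) = c - 1"
    using cinv_right[OF assms] cinv_left[OF assms] by (auto simp: c_def algebra_simps)
  have "b * (a * (b * (c * a))) = b * (c - 1) * a" "b * (c * (a * (b * a))) = b * (c - 1) * a"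
    unfolding c[symmetric] by (metis c mult.assoc)+
  then show ?thesis
    by (intro invertibleI[of _ "1 + b * c * a"]) (simp_all add: algebra_simps)
qed

lemma spectrum_mult_swap:
  fixes a b :: "'a::cstar_algebra"
  assumes "c \<noteq> 0" "c \<in> spectrum (a * b)"
  shows "c \<in> spectrum (b * a)"
proof -
  have eq: "x - c *\<^sub>C 1 = (- c) *\<^sub>C (1 - inverse c *\<^sub>C x)" for x :: 'a
    using assms(1) by (simp add: scaleC_diff_right scaleC_minus_left scaleC_scaleC)
  have "invertible_elem (1 - inverse c *\<^sub>C (a * b))" if "invertible_elem (1 - inverse c *\<^sub>C (b * a))"
    using invertible_one_minus_swap[of b "inverse c *\<^sub>C a"] that
    by (simp add: mult_scaleC_left mult_scaleC_right)
  then show ?thesis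
    using assms unfolding spectrum_iff eq by (auto simp: invertible_scaleC_iff)
qed

lemma selfadj_square_pos: "star x = x \<Longrightarrow> x * x \<in> pos_cone"
  using rcfc_pos[of x "\<lambda>t. t * t"] rcfc_mult[of x "\<lambda>t. t" "\<lambda>t. t"]
  by (simp add: rcfc_id continuous_intros)

text \<open>With \<open>c = u + \<i> v\<close>, where \<open>u\<close> and \<open>v\<close> are
  self-adjoint, the two products of \<open>c\<close> and \<open>star c\<close> add up to
  \<open>2 (u^2 + v^2)\<close>. So if one of them is negative the other is positive; but their
  nonzero spectra agree, hence the negative one is positive as well and vanishes.\<close>

lemma star_mult_self_neg_imp_zero:
  fixes c :: "'a::cstar_algebra"
  assumes neg: "- (star c * c) \<in> pos_cone"
  shows "c = 0"
proof -
  define u v where "u = (1/2) *\<^sub>R (c + star c)" and "v = (\<i>/2) *\<^sub>C (star c - c)"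
  have uv: "star u = u" "star v = v"
    by (simp_all add: u_def v_def star_scaleR star_add star_scaleC star_diff star_star
        scaleC_diff_right scaleC_minus_left)
  have "\<i> / 2 * (\<i> / 2) = complex_of_real (- (1/4))" by (simp add: complex_eq_iff)
  then have "v * v = (- (1/4)) *\<^sub>R ((star c - c) * (star c - c))"
    by (simp only: v_def mult_scaleC_left mult_scaleC_right scaleC_scaleC scaleC_of_real)
  moreover have "u * u = (1/4) *\<^sub>R ((c + star c) * (c + star c))" by (simp add: u_def)
  ultimately have "u * u + v * v
      = (1/4) *\<^sub>R ((c + star c) * (c + star c) - (star c - c) * (star c - c))"
    by (simp add: scaleR_diff_right)
  also have "(c + star c) * (c + star c) - (star c - c) * (star c - c)
      = 2 *\<^sub>R (c * star c + star c * c)"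
    by (simp add: algebra_simps scaleR_2)
  finally have "c * star c + star c * c = 2 *\<^sub>R (u * u + v * v)" by simp
  then have "c * star c = 2 *\<^sub>R (u * u + v * v) + - (star c * c)" by (simp add: algebra_simps)
  moreover have "\<dots> \<in> pos_cone"
    by (intro pos_add pos_scaleR selfadj_square_pos uv neg) simp
  ultimately have pos: "c * star c \<in> pos_cone" by simp
  have sa: "star (star c * c) = star c * c" by (simp add: star_mult star_star)
  have "t \<ge> 0" if "t \<in> rspec (star c * c)" for t
  proof (cases "t = 0")
    case False
    then have "complex_of_real t \<in> spectrum (c * star c)"
      using that spectrum_mult_swap[of "complex_of_real t" "star c" c] by (simp add: rspec_iff[OF sa])
    then show ?thesis using pos by (force simp: pos_cone_iff rspec_def)
  qed simp
  then have "star c * c \<in> pos_cone" using sa by (simp add: pos_cone_iff)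
  then have "star c * c = 0" using neg by (rule pos_antisym)
  then show "c = 0" using cstar_identity[of c] by simp
qed

text \<open>Let \<open>n\<close> be the negative part of \<open>h = star a * a\<close>. Then
  \<open>star (a * n) * (a * n) = n * h * n\<close> is minus the cube of \<open>n\<close>, so
  \<open>a * n = 0\<close> by the preceding lemma, the cube vanishes, and \<open>h\<close> has no
  negative spectral point.\<close>

lemma star_mult_self_pos:
  fixes a :: "'a::cstar_algebra"
  shows "star a * a \<in> pos_cone"
proof -
  define h where "h = star a * a"
  have h: "star h = h" by (simp add: h_def star_mult star_star)
  note co = continuous_on_max continuous_on_minus continuous_on_id continuous_on_const continuous_on_mult
  define n where "n = rcfc (\<lambda>t. max (- t) 0) h"
  have n: "star n = n" unfolding n_def by (intro rcfc_star[OF h] co)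
  have "star (a * n) * (a * n) = n * (h * n)" by (simp add: star_mult n h_def mult.assoc)
  also have "\<dots> = rcfc (\<lambda>t. max (- t) 0 * (t * max (- t) 0)) h"
    unfolding n_def by (simp add: rcfc_mult[OF h] rcfc_id[OF h] co)
  finally have e: "star (a * n) * (a * n) = rcfc (\<lambda>t. max (- t) 0 * (t * max (- t) 0)) h" .
  then have e': "- (star (a * n) * (a * n)) = rcfc (\<lambda>t. (-1) * (max (- t) 0 * (t * max (- t) 0))) h"
    by (subst rcfc_scaleR[OF h]) (intro co, simp)
  have "- (star (a * n) * (a * n)) \<in> pos_cone"
    unfolding e' by (rule rcfc_pos[OF h]) (intro co, auto simp: max_def mult_le_0_iff)
  then have "a * n = 0" by (rule star_mult_self_neg_imp_zero)
  then have "rcfc (\<lambda>t. max (- t) 0 * (t * max (- t) 0)) h = 0" using e by simp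
  moreover have "rspec (rcfc (\<lambda>t. max (- t) 0 * (t * max (- t) 0)) h)
      = (\<lambda>t. max (- t) 0 * (t * max (- t) 0)) ` rspec h"
    by (intro rspec_rcfc[OF h] co)
  ultimately have "(\<lambda>t. max (- t) 0 * (t * max (- t) 0)) ` rspec h = {0}"
    using rspec_one[of 0, where 'a='a] by simp
  then have "\<forall>t\<in>rspec h. max (- t) 0 * (t * max (- t) 0) = 0" by blast
  then have "\<forall>t\<in>rspec h. t \<ge> 0" by (auto simp: max_def split: if_splits)
  then show ?thesis using h by (simp add: pos_cone_iff h_def)
qed

lemma pos_congruence:
  assumes x: "x \<in> pos_cone"
  shows "star a * x * a \<in> pos_cone"
proof -
  note sx = pos_star[OF x]
  define s where "s = rcfc sqrt x"
  have c: "continuous_on (rspec x) sqrt" by (intro continuous_intros)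
  have s: "star s = s" unfolding s_def by (rule rcfc_star[OF sx c])
  have "s * s = rcfc (\<lambda>t. sqrt t * sqrt t) x" unfolding s_def by (rule rcfc_mult[OF sx c c, symmetric])
  also have "\<dots> = rcfc (\<lambda>t. t) x"
    by (intro rcfc_cong[OF sx] continuous_intros) (use x in \<open>auto simp: pos_cone_iff\<close>)
  finally have "s * s = x" by (simp add: rcfc_id[OF sx])
  then have "star a * x * a = star (s * a) * (s * a)" by (simp add: star_mult s mult.assoc) (metis mult.assoc)
  then show ?thesis using star_mult_self_pos by simp
qed

lemma pos_def_congruence:
  assumes "x \<in> pos_def_cone" "invertible_elem a"
  shows "star a * x * a \<in> pos_def_cone"
  using assms pos_congruence[of x a] by (simp add: pos_def_cone_def invertible_mult invertible_star)

lemma selfadj_pos_congruence: "star a = a \<Longrightarrow> x \<in> pos_cone \<Longrightarrow> a * x * a \<in> pos_cone"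
  using pos_congruence[of x a] by simp

lemma pos_def_congruence_pos_def:
  "a \<in> pos_def_cone \<Longrightarrow> x \<in> pos_def_cone \<Longrightarrow> a * x * a \<in> pos_def_cone"
  using pos_def_congruence[of x a] by (simp add: pos_def_star pos_def_invertible)

section \<open>Real powers\<close>

lemma real_power_rcfc: "real_power x r = rcfc (\<lambda>t. t powr r) x"
  by (simp add: real_power_def rcfc_def)

context
  fixes x :: "'a::cstar_algebra"
  assumes x: "x \<in> pos_def_cone"
begin

private lemma sa: "star x = x"
  by (rule pos_def_star[OF x])

private lemma pos: "t \<in> rspec x \<Longrightarrow> t > 0"
  using x by (simp add: pos_def_cone_iff)

lemma continuous_on_powr_rspec: "continuous_on (rspec x) (\<lambda>t. t powr r)"
  using pos by (intro continuous_intros) force+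

lemma real_power_pos_def: "real_power x r \<in> pos_def_cone"
  unfolding real_power_rcfc by (rule rcfc_pos_def[OF sa continuous_on_powr_rspec]) (use pos in force)

lemma real_power_0 [simp]: "real_power x 0 = 1"
proof -
  have "rcfc (\<lambda>t. t powr 0) x = rcfc (\<lambda>_. 1) x"
    by (intro rcfc_cong[OF sa] continuous_on_powr_rspec) (use pos in force)
  then show ?thesis by (simp add: real_power_rcfc rcfc_const[OF sa])
qed

lemma real_power_1 [simp]: "real_power x 1 = x"
proof -
  have "rcfc (\<lambda>t. t powr 1) x = rcfc (\<lambda>t. t) x"
    by (intro rcfc_cong[OF sa] continuous_on_powr_rspec) (use pos in force)
  then show ?thesis by (simp add: real_power_rcfc rcfc_id[OF sa])
qed

lemma real_power_add: "real_power x r * real_power x s = real_power x (r + s)"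
  unfolding real_power_rcfc powr_add by (simp add: rcfc_mult[OF sa] continuous_on_powr_rspec)

lemma real_power_real_power: "real_power (real_power x r) s = real_power x (r * s)"
proof -
  have "rcfc (\<lambda>t. t powr s) (rcfc (\<lambda>t. t powr r) x) = rcfc (\<lambda>t. (t powr r) powr s) x"
    by (rule rcfc_compose[OF sa continuous_on_powr_rspec])
      (use pos in \<open>force intro!: continuous_intros\<close>)
  then show ?thesis by (simp add: real_power_rcfc powr_powr)
qed

lemma real_power_scaleR:
  assumes "c > 0"
  shows "real_power (c *\<^sub>R x) r = (c powr r) *\<^sub>R real_power x r"
proof -
  have "c *\<^sub>R x = rcfc (\<lambda>t. c * t) x"
    by (simp add: rcfc_scaleR[OF sa] rcfc_id[OF sa] continuous_intros)
  then have "real_power (c *\<^sub>R x) r = rcfc (\<lambda>t. t powr r) (rcfc (\<lambda>t. c * t) x)"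
    by (simp add: real_power_rcfc)
  also have "\<dots> = rcfc (\<lambda>t. (c * t) powr r) x"
    by (rule rcfc_compose[OF sa])
      (use pos assms in \<open>force intro!: continuous_intros simp: mult_pos_pos\<close>)+
  also have "\<dots> = rcfc (\<lambda>t. c powr r * t powr r) x"
    by (rule rcfc_cong[OF sa])
      (use pos assms in \<open>force intro!: continuous_intros simp: powr_mult\<close>)+
  finally show ?thesis by (simp add: real_power_rcfc rcfc_scaleR[OF sa continuous_on_powr_rspec])
qed

lemma cinv_real_power: "cinv (real_power x r) = real_power x (- r)"
  by (rule cinv_unique) (simp_all add: real_power_add)

lemma real_power_minus_1: "real_power x (- 1) = cinv x"
  using cinv_real_power[of 1] by simp

end

lemma real_power_one [simp]: "real_power 1 r = (1::'a::cstar_algebra)"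
proof -
  have sa: "star (1::'a) = 1" by simp
  have "rspec (1::'a) = {1}" using rspec_one[of 1] by simp
  then have "rcfc (\<lambda>t. t powr r) (1::'a) = rcfc (\<lambda>_. 1) 1"
    by (intro rcfc_cong[OF sa]) auto
  then show ?thesis by (simp add: real_power_rcfc rcfc_const[OF sa])
qed

lemma real_power_scaleR_one: "c > 0 \<Longrightarrow> real_power (c *\<^sub>R 1) r = (c powr r) *\<^sub>R (1::'a::cstar_algebra)"
  using real_power_scaleR[of "1::'a" c r] by simp

section \<open>Jordan *-isomorphisms\<close>

definition re_part :: "'a::cstar_algebra \<Rightarrow> 'a"
  where "re_part x = (1/2) *\<^sub>R (x + star x)"

text \<open>This is (x - star x) / (2i), with the sign absorbed into the difference.\<close>

definition im_part :: "'a::cstar_algebra \<Rightarrow> 'a"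
  where "im_part x = (\<i>/2) *\<^sub>C (star x - x)"

lemma star_re_part: "star (re_part x) = re_part x"
  by (simp add: re_part_def star_scaleR star_add star_star add.commute)

lemma star_im_part: "star (im_part x) = im_part x"
  by (simp add: im_part_def star_scaleC star_diff star_star scaleC_diff_right scaleC_minus_left)

lemma i_im_part: "\<i> *\<^sub>C im_part x = (1/2) *\<^sub>R (x - star x)"
proof -
  have "\<i> * (\<i> / 2) = complex_of_real (- (1/2))" by (simp add: complex_eq_iff)
  then have "\<i> *\<^sub>C im_part x = (- (1/2)) *\<^sub>R (star x - x)"
    by (simp only: im_part_def scaleC_scaleC scaleC_of_real)
  then show ?thesis by (simp add: algebra_simps)
qed

lemma re_im_decomposition: "x = re_part x + \<i> *\<^sub>C im_part x"
  by (simp add: i_im_part re_part_def scaleR_add_right scaleR_diff_right flip: scaleR_add_left)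

lemma norm_re_part: "norm (re_part x) \<le> norm x"
  using norm_triangle_ineq[of x "star x"] by (simp add: re_part_def norm_star)

lemma norm_im_part: "norm (im_part x) \<le> norm x"
  using norm_triangle_ineq4[of "star x" x] by (simp add: im_part_def norm_scaleC norm_star)

lemma re_im_unique:
  assumes "star u = u" "star v = v"
  shows "re_part (u + \<i> *\<^sub>C v) = u" "im_part (u + \<i> *\<^sub>C v) = v"
proof -
  have s: "star (u + \<i> *\<^sub>C v) = u - \<i> *\<^sub>C v"
    by (simp add: star_add star_scaleC assms scaleC_minus_left)
  show "re_part (u + \<i> *\<^sub>C v) = u" by (simp add: re_part_def s flip: scaleR_2)
  have "star (u + \<i> *\<^sub>C v) - (u + \<i> *\<^sub>C v) = (- 2 * \<i>) *\<^sub>C v"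
    using scaleC_add_left[of "- \<i>" "- \<i>" v] by (simp add: s scaleC_minus_left)
  then show "im_part (u + \<i> *\<^sub>C v) = v" by (simp add: im_part_def scaleC_scaleC)
qed

lemma star_sum: "star (\<Sum>i\<in>I. f i) = (\<Sum>i\<in>I. star (f i))"
  by (induction I rule: infinite_finite_induct) (simp_all add: star_add)

context
  fixes J :: "'a::cstar_algebra \<Rightarrow> 'b::cstar_algebra"
  assumes J: "jordan_star_iso J"
begin

lemma jordan_bij: "bij J"
  and jordan_add: "J (x + y) = J x + J y"
  and jordan_scaleC: "J (c *\<^sub>C x) = c *\<^sub>C J x"
  and jordan_anticommutator: "J (x * y + y * x) = J x * J y + J y * J x"
  and jordan_star: "J (star x) = star (J x)"
  using J by (auto simp: jordan_star_iso_def)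

lemma jordan_scaleR: "J (r *\<^sub>R x) = r *\<^sub>R J x"
  using jordan_scaleC[of "complex_of_real r" x] by (simp add: scaleC_of_real)

lemma jordan_0: "J 0 = 0"
  using jordan_scaleR[of 0 0] by simp

lemma jordan_minus: "J (- x) = - J x"
  using jordan_scaleR[of "- 1" x] by simp

lemma jordan_diff: "J (x - y) = J x - J y"
  using jordan_add[of x "- y"] by (simp add: jordan_minus)

lemma jordan_1: "J 1 = 1"
proof -
  \<comment> \<open>Testing \<open>1\<close> against itself would only show that \<open>J 1\<close>
    is idempotent; testing it against a preimage of the unit determines it.\<close>
  obtain b where "J b = 1" using jordan_bij by (metis bij_pointE)
  then have "2 *\<^sub>R J 1 = 2 *\<^sub>R 1"
    using jordan_anticommutator[of 1 b] jordan_add[of b b] by (simp add: scaleR_2)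
  then show ?thesis by simp
qed

lemma jordan_square: "J (x * x) = J x * J x"
proof -
  have "2 *\<^sub>R J (x * x) = 2 *\<^sub>R (J x * J x)"
    using jordan_anticommutator[of x x] jordan_add[of "x * x" "x * x"] by (simp add: scaleR_2)
  then show ?thesis by simp
qed

text \<open>Although \<open>J\<close> need not be multiplicative, \<open>a * b * a\<close> is a
  combination of nested anticommutators.\<close>

lemma jordan_triple: "J (x * y * x) = J x * J y * J x"
proof -
  have id: "2 *\<^sub>R (a * b * a) = (a * (a * b + b * a) + (a * b + b * a) * a) - (a * a * b + b * (a * a))"
    for a b :: "'c::real_algebra"
    by (simp add: algebra_simps scaleR_2)
  have "2 *\<^sub>R J (x * y * x) = J (2 *\<^sub>R (x * y * x))" by (simp add: jordan_scaleR)
  also have "\<dots> = 2 *\<^sub>R (J x * J y * J x)"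
    unfolding id jordan_diff jordan_anticommutator jordan_square ..
  finally show ?thesis by simp
qed

lemma jordan_power: "J (x ^ n) = J x ^ n"
proof (induction n rule: induct_nat_012)
  case (ge2 n)
  \<comment> \<open>The induction advances by two, so that each step is a triple product.\<close>
  have "y ^ Suc (Suc n) = y * y ^ n * y" for y :: "'c::monoid_mult"
    by (simp add: power_commutes mult.assoc)
  then show ?case using ge2 by (metis jordan_triple)
qed (simp_all add: jordan_1)

lemma jordan_poly_at: "J (poly_at p x) = poly_at p (J x)"
proof -
  \<comment> \<open>Horner's rule cannot be pushed through \<open>J\<close>, which need not respect
    products. With a power of \<open>x\<close> carried in front, each step uses only linearity and
    \<open>jordan_power\<close>.\<close>
  have "J (x ^ n * poly_at p x) = J x ^ n * poly_at p (J x)" for n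
  proof (induction p arbitrary: n)
    case (pCons a p)
    have e: "y ^ n * poly_at (pCons a p) y = a *\<^sub>C y ^ n + y ^ Suc n * poly_at p y"
      for y :: "'c::cstar_algebra"
      by (simp add: distrib_left mult_scaleC_right power_Suc2 mult.assoc del: power_Suc)
    show ?case unfolding e by (simp only: jordan_add jordan_scaleC jordan_power pCons.IH)
  qed (simp add: jordan_0)
  from this[of 0] show ?thesis by simp
qed

text \<open>With \<open>y\<close> inverse to \<open>x\<close>, the identity
  \<open>x * y^2 * x = 1\<close> is a triple product. Its image exhibits a left and a right inverse
  of \<open>J x\<close>.\<close>

lemma jordan_invertible:
  assumes "invertible_elem x"
  shows "invertible_elem (J x)"
proof -
  define y where "y = cinv x"
  have "x * (y * y) * x = 1"
    using cinv_left[OF assms] cinv_right[OF assms] by (simp add: y_def mult.assoc[symmetric])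
  then have "J x * (J y * J y) * J x = 1"
    using jordan_triple[of x "y * y"] by (simp add: jordan_square jordan_1)
  then have l: "J x * (J y * J y) * J x = 1" and r: "J x * (J y * J y * J x) = 1"
    by (simp_all add: mult.assoc)
  then have "J y * J y * J x * J x = 1"
    using left_right_inverse_eq[OF l r] by simp
  with r show ?thesis by (rule invertibleI)
qed

lemma jordan_inv: "jordan_star_iso (inv J)"
proof -
  have *: "inv J u = v \<longleftrightarrow> u = J v" for u v
    using jordan_bij by (metis bij_inv_eq_iff)
  have JJ: "J (inv J u) = u" for u by (metis *)
  show ?thesis
    unfolding jordan_star_iso_def
  proof (intro conjI allI)
    show "inv J (A * B + B * A) = inv J A * inv J B + inv J B * inv J A" for A B
      by (simp only: * jordan_anticommutator JJ)
  qed (simp_all only: * JJ jordan_add jordan_scaleC jordan_star bij_imp_bij_inv[OF jordan_bij])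
qed

end

lemma jordan_invertible_iff:
  assumes J: "jordan_star_iso J"
  shows "invertible_elem (J x) \<longleftrightarrow> invertible_elem x"
  using jordan_invertible[OF J] jordan_invertible[OF jordan_inv[OF J], of "J x"]
    bij_is_inj[OF jordan_bij[OF J]] by auto

lemma jordan_spectrum: "jordan_star_iso J \<Longrightarrow> spectrum (J x) = spectrum x"
  using jordan_invertible_iff[of J "x - c *\<^sub>C 1" for c]
  by (auto simp: spectrum_def jordan_diff jordan_scaleC jordan_1)

lemma jordan_rspec: "jordan_star_iso J \<Longrightarrow> rspec (J x) = rspec x"
  by (simp add: rspec_def jordan_spectrum)

lemma jordan_pos_def_iff:
  assumes J: "jordan_star_iso J"
  shows "J x \<in> pos_def_cone \<longleftrightarrow> x \<in> pos_def_cone"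
  using bij_is_inj[OF jordan_bij[OF J]]
  by (auto simp: pos_def_cone_iff jordan_rspec[OF J] jordan_star[OF J, symmetric] inj_def)

lemma jordan_norm_selfadj:
  assumes J: "jordan_star_iso J" and x: "star x = x"
  shows "norm (J x) = norm x"
proof -
  have Jx: "star (J x) = J x" using jordan_star[OF J, of x] x by simp
  show ?thesis
    using norm_in_rspec[OF x] norm_in_rspec[OF Jx] rspec_norm_le[OF x] rspec_norm_le[OF Jx]
    unfolding jordan_rspec[OF J] by (intro antisym) force+
qed

lemma jordan_bounded_linear:
  assumes J: "jordan_star_iso J"
  shows "bounded_linear J"
proof (rule bounded_linear_intro)
  fix x
  have "J x = J (re_part x) + \<i> *\<^sub>C J (im_part x)"
    by (subst re_im_decomposition) (simp add: jordan_add[OF J] jordan_scaleC[OF J])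
  then have "norm (J x) \<le> norm (J (re_part x)) + norm (J (im_part x))"
    using norm_triangle_ineq[of "J (re_part x)" "\<i> *\<^sub>C J (im_part x)"] by (simp add: norm_scaleC)
  also have "\<dots> \<le> norm x * 2"
    using norm_re_part[of x] norm_im_part[of x]
    by (simp add: jordan_norm_selfadj[OF J] star_re_part star_im_part)
  finally show "norm (J x) \<le> norm x * 2" .
qed (simp_all add: jordan_add[OF J] jordan_scaleR[OF J])

text \<open>\<open>J\<close> is bounded, preserves the spectrum and commutes with polynomials, so
  the same approximating polynomials serve for \<open>x\<close> and \<open>J x\<close>.\<close>

lemma jordan_rcfc:
  assumes J: "jordan_star_iso J" and x: "star x = x" and g: "continuous_on (rspec x) g"
  shows "J (rcfc g x) = rcfc g (J x)"
proof -
  let ?g = "\<lambda>z. complex_of_real (g (Re z))"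
  have Jx: "star (J x) = J x" using jordan_star[OF J, of x] x by simp
  obtain P where P: "uniform_limit (spectrum x) (\<lambda>n. poly (P n)) ?g sequentially"
    "(\<lambda>n. poly_at (P n) x) \<longlonglongrightarrow> rcfc g x"
    using poly_limit_at_cfc[OF x continuous_rspec[OF x g]] unfolding poly_limit_at_def rcfc_def by blast
  have "(\<lambda>n. poly_at (P n) (J x)) \<longlonglongrightarrow> J (rcfc g x)"
    using bounded_linear.tendsto[OF jordan_bounded_linear[OF J] P(2)] by (simp add: jordan_poly_at[OF J])
  then have "poly_limit_at (J x) ?g (J (rcfc g x))"
    using P(1) unfolding poly_limit_at_def jordan_spectrum[OF J] by blast
  then show ?thesis
    unfolding rcfc_def
    by (intro cfc_eqI[OF Jx, symmetric] continuous_rspec[OF Jx]) (simp_all add: jordan_rspec[OF J] g)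
qed

lemma jordan_real_power:
  "jordan_star_iso J \<Longrightarrow> x \<in> pos_def_cone \<Longrightarrow> J (real_power x r) = real_power (J x) r"
  by (simp add: real_power_rcfc jordan_rcfc pos_def_star continuous_on_powr_rspec)

lemma unitary_conjugation_jordan:
  fixes u :: "'a::cstar_algebra"
  assumes "u * star u = 1" "star u * u = 1"
  shows "jordan_star_iso (\<lambda>x. u * x * star u)"
  unfolding jordan_star_iso_def
proof (intro conjI allI)
  show "bij (\<lambda>x. u * x * star u)"
  proof (rule o_bij)
    have "star u * (u * x * star u) * u = x" "u * (star u * x * u) * star u = x" for x
      using assms by (metis mult.assoc mult_1_left mult_1_right)+
    then show "(\<lambda>x. star u * x * u) \<circ> (\<lambda>x. u * x * star u) = id"
      "(\<lambda>x. u * x * star u) \<circ> (\<lambda>x. star u * x * u) = id"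
      by (auto simp: fun_eq_iff)
  qed
  have m: "u * (a * b) * star u = u * a * star u * (u * b * star u)" for a b
    using assms by (metis mult.assoc mult_1_left)
  then show "u * (a * b + b * a) * star u
      = u * a * star u * (u * b * star u) + u * b * star u * (u * a * star u)" for a b
    by (simp add: distrib_left distrib_right)
qed (simp_all add: distrib_left distrib_right mult_scaleC_left mult_scaleC_right star_mult star_star mult.assoc)

section \<open>Unital additive maps between positive definite cones\<close>

locale unital_cone_map =
  fixes F :: "'a::cstar_algebra \<Rightarrow> 'b::cstar_algebra"
  assumes maps: "X \<in> pos_def_cone \<Longrightarrow> F X \<in> pos_def_cone"
    and add: "X \<in> pos_def_cone \<Longrightarrow> Y \<in> pos_def_cone \<Longrightarrow> F (X + Y) = F X + F Y"
    and scaleR: "X \<in> pos_def_cone \<Longrightarrow> t > 0 \<Longrightarrow> F (t *\<^sub>R X) = t *\<^sub>R F X"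
    and one: "F 1 = 1"
begin

lemma scaleR_one: "t > 0 \<Longrightarrow> F (t *\<^sub>R 1) = t *\<^sub>R 1"
  by (simp add: scaleR one)

text \<open>A shift by a multiple of the unit brings \<open>X\<close> into the cone and is undone
  afterwards, as \<open>F\<close> fixes positive multiples of the unit. The amount
  \<open>norm X + 1\<close> is merely one that always suffices: \<open>ext_sa_eq\<close> shows that
  every positive shift into the cone gives the same value.\<close>

definition ext_sa :: "'a \<Rightarrow> 'b"
  where "ext_sa X = F (X + (norm X + 1) *\<^sub>R 1) - (norm X + 1) *\<^sub>R 1"

lemma shift_pos_def: "star X = X \<Longrightarrow> norm X < t \<Longrightarrow> X + t *\<^sub>R 1 \<in> pos_def_cone"
proof -
  assume X: "star X = X" "norm X < t"
  have "X + norm X *\<^sub>R 1 \<in> pos_cone" using selfadj_le_norm(2)[OF X(1)] by simp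
  from pos_add_scaleR_one[OF this, of "t - norm X"] show ?thesis
    using X(2) by (simp add: algebra_simps)
qed

lemma ext_sa_eq:
  assumes X: "star X = X" and t: "t > 0" and Xt: "X + t *\<^sub>R 1 \<in> pos_def_cone"
  shows "F (X + t *\<^sub>R 1) = ext_sa X + t *\<^sub>R 1"
proof -
  define s where "s = norm X + 1"
  have s: "s > 0" "X + s *\<^sub>R 1 \<in> pos_def_cone"
    using shift_pos_def[OF X] by (simp_all add: s_def add_nonneg_pos)
  have "F ((X + t *\<^sub>R 1) + s *\<^sub>R 1) = F (X + t *\<^sub>R 1) + s *\<^sub>R 1"
    using Xt s by (simp add: add scaleR_one_pos_def scaleR_one)
  moreover have "F ((X + s *\<^sub>R 1) + t *\<^sub>R 1) = F (X + s *\<^sub>R 1) + t *\<^sub>R 1"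
    using t s by (simp add: add scaleR_one_pos_def scaleR_one)
  moreover have "(X + t *\<^sub>R 1) + s *\<^sub>R 1 = (X + s *\<^sub>R 1) + t *\<^sub>R 1" by simp
  ultimately show ?thesis by (simp add: ext_sa_def s_def algebra_simps)
qed

lemma ext_sa_cone: "X \<in> pos_def_cone \<Longrightarrow> ext_sa X = F X"
  using ext_sa_eq[of X 1] add[of X 1] by (simp add: pos_def_star pos_def_add one)

lemma star_ext_sa: "star X = X \<Longrightarrow> star (ext_sa X) = ext_sa X"
proof -
  assume X: "star X = X"
  have "X + (norm X + 1) *\<^sub>R 1 \<in> pos_def_cone" by (rule shift_pos_def[OF X]) simp
  from pos_def_star[OF maps[OF this]] show ?thesis
    by (simp add: ext_sa_def star_diff star_scaleR)
qed

lemma ext_sa_add: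
  assumes "star X = X" "star Y = Y"
  shows "ext_sa (X + Y) = ext_sa X + ext_sa Y"
proof -
  define s t where "s = norm X + 1" and "t = norm Y + 1"
  have p: "X + s *\<^sub>R 1 \<in> pos_def_cone" "Y + t *\<^sub>R 1 \<in> pos_def_cone" "s > 0" "t > 0"
    unfolding s_def t_def by (auto intro!: shift_pos_def assms simp: add_nonneg_pos)
  have eq: "(X + s *\<^sub>R 1) + (Y + t *\<^sub>R 1) = (X + Y) + (s + t) *\<^sub>R 1"
    by (simp add: algebra_simps)
  have "F ((X + Y) + (s + t) *\<^sub>R 1) = ext_sa (X + Y) + (s + t) *\<^sub>R 1"
    using pos_def_add[OF p(1,2)] p(3,4) assms unfolding eq
    by (intro ext_sa_eq) (simp_all add: star_add)
  moreover have "F ((X + Y) + (s + t) *\<^sub>R 1) = F (X + s *\<^sub>R 1) + F (Y + t *\<^sub>R 1)"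
    using add[OF p(1,2)] by (simp only: eq)
  ultimately show ?thesis
    using ext_sa_eq[OF assms(1) p(3,1)] ext_sa_eq[OF assms(2) p(4,2)] by (simp add: algebra_simps)
qed

lemma ext_sa_0: "ext_sa 0 = 0"
  by (simp add: ext_sa_def one)

lemma ext_sa_minus: "star X = X \<Longrightarrow> ext_sa (- X) = - ext_sa X"
  using ext_sa_add[of X "- X"] by (simp add: star_minus ext_sa_0 minus_unique)

lemma ext_sa_diff: "star X = X \<Longrightarrow> star Y = Y \<Longrightarrow> ext_sa (X - Y) = ext_sa X - ext_sa Y"
  using ext_sa_add[of X "- Y"] by (simp add: star_minus ext_sa_minus)

lemma ext_sa_scaleR:
  assumes X: "star X = X"
  shows "ext_sa (r *\<^sub>R X) = r *\<^sub>R ext_sa X"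
proof -
  have pos: "ext_sa (r *\<^sub>R X) = r *\<^sub>R ext_sa X" if r: "r > 0" for r
  proof -
    define t where "t = norm X + 1"
    have t: "t > 0" "X + t *\<^sub>R 1 \<in> pos_def_cone"
      using shift_pos_def[OF X] by (simp_all add: t_def add_nonneg_pos)
    have eq: "r *\<^sub>R (X + t *\<^sub>R 1) = r *\<^sub>R X + (r * t) *\<^sub>R 1" by (simp add: algebra_simps)
    have "F (r *\<^sub>R X + (r * t) *\<^sub>R 1) = ext_sa (r *\<^sub>R X) + (r * t) *\<^sub>R 1"
      using pos_def_scaleR[OF t(2) r] r t(1) unfolding eq
      by (intro ext_sa_eq) (simp_all add: star_scaleR X)
    moreover have "F (r *\<^sub>R X + (r * t) *\<^sub>R 1) = r *\<^sub>R (ext_sa X + t *\<^sub>R 1)"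
      using scaleR[OF t(2) r] ext_sa_eq[OF X t] by (simp only: eq)
    ultimately show ?thesis by (simp add: algebra_simps)
  qed
  consider "r > 0" | "r = 0" | "- r > 0" by linarith
  then show ?thesis
  proof cases
    case 3
    then show ?thesis
      using pos[of "- r"] ext_sa_minus[of "r *\<^sub>R X"] X by (simp add: star_scaleR)
  qed (simp_all add: pos ext_sa_0)
qed

lemma ext_sa_one: "ext_sa 1 = 1"
  by (simp add: ext_sa_cone one)

lemma ext_sa_sum:
  "finite I \<Longrightarrow> (\<And>i. i \<in> I \<Longrightarrow> star (X i) = X i) \<Longrightarrow> ext_sa (\<Sum>i\<in>I. X i) = (\<Sum>i\<in>I. ext_sa (X i))"
proof (induction I rule: finite_induct)
  case (insert i I)
  have "star (\<Sum>i\<in>I. X i) = (\<Sum>i\<in>I. X i)" using insert.prems by (simp add: star_sum)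
  then show ?case using insert by (simp add: ext_sa_add)
qed (simp add: ext_sa_0)

lemma ext_sa_pos:
  assumes "X \<in> pos_cone"
  shows "ext_sa X \<in> pos_cone"
proof (rule pos_closed_eps)
  fix e :: real assume e: "e > 0"
  have "X + e *\<^sub>R 1 \<in> pos_def_cone" using assms e by (rule pos_add_scaleR_one)
  then show "ext_sa X + e *\<^sub>R 1 \<in> pos_cone"
    using ext_sa_eq[OF pos_star[OF assms] e] maps pos_def_pos by metis
qed

text \<open>Kadison's inequality. The Bernstein polynomials of \<open>a\<close> form a partition of unity whose
  images \<open>q i\<close> are positive, and \<open>\<Sum>i. (i - n b) q i (i - n b) \<ge> 0\<close> is
  \<open>n\<^sup>2 (c - b\<^sup>2) + n (b - c) \<ge> 0\<close>, where \<open>b\<close> and \<open>c\<close> are the images of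
  \<open>a\<close> and \<open>a\<^sup>2\<close>.\<close>

lemma Kadison_inequality:
  assumes a: "a \<in> pos_cone" "1 - a \<in> pos_cone"
  shows "ext_sa (a * a) - ext_sa a * ext_sa a \<in> pos_cone"
proof -
  have sa: "star a = a" using a(1) by (rule pos_star)
  have rs: "0 \<le> t" "t \<le> 1" if "t \<in> rspec a" for t
    using that a rspec_affine[OF sa, of "-1" 1] by (auto simp: pos_cone_iff)
  define b c where "b = ext_sa a" and "c = ext_sa (a * a)"
  have saa: "star (a * a) = a * a" by (simp add: star_mult sa)
  have sb: "star b = b" and sc: "star c = c"
    by (simp_all add: b_def c_def star_ext_sa sa saa)
  have main: "(real n * (real n - 1)) *\<^sub>R c + real n *\<^sub>R b - (real n)\<^sup>2 *\<^sub>R (b * b) \<in> pos_cone" for n :: nat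
  proof -
    define f where "f i = rcfc (Bernstein n i) a" for i
    have cB: "continuous_on (rspec a) (Bernstein n i)" for i
      unfolding Bernstein_def by (intro continuous_intros)
    have f: "star (f i) = f i" "f i \<in> pos_cone" for i
      unfolding f_def using rcfc_star[OF sa cB] rcfc_pos[OF sa cB] rs
      by (simp_all add: Bernstein_def)
    define q where "q i = ext_sa (f i)" for i
    have q: "q i \<in> pos_cone" for i by (simp add: q_def ext_sa_pos f)
    \<comment> \<open>Linearity turns the moment identities of the Bernstein polynomials into moment
      identities for the \<open>q i\<close>.\<close>
    have comb: "(\<Sum>i\<le>n. w i *\<^sub>R q i) = ext_sa (rcfc (\<lambda>t. \<Sum>i\<le>n. w i * Bernstein n i t) a)" for w
    proof -
      have "rcfc (\<lambda>t. \<Sum>i\<le>n. w i * Bernstein n i t) a = (\<Sum>i\<le>n. w i *\<^sub>R f i)"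
        by (subst rcfc_sum[OF sa]) (auto simp: rcfc_scaleR[OF sa] f_def cB intro!: continuous_intros cB)
      then show ?thesis by (simp add: ext_sa_sum ext_sa_scaleR star_scaleR f q_def)
    qed
    have q0: "(\<Sum>i\<le>n. q i) = 1"
      using comb[of "\<lambda>_. 1"] by (simp add: sum_Bernstein rcfc_const[OF sa] ext_sa_one)
    have q1: "(\<Sum>i\<le>n. real i *\<^sub>R q i) = real n *\<^sub>R b"
      using comb[of real]
      by (simp add: sum_k_Bernstein rcfc_scaleR[OF sa] rcfc_id[OF sa] ext_sa_scaleR sa b_def continuous_intros)
    have "rcfc (\<lambda>t. real n * (real n - 1) * t\<^sup>2) a = (real n * (real n - 1)) *\<^sub>R (a * a)"
      using rcfc_mult[OF sa, of "\<lambda>t. t" "\<lambda>t. t"]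
      by (simp add: rcfc_scaleR[OF sa] rcfc_id[OF sa] power2_eq_square continuous_intros)
    then have q2: "(\<Sum>i\<le>n. (real i * (real i - 1)) *\<^sub>R q i) = (real n * (real n - 1)) *\<^sub>R c"
      using comb[of "\<lambda>i. real i * (real i - 1)"]
      by (simp add: sum_kk_Bernstein ext_sa_scaleR saa c_def)
    define B where "B = real n *\<^sub>R b"
    have sB: "star (real i *\<^sub>R 1 - B) = real i *\<^sub>R 1 - B" for i
      by (simp add: B_def star_diff star_scaleR sb)
    have "(\<Sum>i\<le>n. (real i *\<^sub>R 1 - B) * q i * (real i *\<^sub>R 1 - B)) \<in> pos_cone"
      by (intro pos_sum selfadj_pos_congruence sB q)
    \<comment> \<open>The square of \<open>i\<close> is split as \<open>i (i - 1) + i\<close>, the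
      form in which the second Bernstein moment is known; \<open>B\<close> need not commute with
      \<open>q i\<close>, so both mixed terms are kept.\<close>
    also have "(\<Sum>i\<le>n. (real i *\<^sub>R 1 - B) * q i * (real i *\<^sub>R 1 - B))
        = (\<Sum>i\<le>n. (real i * (real i - 1)) *\<^sub>R q i + real i *\<^sub>R q i
            - (real i *\<^sub>R q i) * B - B * (real i *\<^sub>R q i) + B * q i * B)"
      by (intro sum.cong refl) (simp add: algebra_simps)
    also have "\<dots> = (\<Sum>i\<le>n. (real i * (real i - 1)) *\<^sub>R q i) + (\<Sum>i\<le>n. real i *\<^sub>R q i)
        - (\<Sum>i\<le>n. real i *\<^sub>R q i) * B - B * (\<Sum>i\<le>n. real i *\<^sub>R q i) + B * (\<Sum>i\<le>n. q i) * B"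
      by (simp only: sum.distrib sum_subtractf sum_distrib_left sum_distrib_right)
    also have "\<dots> = (real n * (real n - 1)) *\<^sub>R c + real n *\<^sub>R b - (real n)\<^sup>2 *\<^sub>R (b * b)"
      unfolding q0 q1 q2 by (simp add: B_def power2_eq_square)
    finally show ?thesis .
  qed
  show ?thesis
    unfolding b_def[symmetric] c_def[symmetric]
  proof (rule pos_closed_eps)
    fix e :: real assume e: "e > 0"
    \<comment> \<open>Division by \<open>n^2\<close> leaves \<open>c - b^2\<close> plus the
      remainder \<open>(b - c) / n\<close>, which this \<open>n\<close> makes smaller than
      \<open>e\<close>.\<close>
    obtain n :: nat where n: "n > 0" "norm (b - c) < real n * e"
      using reals_Archimedean3[OF e] by (metis gr0I mult_zero_left norm_ge_zero not_less of_nat_0)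
    have "(c - b * b) + (1 / real n) *\<^sub>R (b - c) \<in> pos_cone"
      using pos_scaleR[OF main[of n], of "1 / (real n)\<^sup>2"] n(1)
      by (simp add: algebra_simps power2_eq_square)
    moreover have "e *\<^sub>R 1 - (1 / real n) *\<^sub>R (b - c) \<in> pos_cone"
    proof (rule selfadj_le_norm(1))
      have "norm (b - c) / real n \<le> e" using n by (simp add: field_simps)
      then show "norm ((1 / real n) *\<^sub>R (b - c)) \<le> e" by (simp only: norm_scaleR) simp
    qed (simp add: star_scaleR star_diff sb sc)
    ultimately have "(c - b * b) + (1 / real n) *\<^sub>R (b - c) + (e *\<^sub>R 1 - (1 / real n) *\<^sub>R (b - c)) \<in> pos_cone"
      by (rule pos_add)
    then show "c - b * b + e *\<^sub>R 1 \<in> pos_cone" by simp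
  qed
qed

section \<open>Complex-linear extension\<close>

definition ext :: "'a \<Rightarrow> 'b"
  where "ext x = ext_sa (re_part x) + \<i> *\<^sub>C ext_sa (im_part x)"

lemma re_ext: "re_part (ext x) = ext_sa (re_part x)"
  and im_ext: "im_part (ext x) = ext_sa (im_part x)"
  unfolding ext_def by (rule re_im_unique; simp add: star_ext_sa star_re_part star_im_part)+

lemma ext_unique: "star u = u \<Longrightarrow> star v = v \<Longrightarrow> ext (u + \<i> *\<^sub>C v) = ext_sa u + \<i> *\<^sub>C ext_sa v"
  by (simp add: ext_def re_im_unique)

lemma ext_selfadj: "star x = x \<Longrightarrow> ext x = ext_sa x"
  using ext_unique[of x 0] by (simp add: ext_sa_0)

lemma ext_add: "ext (x + y) = ext x + ext y"
proof -
  have "x + y = (re_part x + re_part y) + \<i> *\<^sub>C (im_part x + im_part y)"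
    by (subst re_im_decomposition[of x], subst re_im_decomposition[of y]) (simp add: scaleC_add_right)
  then have "ext (x + y) = ext_sa (re_part x + re_part y) + \<i> *\<^sub>C ext_sa (im_part x + im_part y)"
    using ext_unique by (simp only: star_add star_re_part star_im_part)
  then show ?thesis
    by (simp add: ext_def ext_sa_add star_re_part star_im_part scaleC_add_right)
qed

lemma ext_scaleR: "ext (r *\<^sub>R x) = r *\<^sub>R ext x"
proof -
  have "r *\<^sub>R x = r *\<^sub>R re_part x + \<i> *\<^sub>C (r *\<^sub>R im_part x)"
    by (subst re_im_decomposition[of x]) (simp add: scaleR_add_right scaleC_scaleR)
  then have "ext (r *\<^sub>R x) = ext_sa (r *\<^sub>R re_part x) + \<i> *\<^sub>C ext_sa (r *\<^sub>R im_part x)"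
    using ext_unique by (simp only: star_scaleR star_re_part star_im_part)
  then show ?thesis
    by (simp add: ext_def ext_sa_scaleR star_re_part star_im_part scaleR_add_right scaleC_scaleR)
qed

lemma ext_i: "ext (\<i> *\<^sub>C x) = \<i> *\<^sub>C ext x"
proof -
  have "\<i> *\<^sub>C x = - im_part x + \<i> *\<^sub>C re_part x"
    by (subst re_im_decomposition[of x]) (simp add: scaleC_add_right scaleC_scaleC scaleC_minus_left)
  then have "ext (\<i> *\<^sub>C x) = ext_sa (- im_part x) + \<i> *\<^sub>C ext_sa (re_part x)"
    using ext_unique by (simp only: star_minus star_re_part star_im_part)
  then show ?thesis
    by (simp add: ext_def ext_sa_minus star_im_part scaleC_add_right scaleC_scaleC scaleC_minus_left)
qed

lemma ext_scaleC: "ext (c *\<^sub>C x) = c *\<^sub>C ext x"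
proof -
  have c: "c *\<^sub>C y = Re c *\<^sub>R y + Im c *\<^sub>R (\<i> *\<^sub>C y)" for y :: "'c::cstar_algebra"
  proof -
    have "c = complex_of_real (Re c) + complex_of_real (Im c) * \<i>" by (simp add: complex_eq_iff)
    then have "c *\<^sub>C y = (complex_of_real (Re c) + complex_of_real (Im c) * \<i>) *\<^sub>C y" by simp
    then show ?thesis by (simp only: scaleC_add_left scaleC_scaleC[symmetric] scaleC_of_real)
  qed
  show ?thesis unfolding c by (simp only: ext_add ext_scaleR ext_i)
qed

lemma ext_star: "ext (star x) = star (ext x)"
proof -
  have "star x = re_part x + \<i> *\<^sub>C (- im_part x)"
    by (subst re_im_decomposition[of x])
      (simp add: star_add star_scaleC star_re_part star_im_part scaleC_minus_left scaleC_minus_right)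
  then have "ext (star x) = ext_sa (re_part x) + \<i> *\<^sub>C ext_sa (- im_part x)"
    using ext_unique by (simp only: star_minus star_re_part star_im_part)
  then show ?thesis
    by (simp add: ext_def ext_sa_minus star_add star_scaleC star_ext_sa star_re_part star_im_part
        scaleC_minus_left scaleC_minus_right)
qed

text \<open>Polarisation, \<open>ab + ba = (a + b)^2 - a^2 - b^2\<close>, settles self-adjoint
  pairs; complex linearity then frees one argument after the other.\<close>

lemma ext_jordan_of_square:
  assumes sq: "\<And>a. star a = a \<Longrightarrow> ext_sa (a * a) = ext_sa a * ext_sa a"
  shows "ext (x * y + y * x) = ext x * ext y + ext y * ext x"
proof -
  have sa: "ext (a * b + b * a) = ext a * ext b + ext b * ext a" if "star a = a" "star b = b" for a b
  proof -
    have st: "star (a * a) = a * a" "star (b * b) = b * b" "star (a + b) = a + b"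
      "star (a * b + b * a) = a * b + b * a"
      by (simp_all add: star_mult star_add that add.commute)
    have "a * b + b * a = (a + b) * (a + b) - a * a - b * b" by (simp add: algebra_simps)
    then have "ext_sa (a * b + b * a) = ext_sa ((a + b) * (a + b)) - ext_sa (a * a) - ext_sa (b * b)"
      using ext_sa_diff st by (simp add: star_mult star_diff)
    also have "\<dots> = ext_sa a * ext_sa b + ext_sa b * ext_sa a"
      using sq[OF st(3)] sq[OF that(1)] sq[OF that(2)] by (simp add: ext_sa_add that algebra_simps)
    finally show ?thesis by (simp add: ext_selfadj that st)
  qed
  have right: "ext (a * y + y * a) = ext a * ext y + ext y * ext a" if "star a = a" for a y
  proof -
    have "a * y + y * a = (a * re_part y + re_part y * a) + \<i> *\<^sub>C (a * im_part y + im_part y * a)"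
      by (subst (1 2) re_im_decomposition[of y])
        (simp add: algebra_simps mult_scaleC_left mult_scaleC_right scaleC_add_right)
    then have "ext (a * y + y * a)
        = ext (a * re_part y + re_part y * a) + \<i> *\<^sub>C ext (a * im_part y + im_part y * a)"
      by (simp only: ext_i ext_add[of _ "\<i> *\<^sub>C _"])
    moreover have "ext y = ext (re_part y) + \<i> *\<^sub>C ext (im_part y)"
      by (subst re_im_decomposition[of y]) (simp only: ext_add ext_i)
    ultimately show ?thesis
      unfolding sa[OF that star_re_part] sa[OF that star_im_part]
      by (simp add: algebra_simps mult_scaleC_left mult_scaleC_right scaleC_add_right)
  qed
  have "x * y + y * x = (re_part x * y + y * re_part x) + \<i> *\<^sub>C (im_part x * y + y * im_part x)"
    by (subst (1 2) re_im_decomposition[of x])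
      (simp add: algebra_simps mult_scaleC_left mult_scaleC_right scaleC_add_right)
  then have "ext (x * y + y * x)
      = ext (re_part x * y + y * re_part x) + \<i> *\<^sub>C ext (im_part x * y + y * im_part x)"
    by (simp only: ext_i ext_add[of _ "\<i> *\<^sub>C _"])
  moreover have "ext x = ext (re_part x) + \<i> *\<^sub>C ext (im_part x)"
    by (subst re_im_decomposition[of x]) (simp only: ext_add ext_i)
  ultimately show ?thesis
    unfolding right[OF star_re_part] right[OF star_im_part]
    by (simp add: algebra_simps mult_scaleC_left mult_scaleC_right scaleC_add_right)
qed

end

section \<open>Kadison's theorem for inverse pairs of cone maps\<close>

locale unital_cone_iso = F: unital_cone_map F + G: unital_cone_map G
  for F :: "'a::cstar_algebra \<Rightarrow> 'b::cstar_algebra" and G :: "'b \<Rightarrow> 'a" +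
  assumes GF: "X \<in> pos_def_cone \<Longrightarrow> G (F X) = X"
    and FG: "Y \<in> pos_def_cone \<Longrightarrow> F (G Y) = Y"
begin

lemma ext_sa_inverse: "star X = X \<Longrightarrow> G.ext_sa (F.ext_sa X) = X"
proof -
  assume X: "star X = X"
  define t where "t = norm X + 1"
  have t: "t > 0" "X + t *\<^sub>R 1 \<in> pos_def_cone"
    using F.shift_pos_def[OF X] by (simp_all add: t_def add_nonneg_pos)
  note Ft = F.ext_sa_eq[OF X t]
  have "G (F.ext_sa X + t *\<^sub>R 1) = G.ext_sa (F.ext_sa X) + t *\<^sub>R 1"
    using F.maps[OF t(2)] t(1) by (intro G.ext_sa_eq) (simp_all add: Ft F.star_ext_sa X)
  then show ?thesis using GF[OF t(2)] by (simp add: Ft)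
qed

lemma ext_inverse: "G.ext (F.ext x) = x"
  by (simp add: G.ext_def F.re_ext F.im_ext ext_sa_inverse star_re_part star_im_part
      flip: re_im_decomposition)

end

text \<open>The assumptions are symmetric in the two maps, so every result becomes available with
  \<open>F\<close> and \<open>G\<close> exchanged.\<close>

sublocale unital_cone_iso \<subseteq> inverse: unital_cone_iso G F
  by unfold_locales (rule FG GF; assumption)+

context unital_cone_iso
begin

text \<open>Kadison's inequality for \<open>F\<close> at \<open>a\<close> bounds the image of
  \<open>a^2\<close> below by \<open>b^2\<close>. For \<open>G\<close> at \<open>b\<close> it bounds
  the image of \<open>b^2\<close> below by \<open>a^2\<close>, and applying the positive map
  \<open>F\<close> reverses the first bound.\<close>

lemma ext_sa_square_unit_interval:
  assumes a: "a \<in> pos_cone" "1 - a \<in> pos_cone"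
  shows "F.ext_sa (a * a) = F.ext_sa a * F.ext_sa a"
proof -
  have sa: "star a = a" using a(1) by (rule pos_star)
  define b where "b = F.ext_sa a"
  have b: "b \<in> pos_cone" "1 - b \<in> pos_cone" "star b = b"
    using F.ext_sa_pos[OF a(1)] F.ext_sa_pos[OF a(2)] F.star_ext_sa[OF sa]
    by (simp_all add: b_def F.ext_sa_diff F.ext_sa_one sa)
  have Gb: "G.ext_sa b = a" by (simp add: b_def ext_sa_inverse sa)
  have st: "star (a * a) = a * a" "star (b * b) = b * b" by (simp_all add: star_mult sa b)
  have "F.ext_sa (a * a) - b * b \<in> pos_cone"
    using F.Kadison_inequality[OF a] by (simp add: b_def)
  moreover have "F.ext_sa (G.ext_sa (b * b) - a * a) \<in> pos_cone"
    using G.Kadison_inequality[OF b(1,2)] by (simp add: Gb F.ext_sa_pos)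
  then have "- (F.ext_sa (a * a) - b * b) \<in> pos_cone"
    by (simp add: F.ext_sa_diff G.star_ext_sa st inverse.ext_sa_inverse)
  ultimately show ?thesis using pos_antisym b_def by fastforce
qed

lemma ext_sa_square:
  assumes x: "star x = x"
  shows "F.ext_sa (x * x) = F.ext_sa x * F.ext_sa x"
proof -
  define t where "t = norm x + 1"
  \<comment> \<open>The affine map that takes the interval from \<open>- t\<close> to
    \<open>t\<close>, which contains the spectrum of \<open>x\<close>, onto the unit
    interval.\<close>
  define a where "a = (1 / (2 * t)) *\<^sub>R (x + t *\<^sub>R 1)"
  have t: "t > 0" "norm x \<le> t" by (simp_all add: t_def add_nonneg_pos)
  have a: "a \<in> pos_cone"
    unfolding a_def using t by (intro pos_scaleR selfadj_le_norm x) auto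
  have "1 - a = (1 / (2 * t)) *\<^sub>R (t *\<^sub>R 1 - x)"
    using t by (simp add: a_def algebra_simps flip: scaleR_add_left)
  then have a': "1 - a \<in> pos_cone"
    using t by (simp only:) (intro pos_scaleR selfadj_le_norm x; simp)
  have sa: "star a = a" "star (a * a) = a * a" using pos_star[OF a] by (simp_all add: star_mult)
  have xa: "x = (2 * t) *\<^sub>R a - t *\<^sub>R 1" using t by (simp add: a_def)
  have "x * x = (4 * t\<^sup>2) *\<^sub>R (a * a) - (4 * t\<^sup>2) *\<^sub>R a + t\<^sup>2 *\<^sub>R 1"
    unfolding xa by (simp add: algebra_simps power2_eq_square flip: scaleR_add_left)
  then have "F.ext_sa (x * x)
      = (4 * t\<^sup>2) *\<^sub>R (F.ext_sa a * F.ext_sa a) - (4 * t\<^sup>2) *\<^sub>R F.ext_sa a + t\<^sup>2 *\<^sub>R 1"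
    by (simp add: F.ext_sa_add F.ext_sa_diff F.ext_sa_scaleR F.ext_sa_one star_scaleR star_diff sa
        ext_sa_square_unit_interval[OF a a'])
  also have "\<dots> = ((2 * t) *\<^sub>R F.ext_sa a - t *\<^sub>R 1) * ((2 * t) *\<^sub>R F.ext_sa a - t *\<^sub>R 1)"
    by (simp add: algebra_simps power2_eq_square flip: scaleR_add_left)
  also have "(2 * t) *\<^sub>R F.ext_sa a - t *\<^sub>R 1 = F.ext_sa x"
    unfolding xa by (simp add: F.ext_sa_diff F.ext_sa_scaleR F.ext_sa_one star_scaleR sa)
  finally show ?thesis .
qed

theorem jordan_star_iso_ext: "jordan_star_iso F.ext"
  unfolding jordan_star_iso_def
proof (intro conjI allI)
  show "bij F.ext"
    by (rule o_bij[of G.ext]) (simp_all add: fun_eq_iff ext_inverse inverse.ext_inverse)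
  show "F.ext (A * B + B * A) = F.ext A * F.ext B + F.ext B * F.ext A" for A B
    by (rule F.ext_jordan_of_square[OF ext_sa_square])
qed (simp_all add: F.ext_add F.ext_scaleC F.ext_star)

lemma ext_cone: "X \<in> pos_def_cone \<Longrightarrow> F.ext X = F X"
  by (simp add: F.ext_selfadj F.ext_sa_cone pos_def_star)

end

section \<open>The power mean\<close>

lemma
  assumes A: "A \<in> pos_def_cone"
  shows sqrt_pos_def: "real_power A (1/2) \<in> pos_def_cone" "real_power A (-1/2) \<in> pos_def_cone"
      "real_power A (- (1/2)) \<in> pos_def_cone"
    and sqrt_inverse: "real_power A (1/2) * real_power A (-1/2) = 1"
      "real_power A (-1/2) * real_power A (1/2) = 1"
    and sqrt_square: "real_power A (1/2) * real_power A (1/2) = A"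
  using A by (simp_all add: real_power_pos_def real_power_add)

lemma inverse_congruence_cancel:
  assumes "h * k = 1" "k * h = (1::'a::monoid_mult)"
  shows "k * (h * x * h) * k = x" "h * (k * x * k) * h = x"
  using assms by (metis mult.assoc mult_1_left mult_1_right)+

text \<open>The representing function of the Kubo-Ando mean, that is the mean of the numbers 1 and
  \<open>t\<close>. It collapses the nested powers into a single functional calculus of one
  element.\<close>

definition mean_fun :: "real \<Rightarrow> real \<Rightarrow> real"
  where "mean_fun p t = ((1 + t powr p) / 2) powr (1 / p)"

lemma one_plus_powr_pos: "1 + t powr p > (0::real)"
  using powr_ge_zero[of t p] by linarith

lemma continuous_on_mean_fun: "(\<And>t. t \<in> S \<Longrightarrow> t > 0) \<Longrightarrow> continuous_on S (mean_fun p)"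
proof -
  assume pos: "\<And>t. t \<in> S \<Longrightarrow> t > 0"
  have "1 + t powr p \<noteq> 0" for t using one_plus_powr_pos[of t p] by simp
  with pos show ?thesis unfolding mean_fun_def by (intro continuous_intros) force+
qed

lemma mean_fun_pos: "mean_fun p t > 0"
  using one_plus_powr_pos[of t p] unfolding mean_fun_def by simp

lemma real_power_mean_fun:
  assumes Z: "Z \<in> pos_def_cone"
  shows "real_power ((1/2) *\<^sub>R (1 + real_power Z p)) (1/p) = rcfc (mean_fun p) Z"
proof -
  note sa = pos_def_star[OF Z] and c = continuous_on_powr_rspec[OF Z, of p]
  have c': "continuous_on (rspec Z) (\<lambda>t. 1 + t powr p)" by (intro continuous_intros c)
  have e: "(1/2) *\<^sub>R (1 + real_power Z p) = rcfc (\<lambda>t. (1/2) * (1 + t powr p)) Z"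
    unfolding real_power_rcfc
    by (simp only: rcfc_scaleR[OF sa c'] rcfc_add[OF sa continuous_on_const c] rcfc_const[OF sa])
      simp
  have "rcfc (\<lambda>t. t powr (1/p)) (rcfc (\<lambda>t. (1/2) * (1 + t powr p)) Z)
      = rcfc (\<lambda>t. ((1/2) * (1 + t powr p)) powr (1/p)) Z"
    by (intro rcfc_compose[OF sa] continuous_on_powr continuous_intros c) (auto simp: one_plus_powr_pos less_imp_neq[symmetric])
  then show ?thesis by (simp add: e real_power_rcfc[of "rcfc _ _"] mean_fun_def[abs_def])
qed

lemma power_mean_rcfc:
  assumes "A \<in> pos_def_cone" "B \<in> pos_def_cone"
  shows "power_mean p A B = real_power A (1/2) *
    rcfc (mean_fun p) (real_power A (-1/2) * B * real_power A (-1/2)) * real_power A (1/2)"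
  unfolding power_mean_def using assms
  by (subst real_power_mean_fun) (auto intro: pos_def_congruence_pos_def sqrt_pos_def)

lemma rcfc_mean_fun_pos_def: "Z \<in> pos_def_cone \<Longrightarrow> rcfc (mean_fun p) Z \<in> pos_def_cone"
  by (intro rcfc_pos_def continuous_on_mean_fun mean_fun_pos pos_def_star)
    (simp_all add: pos_def_cone_iff)

lemma power_mean_pos_def:
  "A \<in> pos_def_cone \<Longrightarrow> B \<in> pos_def_cone \<Longrightarrow> power_mean p A B \<in> pos_def_cone"
  by (simp add: power_mean_rcfc pos_def_congruence_pos_def sqrt_pos_def rcfc_mean_fun_pos_def)

lemma power_mean_one_left:
  "B \<in> pos_def_cone \<Longrightarrow> power_mean p 1 B = real_power ((1/2) *\<^sub>R (1 + real_power B p)) (1/p)"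
  by (simp add: power_mean_def)

lemma jordan_power_mean:
  assumes J: "jordan_star_iso J" and AB: "A \<in> pos_def_cone" "B \<in> pos_def_cone"
  shows "J (power_mean p A B) = power_mean p (J A) (J B)"
proof -
  let ?Z = "real_power A (-1/2) * B * real_power A (-1/2)"
  have Z: "?Z \<in> pos_def_cone" using AB by (intro pos_def_congruence_pos_def sqrt_pos_def)
  have "J (rcfc (mean_fun p) ?Z) = rcfc (mean_fun p) (J ?Z)"
    using Z by (intro jordan_rcfc[OF J] pos_def_star continuous_on_mean_fun)
      (simp_all add: pos_def_cone_iff)
  then show ?thesis
    using AB J by (simp add: power_mean_rcfc jordan_triple jordan_real_power jordan_pos_def_iff)
qed

text \<open>With \<open>K = (D A D)\<^sup>1\<^sup>/\<^sup>2\<close>, the polar decomposition \<open>D A\<^sup>1\<^sup>/\<^sup>2 = K U\<close> provides a unitary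
  \<open>U\<close> that conjugates one functional calculus into the other.\<close>

lemma power_mean_congruence:
  assumes D: "D \<in> pos_def_cone" and A: "A \<in> pos_def_cone" and B: "B \<in> pos_def_cone"
  shows "power_mean p (D * A * D) (D * B * D) = D * power_mean p A B * D"
proof -
  define h k where "h = real_power A (1/2)" and "k = real_power A (-1/2)"
  have h: "h * k = 1" "k * h = 1" "h * h = A" "star h = h" "star k = k"
    and Z: "k * B * k \<in> pos_def_cone"
    using A B unfolding h_def k_def
    by (simp_all only: sqrt_inverse sqrt_square sqrt_pos_def pos_def_star pos_def_congruence_pos_def)
  have DAD: "D * A * D \<in> pos_def_cone" "D * B * D \<in> pos_def_cone"
    using A B D by (simp_all add: pos_def_congruence_pos_def)
  define K L where "K = real_power (D * A * D) (1/2)" and "L = real_power (D * A * D) (-1/2)"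
  have K: "K * L = 1" "L * K = 1" "K * K = D * A * D" "star K = K" "star L = L"
    using DAD unfolding K_def L_def
    by (simp_all only: sqrt_inverse sqrt_square sqrt_pos_def pos_def_star)
  define E where "E = cinv D"
  have E: "D * E = 1" "E * D = 1" "star D = D"
    using D by (simp_all add: E_def cinv_left cinv_right pos_def_invertible pos_def_star)
  define U where "U = L * D * h"
  have sU: "star U = h * D * L" by (simp add: U_def star_mult h K E mult.assoc)
  have "U * star U = L * (D * (h * h) * D) * L" by (simp only: sU) (simp add: U_def mult.assoc)
  also have "\<dots> = L * (K * K) * L" by (simp add: h K)
  also have "\<dots> = 1" by (metis K(1,2) mult.assoc mult_1_right)
  finally have U1: "U * star U = 1" .
  \<comment> \<open>\<open>U\<close> is invertible as a product of invertible elements; its inverse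
    must then be the right inverse \<open>star U\<close> already found.\<close>
  have "U * (k * E * K) = 1" using h(1) E(1) K(2) unfolding U_def
    by (metis mult.assoc mult_1_left)
  moreover have "(k * E * K) * U = 1" using h(2) E(2) K(1) unfolding U_def
    by (metis mult.assoc mult_1_left)
  ultimately have U2: "star U * U = 1"
    using left_right_inverse_eq[of "k * E * K" U "star U"] U1 by simp
  have KU: "K * U = D * h" using K(1) unfolding U_def by (metis mult.assoc mult_1_left)
  have UK: "star U * K = h * D" using K(2) unfolding sU by (metis mult.assoc mult_1_right)
  have "U * k = L * D" using h(1) unfolding U_def by (metis mult.assoc mult_1_right)
  moreover have "k * star U = D * L" using h(2) unfolding sU by (metis mult.assoc mult_1_left)
  ultimately have arg: "L * (D * B * D) * L = U * (k * B * k) * star U"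
    by (metis mult.assoc)
  note JU = unitary_conjugation_jordan[OF U1 U2]
  have conj: "rcfc (mean_fun p) (L * (D * B * D) * L) = U * rcfc (mean_fun p) (k * B * k) * star U"
    unfolding arg
    by (rule jordan_rcfc[OF JU, symmetric])
      (use Z in \<open>auto simp: pos_def_star pos_def_cone_iff intro!: continuous_on_mean_fun\<close>)
  have "power_mean p (D * A * D) (D * B * D) = K * rcfc (mean_fun p) (L * (D * B * D) * L) * K"
    unfolding K_def L_def by (rule power_mean_rcfc[OF DAD])
  also have "\<dots> = (K * U) * rcfc (mean_fun p) (k * B * k) * (star U * K)"
    unfolding conj by (simp only: mult.assoc)
  also have "\<dots> = D * (h * rcfc (mean_fun p) (k * B * k) * h) * D"
    by (simp only: KU UK mult.assoc)
  also have "h * rcfc (mean_fun p) (k * B * k) * h = power_mean p A B"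
    unfolding h_def k_def by (rule power_mean_rcfc[OF A B, symmetric])
  finally show ?thesis .
qed

lemma cinv_pos_def: "A \<in> pos_def_cone \<Longrightarrow> cinv A \<in> pos_def_cone"
  using real_power_pos_def[of A "- 1"] by (simp add: real_power_minus_1)

lemma real_power_cinv: "A \<in> pos_def_cone \<Longrightarrow> real_power (cinv A) r = real_power A (- r)"
  using real_power_real_power[of A "- 1" r] by (simp add: real_power_minus_1)

lemma cinv_triple:
  "invertible_elem x \<Longrightarrow> invertible_elem y \<Longrightarrow> cinv (x * y * x) = cinv x * cinv y * cinv x"
  by (simp add: cinv_mult invertible_mult mult.assoc)

text \<open>Inverting both arguments replaces \<open>Z\<close> by its inverse, so its p-th power
  becomes the power \<open>- p\<close>; inverting the result replaces the outer exponent
  \<open>1/p\<close> by \<open>- 1/p\<close>.\<close>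

lemma cinv_power_mean:
  assumes A: "A \<in> pos_def_cone" and B: "B \<in> pos_def_cone"
  shows "cinv (power_mean p (cinv A) (cinv B)) = power_mean (- p) A B"
proof -
  define h k where "h = real_power A (1/2)" and "k = real_power A (-1/2)"
  have hk: "h \<in> pos_def_cone" "k \<in> pos_def_cone" "cinv h = k" "cinv k = h"
    using A by (simp_all add: h_def k_def sqrt_pos_def cinv_real_power)
  define Z where "Z = k * B * k"
  have Z: "Z \<in> pos_def_cone" using hk B by (simp add: Z_def pos_def_congruence_pos_def)
  have cZ: "h * cinv B * h = cinv Z"
    using hk B by (simp add: Z_def cinv_triple pos_def_invertible)
  have h': "real_power (cinv A) (1/2) = k" "real_power (cinv A) (- (1/2)) = h"
    using A by (simp_all add: real_power_cinv h_def k_def)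
  define S where "S = (1/2) *\<^sub>R (1 + real_power Z (- p))"
  have S: "S \<in> pos_def_cone"
    using Z by (simp add: S_def pos_def_scaleR pos_def_add real_power_pos_def)
  have "power_mean p (cinv A) (cinv B) = k * real_power S (1/p) * k"
    using Z by (simp add: power_mean_def h' cZ S_def real_power_cinv)
  then have "cinv (power_mean p (cinv A) (cinv B)) = h * real_power S (- (1/p)) * h"
    using hk S by (simp add: cinv_triple pos_def_invertible real_power_pos_def cinv_real_power)
  also have "\<dots> = power_mean (- p) A B"
    by (simp add: power_mean_def S_def Z_def h_def k_def)
  finally show ?thesis .
qed

text \<open>This is what makes maps preserving the mean order isomorphisms.\<close>

lemma range_power_mean:
  assumes p: "p > 0" and A: "A \<in> pos_def_cone"
  shows "(\<exists>X\<in>pos_def_cone. Y = power_mean p A X) \<longleftrightarrow> Y - ((1/2) powr (1/p)) *\<^sub>R A \<in> pos_def_cone"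
proof -
  \<comment> \<open>The limit of \<open>mean_fun p t\<close> as \<open>t\<close> decreases to 0, a
    lower bound that is never attained.\<close>
  define c :: real where "c = (1/2) powr (1/p)"
  have c: "c > 0" "c powr p = 1/2" using p by (simp_all add: c_def powr_powr)
  define h k where "h = real_power A (1/2)" and "k = real_power A (-1/2)"
  have h: "h * k = 1" "k * h = 1" "h * h = A" "h \<in> pos_def_cone" "k \<in> pos_def_cone"
    using A unfolding h_def k_def by (simp_all only: sqrt_inverse sqrt_square sqrt_pos_def)
  have mean: "power_mean p A X = h * rcfc (mean_fun p) (k * X * k) * h" if "X \<in> pos_def_cone" for X
    using that A by (simp add: power_mean_rcfc h_def k_def)
  have conj: "h * (W - c *\<^sub>R 1) * h = h * W * h - c *\<^sub>R A" for W
    by (simp add: algebra_simps h)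
  have gt: "mean_fun p t > c" if "t > 0" for t
  proof -
    have "(1/2) powr (1/p) < ((1 + t powr p) / 2) powr (1/p)"
      using that p by (intro powr_less_mono2) (auto simp: divide_simps)
    then show ?thesis by (simp add: c_def mean_fun_def)
  qed
  show ?thesis
    unfolding c_def[symmetric]
  proof
    assume "\<exists>X\<in>pos_def_cone. Y = power_mean p A X"
    then obtain X where X: "X \<in> pos_def_cone" "Y = power_mean p A X" by blast
    define Z where "Z = k * X * k"
    have Z: "Z \<in> pos_def_cone" using X h by (simp add: Z_def pos_def_congruence_pos_def)
    have tpos: "t > 0" if "t \<in> rspec Z" for t using that Z by (simp add: pos_def_cone_iff)
    have "rcfc (\<lambda>t. mean_fun p t - c) Z \<in> pos_def_cone"
      using gt tpos by (intro rcfc_pos_def pos_def_star[OF Z] continuous_intros continuous_on_mean_fun) force+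
    then have "rcfc (mean_fun p) Z - c *\<^sub>R 1 \<in> pos_def_cone"
      by (simp add: rcfc_diff[OF pos_def_star[OF Z]] rcfc_const[OF pos_def_star[OF Z]]
          continuous_on_mean_fun tpos continuous_intros)
    then have "h * (rcfc (mean_fun p) Z - c *\<^sub>R 1) * h \<in> pos_def_cone"
      using h by (simp add: pos_def_congruence_pos_def)
    then show "Y - c *\<^sub>R A \<in> pos_def_cone" unfolding conj by (simp add: X mean Z_def)
  next
    assume Y: "Y - c *\<^sub>R A \<in> pos_def_cone"
    define W where "W = k * Y * k"
    have hWh: "h * W * h = Y" unfolding W_def by (rule inverse_congruence_cancel[OF h(1,2)])
    have "W - c *\<^sub>R 1 = k * (h * (W - c *\<^sub>R 1) * h) * k"
      by (simp add: inverse_congruence_cancel[OF h(1,2)])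
    also have "\<dots> \<in> pos_def_cone" unfolding conj hWh using Y h by (simp add: pos_def_congruence_pos_def)
    finally have Wc: "W - c *\<^sub>R 1 \<in> pos_def_cone" .
    have sW: "star W = W" using pos_def_star[OF Wc] by (simp add: star_diff star_scaleR)
    have Wgt: "w > c" if "w \<in> rspec W" for w
      using Wc that rspec_affine[OF sW, of 1 "- c"] by (auto simp: pos_def_cone_iff)
    have W2: "2 * w powr p - 1 > 0" if "w \<in> rspec W" for w
      using powr_less_mono2[of p c w] c p Wgt[OF that] by simp
    \<comment> \<open>This is w = ((1 + t^p) / 2)^(1/p) solved for \<open>t\<close>; the solution is
      positive precisely because \<open>w > c\<close> means \<open>2 w^p > 1\<close>.\<close>
    define g where "g w = (2 * w powr p - 1) powr (1/p)" for w
    have cg: "continuous_on (rspec W) g"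
      unfolding g_def using W2 Wgt c(1) by (intro continuous_intros) force+
    define Z where "Z = rcfc g W"
    have Z: "Z \<in> pos_def_cone" unfolding Z_def
      by (rule rcfc_pos_def[OF sW cg]) (use W2 in \<open>force simp: g_def\<close>)
    have "rcfc (mean_fun p) Z = rcfc (\<lambda>w. mean_fun p (g w)) W"
      unfolding Z_def
      by (intro rcfc_compose[OF sW cg] continuous_on_mean_fun) (use W2 in \<open>force simp: g_def\<close>)
    also have "\<dots> = rcfc (\<lambda>w. w) W"
    proof (rule rcfc_cong[OF sW])
      show "continuous_on (rspec W) (\<lambda>w. mean_fun p (g w))"
        by (rule continuous_on_compose2[OF continuous_on_mean_fun cg, of "g ` rspec W"])
          (use W2 in \<open>force simp: g_def\<close>)+
      show "mean_fun p (g w) = w" if "w \<in> rspec W" for w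
        using W2[OF that] Wgt[OF that] c(1) p by (simp add: mean_fun_def g_def powr_powr)
    qed
    also have "\<dots> = W" by (rule rcfc_id[OF sW])
    finally have fZ: "rcfc (mean_fun p) Z = W" .
    have X: "h * Z * h \<in> pos_def_cone" using h Z by (simp add: pos_def_congruence_pos_def)
    have "power_mean p A (h * Z * h) = Y"
      unfolding mean[OF X] inverse_congruence_cancel[OF h(1,2)] fZ hWh ..
    then show "\<exists>X\<in>pos_def_cone. Y = power_mean p A X" using X by blast
  qed
qed

section \<open>Maps preserving a power mean with positive exponent\<close>

text \<open>The order is expressed through inclusion of the sets strictly above \<open>c B\<close>
  and \<open>c A\<close>, which are sets of means when \<open>c\<close> is the constant of
  \<open>range_power_mean\<close>. For the converse, \<open>Y\<close> approaches \<open>c B\<close>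
  along \<open>c B + e\<close>.\<close>

lemma pos_diff_iff_upper:
  assumes c: "c > 0" and AB: "A \<in> pos_def_cone" "B \<in> pos_def_cone"
  shows "B - A \<in> pos_cone \<longleftrightarrow>
    (\<forall>Y\<in>pos_def_cone. Y - c *\<^sub>R B \<in> pos_def_cone \<longrightarrow> Y - c *\<^sub>R A \<in> pos_def_cone)"
proof
  assume "B - A \<in> pos_cone"
  then have "c *\<^sub>R (B - A) \<in> pos_cone" using c by (simp add: pos_scaleR)
  then have "c *\<^sub>R (B - A) + (Y - c *\<^sub>R B) \<in> pos_def_cone" if "Y - c *\<^sub>R B \<in> pos_def_cone" for Y
    using that by (rule pos_add_pos_def)
  then show "\<forall>Y\<in>pos_def_cone. Y - c *\<^sub>R B \<in> pos_def_cone \<longrightarrow> Y - c *\<^sub>R A \<in> pos_def_cone"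
    by (simp add: algebra_simps)
next
  assume *: "\<forall>Y\<in>pos_def_cone. Y - c *\<^sub>R B \<in> pos_def_cone \<longrightarrow> Y - c *\<^sub>R A \<in> pos_def_cone"
  have "c *\<^sub>R (B - A) \<in> pos_cone"
  proof (rule pos_closed_eps)
    fix e :: real assume e: "e > 0"
    have "c *\<^sub>R B + e *\<^sub>R 1 \<in> pos_def_cone"
      using AB c e by (simp add: pos_def_add pos_def_scaleR scaleR_one_pos_def)
    then have "(c *\<^sub>R B + e *\<^sub>R 1) - c *\<^sub>R A \<in> pos_def_cone"
      using *[rule_format, of "c *\<^sub>R B + e *\<^sub>R 1"] e by (simp add: scaleR_one_pos_def)
    then show "c *\<^sub>R (B - A) + e *\<^sub>R 1 \<in> pos_cone"
      by (simp add: algebra_simps pos_def_pos)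
  qed
  from pos_scaleR[OF this, of "1 / c"] show "B - A \<in> pos_cone" using c by simp
qed

text \<open>\<open>A\<close> is the greatest lower bound of the elements strictly above it, which
  lets \<open>c A\<close> be recovered from its strict upper set by the order alone. The elements
  \<open>A + e\<close> are the test points.\<close>

lemma pos_diff_iff_lower_bound:
  assumes A: "A \<in> pos_def_cone"
  shows "A - X \<in> pos_cone \<longleftrightarrow>
    (\<forall>Y\<in>pos_def_cone. Y - A \<in> pos_def_cone \<longrightarrow> Y - X \<in> pos_cone)"
proof
  assume AX: "A - X \<in> pos_cone"
  have "(A - X) + (Y - A) \<in> pos_cone" if "Y - A \<in> pos_def_cone" for Y
    using AX pos_def_pos[OF that] by (rule pos_add)
  then show "\<forall>Y\<in>pos_def_cone. Y - A \<in> pos_def_cone \<longrightarrow> Y - X \<in> pos_cone" by simp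
next
  assume *: "\<forall>Y\<in>pos_def_cone. Y - A \<in> pos_def_cone \<longrightarrow> Y - X \<in> pos_cone"
  show "A - X \<in> pos_cone"
  proof (rule pos_closed_eps)
    fix e :: real assume e: "e > 0"
    then have "A + e *\<^sub>R 1 \<in> pos_def_cone" using A by (simp add: pos_def_add scaleR_one_pos_def)
    then have "(A + e *\<^sub>R 1) - X \<in> pos_cone"
      using *[rule_format, of "A + e *\<^sub>R 1"] e by (simp add: scaleR_one_pos_def)
    then show "A - X + e *\<^sub>R 1 \<in> pos_cone" by (simp add: algebra_simps)
  qed
qed

lemma dyadic_between:
  fixes a b :: real
  assumes "0 \<le> a" "a < b"
  obtains n k :: nat where "n > 0" "a < real n / 2 ^ k" "real n / 2 ^ k < b"
proof -
  obtain k :: nat where k: "1 / (b - a) < 2 ^ k"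
    using real_arch_pow[of 2 "1 / (b - a)"] by auto
  \<comment> \<open>The first point of the grid of width 1/2^k strictly above \<open>a\<close>; as
    the width is less than \<open>b - a\<close>, it stays below \<open>b\<close>.\<close>
  define n where "n = nat \<lfloor>a * 2 ^ k\<rfloor> + 1"
  have "real n = of_int \<lfloor>a * 2 ^ k\<rfloor> + 1" using assms by (simp add: n_def)
  then have "a * 2 ^ k < real n" "real n \<le> a * 2 ^ k + 1" by linarith+
  moreover have "1 < (b - a) * 2 ^ k" using k assms by (simp add: field_simps)
  ultimately have "a * 2 ^ k < real n" "real n < b * 2 ^ k" by (simp_all add: algebra_simps)
  then show ?thesis by (intro that[of n k]) (simp_all add: n_def field_simps)
qed

section \<open>Order and homogeneity of mean preserving bijections\<close>

locale power_mean_iso =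
  fixes p :: real and \<phi> :: "'a::cstar_algebra \<Rightarrow> 'b::cstar_algebra"
  assumes p: "p > 0"
    and bij: "bij_betw \<phi> pos_def_cone pos_def_cone"
    and mean: "A \<in> pos_def_cone \<Longrightarrow> B \<in> pos_def_cone \<Longrightarrow>
      \<phi> (power_mean p A B) = power_mean p (\<phi> A) (\<phi> B)"
begin

definition c :: real where "c = (1/2) powr (1/p)"

lemma c_pos: "c > 0"
  by (simp add: c_def)

lemma maps: "A \<in> pos_def_cone \<Longrightarrow> \<phi> A \<in> pos_def_cone"
  using bij bij_betwE by blast

lemma surj: "B \<in> pos_def_cone \<Longrightarrow> \<exists>A\<in>pos_def_cone. B = \<phi> A"
  using bij by (auto simp: bij_betw_def)

lemma inj: "A \<in> pos_def_cone \<Longrightarrow> B \<in> pos_def_cone \<Longrightarrow> \<phi> A = \<phi> B \<Longrightarrow> A = B"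
  using bij by (auto simp: bij_betw_def inj_on_def)

lemma ball_image: "(\<forall>Y\<in>pos_def_cone. P Y) \<longleftrightarrow> (\<forall>Y\<in>pos_def_cone. P (\<phi> Y))"
  using maps surj by metis

text \<open>By \<open>range_power_mean\<close> both sides say that the element is a mean with the
  given first argument, and the bijection \<open>\<phi>\<close> carries this property in both
  directions.\<close>

lemma upper_cone_iff:
  assumes A: "A \<in> pos_def_cone" and Y: "Y \<in> pos_def_cone"
  shows "\<phi> Y - c *\<^sub>R \<phi> A \<in> pos_def_cone \<longleftrightarrow> Y - c *\<^sub>R A \<in> pos_def_cone"
proof -
  have "(\<exists>X\<in>pos_def_cone. \<phi> Y = power_mean p (\<phi> A) X) \<longleftrightarrow> (\<exists>X\<in>pos_def_cone. Y = power_mean p A X)"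
    using maps surj inj mean power_mean_pos_def A Y by metis
  then show ?thesis
    unfolding c_def by (simp add: range_power_mean[OF p] A maps)
qed

lemma order_iff:
  assumes A: "A \<in> pos_def_cone" and B: "B \<in> pos_def_cone"
  shows "\<phi> B - \<phi> A \<in> pos_cone \<longleftrightarrow> B - A \<in> pos_cone"
  unfolding pos_diff_iff_upper[OF c_pos A B] pos_diff_iff_upper[OF c_pos maps[OF A] maps[OF B]]
  by (subst ball_image) (simp add: upper_cone_iff A B)

text \<open>The strict upper sets of \<open>c A\<close> and \<open>c \<phi> A\<close> correspond
  under \<open>\<phi>\<close>, so \<open>\<phi> (c A)\<close> and \<open>c \<phi> A\<close> have the
  same lower bounds in the cone. Each is thus a lower bound of the other.\<close>

lemma scaleR_c:
  assumes A: "A \<in> pos_def_cone"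
  shows "\<phi> (c *\<^sub>R A) = c *\<^sub>R \<phi> A"
proof -
  have cA: "c *\<^sub>R A \<in> pos_def_cone" "c *\<^sub>R \<phi> A \<in> pos_def_cone"
    using A maps c_pos by (simp_all add: pos_def_scaleR)
  have "\<phi> (c *\<^sub>R A) - X \<in> pos_cone \<longleftrightarrow> c *\<^sub>R \<phi> A - X \<in> pos_cone" if "X \<in> pos_def_cone" for X
  proof -
    obtain Z where Z: "Z \<in> pos_def_cone" "X = \<phi> Z" using surj \<open>X \<in> pos_def_cone\<close> by blast
    show ?thesis
      unfolding Z(2) order_iff[OF Z(1) cA(1)] pos_diff_iff_lower_bound[OF cA(1)]
        pos_diff_iff_lower_bound[OF cA(2)]
        ball_image[of "\<lambda>Y. Y - c *\<^sub>R \<phi> A \<in> pos_def_cone \<longrightarrow> Y - \<phi> Z \<in> pos_cone"]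
      by (simp add: upper_cone_iff order_iff A Z)
  qed
  from this[OF cA(2)] this[OF maps[OF cA(1)]] have
    "\<phi> (c *\<^sub>R A) - c *\<^sub>R \<phi> A \<in> pos_cone" "- (\<phi> (c *\<^sub>R A) - c *\<^sub>R \<phi> A) \<in> pos_cone"
    by simp_all
  from pos_antisym[OF this] show ?thesis by simp
qed

text \<open>Congruence invariance of the mean allows renormalisation: with \<open>H\<close> the
  square root of \<open>A\<close> and \<open>K\<close> the inverse square root of
  \<open>\<phi> A\<close>, the new map is unital and its behaviour at \<open>1\<close> is that of
  \<open>\<phi>\<close> at \<open>A\<close>.\<close>

lemma congruence:
  assumes H: "H \<in> pos_def_cone" and K: "K \<in> pos_def_cone"
  shows "power_mean_iso p (\<lambda>X. K * \<phi> (H * X * H) * K)"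
proof
  show "p > 0" by (rule p)
  have cong: "bij_betw (\<lambda>X. S * X * S) pos_def_cone pos_def_cone"
    if S: "S \<in> pos_def_cone" for S :: "'c::cstar_algebra"
  proof (rule bij_betwI)
    have inv: "cinv S * S = 1" "S * cinv S = 1"
      using S by (simp_all add: cinv_left cinv_right pos_def_invertible)
    show "cinv S * (S * X * S) * cinv S = X" "S * (cinv S * X * cinv S) * S = X" for X
      by (rule inverse_congruence_cancel[OF inv(2,1)])+
  qed (use S cinv_pos_def[OF S] in \<open>auto simp: pos_def_congruence_pos_def\<close>)
  show "bij_betw (\<lambda>X. K * \<phi> (H * X * H) * K) pos_def_cone pos_def_cone"
    using bij_betw_trans[OF bij_betw_trans[OF cong[OF H] bij] cong[OF K]] by (simp add: comp_def)
  show "K * \<phi> (H * power_mean p A B * H) * K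
      = power_mean p (K * \<phi> (H * A * H) * K) (K * \<phi> (H * B * H) * K)"
    if "A \<in> pos_def_cone" "B \<in> pos_def_cone" for A B
    using that H K by (simp add: power_mean_congruence[symmetric] mean maps pos_def_congruence_pos_def)
qed

end

locale unital_power_mean_iso = power_mean_iso +
  assumes one: "\<phi> 1 = 1"
begin

definition F :: "'a \<Rightarrow> 'b"
  where "F B = real_power (\<phi> (real_power B (1/p))) p"

lemma F_maps: "B \<in> pos_def_cone \<Longrightarrow> F B \<in> pos_def_cone"
  by (simp add: F_def maps real_power_pos_def)

lemma root_F: "B \<in> pos_def_cone \<Longrightarrow> real_power (F B) (1/p) = \<phi> (real_power B (1/p))"
  using p by (simp add: F_def maps real_power_pos_def real_power_real_power)

lemma phi_via_F: "A \<in> pos_def_cone \<Longrightarrow> \<phi> A = real_power (F (real_power A p)) (1/p)"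
  using p by (simp add: root_F real_power_pos_def real_power_real_power)

lemma F_one: "F 1 = 1"
  by (simp add: F_def one)

text \<open>Under the p-th power the factor \<open>c\<close> of \<open>scaleR_c\<close> turns into
  \<open>c^p = 1/2\<close>.\<close>

lemma F_half: "B \<in> pos_def_cone \<Longrightarrow> F ((1/2) *\<^sub>R B) = (1/2) *\<^sub>R F B"
proof -
  assume B: "B \<in> pos_def_cone"
  have "\<phi> (real_power ((1/2) *\<^sub>R B) (1/p)) = c *\<^sub>R \<phi> (real_power B (1/p))"
    using B scaleR_c[of "real_power B (1/p)"]
    by (simp add: real_power_scaleR real_power_pos_def c_def del: scaleR_half_double)
  then have "F ((1/2) *\<^sub>R B) = (c powr p) *\<^sub>R F B"
    using B by (simp add: F_def real_power_scaleR c_pos maps real_power_pos_def)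
  then show ?thesis using p by (simp add: c_def powr_powr)
qed

text \<open>The mean of \<open>1\<close> and \<open>B^(1/p)\<close> is the root of the arithmetic
  mean of \<open>1\<close> and \<open>B\<close>; the factor one half is then removed by
  \<open>F_half\<close>.\<close>

lemma F_add_one: "B \<in> pos_def_cone \<Longrightarrow> F (1 + B) = 1 + F B"
proof -
  assume B: "B \<in> pos_def_cone"
  let ?R = "real_power B (1/p)"
  have R: "?R \<in> pos_def_cone" "real_power ?R p = B"
    using B p by (simp_all add: real_power_pos_def real_power_real_power)
  have S: "1 + B \<in> pos_def_cone" "1 + F B \<in> pos_def_cone" using B by (simp_all add: pos_def_add F_maps)
  have "\<phi> (power_mean p 1 ?R) = power_mean p 1 (\<phi> ?R)" using R one by (simp add: mean)
  then have "\<phi> (real_power ((1/2) *\<^sub>R (1 + B)) (1/p)) = real_power ((1/2) *\<^sub>R (1 + F B)) (1/p)"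
    using R by (simp add: power_mean_one_left maps F_def)
  then have "F ((1/2) *\<^sub>R (1 + B)) = (1/2) *\<^sub>R (1 + F B)"
    using p S by (simp add: F_def[of "(1/2) *\<^sub>R (1 + B)"] real_power_real_power pos_def_scaleR)
  then show ?thesis using F_half[OF S(1)] by simp
qed

lemma F_dyadic: "n > 0 \<Longrightarrow> F ((real n / 2 ^ k) *\<^sub>R 1) = (real n / 2 ^ k) *\<^sub>R 1"
proof (induction k)
  case 0
  then show ?case
  proof (induction n)
    case (Suc n)
    show ?case
    proof (cases "n = 0")
      case False
      then have "F (1 + (real n) *\<^sub>R 1) = 1 + (real n) *\<^sub>R 1"
        using Suc.IH by (simp add: F_add_one scaleR_one_pos_def)
      then show ?thesis by (simp add: scaleR_add_left)
    qed (simp add: F_one)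
  qed simp
next
  case (Suc k)
  then have "F ((1/2) *\<^sub>R (real n / 2 ^ k) *\<^sub>R 1) = (1/2) *\<^sub>R (real n / 2 ^ k) *\<^sub>R 1"
    by (simp add: F_half scaleR_one_pos_def del: scaleR_scaleR)
  then show ?case by simp
qed

lemma phi_dyadic:
  assumes "n > 0"
  shows "\<phi> (((real n / 2 ^ k) powr (1/p)) *\<^sub>R 1) = ((real n / 2 ^ k) powr (1/p)) *\<^sub>R 1"
  using root_F[of "(real n / 2 ^ k) *\<^sub>R 1"] assms
  by (simp add: F_dyadic real_power_scaleR_one scaleR_one_pos_def)

text \<open>The numbers \<open>u\<close> for which \<open>u^p\<close> is a positive dyadic rational
  are dense among the positive reals, and \<open>\<phi>\<close> fixes their multiples of the unit;
  monotonicity squeezes \<open>\<phi> (t 1)\<close> between them.\<close>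

lemma phi_scaleR_one:
  assumes t: "t > 0"
  shows "\<phi> (t *\<^sub>R 1) = t *\<^sub>R 1"
proof -
  have t1: "t *\<^sub>R 1 \<in> pos_def_cone" using t by (rule scaleR_one_pos_def)
  have between: "\<exists>u. a < u \<and> u < b \<and> \<phi> (u *\<^sub>R 1) = u *\<^sub>R 1" if "0 < a" "a < b" for a b
  proof -
    have "a powr p < b powr p" using that p by (simp add: powr_less_mono2)
    then obtain n k :: nat where
      n: "n > 0" "a powr p < real n / 2 ^ k" "real n / 2 ^ k < b powr p"
      using dyadic_between[of "a powr p" "b powr p"] by auto
    define u where "u = (real n / 2 ^ k) powr (1/p)"
    have "(a powr p) powr (1/p) < u" "u < (b powr p) powr (1/p)"
      unfolding u_def using n p by (auto intro!: powr_less_mono2)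
    then show ?thesis using phi_dyadic[OF n(1), of k] that p by (auto simp: u_def powr_powr)
  qed
  have ge: "(b - a) *\<^sub>R 1 \<in> pos_cone" if "a \<le> b" for a b :: real
    using that by (intro scaleR_one_pos) simp
  have "\<phi> (t *\<^sub>R 1) - t *\<^sub>R 1 \<in> pos_cone"
  proof (rule pos_closed_eps)
    fix e :: real assume e: "e > 0"
    \<comment> \<open>\<open>t - e\<close> may be negative; \<open>t / 2\<close> keeps the
      approximating scalar positive.\<close>
    have "0 < max (t / 2) (t - e)" "max (t / 2) (t - e) < t" using t e by auto
    from between[OF this] obtain u where
      u: "max (t / 2) (t - e) < u" "u < t" "\<phi> (u *\<^sub>R 1) = u *\<^sub>R 1"
      by blast
    then have "u > 0" using t by auto
    then have "\<phi> (t *\<^sub>R 1) - u *\<^sub>R 1 \<in> pos_cone"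
      using order_iff[of "u *\<^sub>R 1" "t *\<^sub>R 1"] t1 u ge[of u t]
      by (simp add: scaleR_one_pos_def scaleR_diff_left)
    from pos_add[OF this ge[of "t - e" u]] show "\<phi> (t *\<^sub>R 1) - t *\<^sub>R 1 + e *\<^sub>R 1 \<in> pos_cone"
      using u by (simp add: algebra_simps)
  qed
  moreover have "- (\<phi> (t *\<^sub>R 1) - t *\<^sub>R 1) \<in> pos_cone"
  proof (rule pos_closed_eps)
    fix e :: real assume e: "e > 0"
    obtain u where u: "t < u" "u < t + e" "\<phi> (u *\<^sub>R 1) = u *\<^sub>R 1"
      using between[of t "t + e"] t e by auto
    then have "u *\<^sub>R 1 - \<phi> (t *\<^sub>R 1) \<in> pos_cone"
      using order_iff[of "t *\<^sub>R 1" "u *\<^sub>R 1"] t t1 ge[of t u]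
      by (simp add: scaleR_one_pos_def scaleR_diff_left)
    from pos_add[OF this ge[of u "t + e"]] show "- (\<phi> (t *\<^sub>R 1) - t *\<^sub>R 1) + e *\<^sub>R 1 \<in> pos_cone"
      using u by (simp add: algebra_simps)
  qed
  ultimately show ?thesis using pos_antisym by fastforce
qed

end

text \<open>Renormalised at the base point \<open>A\<close>, the claim is
  \<open>phi_scaleR_one\<close> for a unital map.\<close>

lemma (in power_mean_iso) scaleR:
  assumes A: "A \<in> pos_def_cone" and t: "t > 0"
  shows "\<phi> (t *\<^sub>R A) = t *\<^sub>R \<phi> A"
proof -
  define h where "h = real_power A (1/2)"
  define k l where "k = real_power (\<phi> A) (-1/2)" and "l = real_power (\<phi> A) (1/2)"
  have h: "h \<in> pos_def_cone" "h * h = A"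
    using A unfolding h_def by (simp_all only: sqrt_pos_def sqrt_square)
  have k: "k \<in> pos_def_cone" "l * k = 1" "k * l = 1" "l * l = \<phi> A"
    using maps[OF A] unfolding k_def l_def by (simp_all only: sqrt_pos_def sqrt_square sqrt_inverse)
  interpret N: unital_power_mean_iso p "\<lambda>X. k * \<phi> (h * X * h) * k"
  proof (rule unital_power_mean_iso.intro[OF congruence[OF h(1) k(1)]], unfold_locales)
    show "k * \<phi> (h * 1 * h) * k = 1"
      using inverse_congruence_cancel(1)[OF k(2,3), of 1] by (simp add: h k(4))
  qed
  have "k * \<phi> (t *\<^sub>R A) * k = t *\<^sub>R 1" using N.phi_scaleR_one[OF t] by (simp add: h)
  then have "l * (k * \<phi> (t *\<^sub>R A) * k) * l = t *\<^sub>R \<phi> A" by (simp add: k)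
  then show ?thesis by (simp add: inverse_congruence_cancel[OF k(2,3)])
qed

section \<open>Derivatives at the unit\<close>

text \<open>The remainder is the functional calculus of \<open>t^r - 1 - r (t - 1)\<close>, whose
  norm is bounded by its supremum over the spectrum of \<open>y\<close>. All spectral points are as
  near to 1 as \<open>y\<close> is in norm, so the scalar derivative suffices.\<close>

lemma real_power_has_derivative_one:
  "((\<lambda>x::'a::cstar_algebra. real_power x r) has_derivative (\<lambda>h. r *\<^sub>R h)) (at 1 within {x. star x = x})"
  unfolding has_derivative_within_alt
proof (intro conjI allI impI)
  show "bounded_linear (\<lambda>h::'a. r *\<^sub>R h)" by (rule bounded_linear_scaleR_right)
  fix e :: real assume e: "e > 0"
  have "((\<lambda>t. t powr r) has_real_derivative r * 1 powr (r - 1)) (at 1)"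
    by (rule has_real_derivative_powr) simp
  then have "((\<lambda>t. t powr r) has_derivative (\<lambda>h. r * h)) (at 1)"
    by (simp add: has_field_derivative_def)
  then obtain d where d: "d > 0"
    "\<And>t. \<bar>t - 1\<bar> < d \<Longrightarrow> \<bar>t powr r - 1 - r * (t - 1)\<bar> \<le> e * \<bar>t - 1\<bar>"
    unfolding has_derivative_at_alt using e by (auto simp: real_norm_def)
  show "\<exists>d>0. \<forall>y\<in>{x::'a. star x = x}. norm (y - 1) < d \<longrightarrow>
      norm (real_power y r - real_power 1 r - r *\<^sub>R (y - 1)) \<le> e * norm (y - 1)"
  proof (intro exI[of _ "min d 1"] conjI ballI impI)
    fix y :: 'a assume "y \<in> {x. star x = x}" and n: "norm (y - 1) < min d 1"
    then have y: "star y = y" by simp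
    have t1: "\<bar>t - 1\<bar> \<le> norm (y - 1)" if "t \<in> rspec y" for t
      using rspec_norm_le[of "y - 1" "t - 1"] rspec_affine[OF y, of 1 "- 1"] that y
      by (force simp: star_diff)
    \<comment> \<open>The 1 in \<open>min d 1\<close> serves here: at distance less than 1 from the
      unit the spectrum stays positive.\<close>
    have tpos: "t > 0" if "t \<in> rspec y" for t using t1[OF that] n by auto
    have "y \<in> pos_def_cone" using y tpos by (simp add: pos_def_cone_iff)
    note c = continuous_on_powr_rspec[OF this, of r]
    have a: "rcfc (\<lambda>t. r * t + (1 - r)) y = r *\<^sub>R y + (1 - r) *\<^sub>R 1" by (rule rcfc_affine[OF y])
    have "rcfc (\<lambda>t. t powr r - (r * t + (1 - r))) y = real_power y r - (r *\<^sub>R y + (1 - r) *\<^sub>R 1)"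
      unfolding real_power_rcfc a[symmetric] by (intro rcfc_diff[OF y c] continuous_intros)
    then have "real_power y r - real_power 1 r - r *\<^sub>R (y - 1) = rcfc (\<lambda>t. t powr r - (r * t + (1 - r))) y"
      by (simp add: algebra_simps)
    also have "norm \<dots> \<le> e * norm (y - 1)"
    proof (rule rcfc_norm_le[OF y])
      show "continuous_on (rspec y) (\<lambda>t. t powr r - (r * t + (1 - r)))" by (intro continuous_intros c)
      fix t assume t: "t \<in> rspec y"
      have "\<bar>t powr r - 1 - r * (t - 1)\<bar> \<le> e * \<bar>t - 1\<bar>" using d(2)[of t] t1[OF t] n by simp
      also have "\<dots> \<le> e * norm (y - 1)" using t1[OF t] e by simp
      finally show "\<bar>t powr r - (r * t + (1 - r))\<bar> \<le> e * norm (y - 1)" by (simp add: algebra_simps)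
    qed
    finally show "norm (real_power y r - real_power 1 r - r *\<^sub>R (y - 1)) \<le> e * norm (y - 1)" .
  qed (use d in simp)
qed

text \<open>Derivatives along curves are one-sided because rays \<open>1 + t X\<close> need not stay
  in the cone for negative \<open>t\<close>.\<close>

lemma real_power_has_vector_derivative:
  fixes \<gamma> :: "real \<Rightarrow> 'a::cstar_algebra"
  assumes "\<gamma> 0 = 1" "\<And>t. t \<ge> 0 \<Longrightarrow> star (\<gamma> t) = \<gamma> t"
    and "(\<gamma> has_vector_derivative X) (at 0 within {0..})"
  shows "((\<lambda>t. real_power (\<gamma> t) r) has_vector_derivative (r *\<^sub>R X)) (at 0 within {0..})"
proof -
  have "((\<lambda>x. real_power x r) has_derivative (\<lambda>h. r *\<^sub>R h)) (at (\<gamma> 0) within (\<gamma> ` {0..}))"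
    unfolding assms(1)
    by (rule has_derivative_subset[OF real_power_has_derivative_one]) (use assms(2) in auto)
  from diff_chain_within[OF assms(3)[unfolded has_vector_derivative_def] this] show ?thesis
    by (simp add: has_vector_derivative_def comp_def mult.commute)
qed

text \<open>The two outer factors of \<open>Z\<close> contribute \<open>- X/2\<close> each, so
  \<open>Z\<close> has derivative \<open>Y - X\<close>. The exponents \<open>p\<close> and
  \<open>1/p\<close> cancel, leaving \<open>(Y - X)/2\<close>, to which the two factors
  \<open>h\<close> add \<open>X\<close>.\<close>

lemma power_mean_has_vector_derivative:
  fixes \<alpha> \<beta> :: "real \<Rightarrow> 'a::cstar_algebra"
  assumes p: "p \<noteq> 0" and \<alpha>: "\<alpha> 0 = 1" "\<And>t. t \<ge> 0 \<Longrightarrow> \<alpha> t \<in> pos_def_cone"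
    and d\<alpha>: "(\<alpha> has_vector_derivative X) (at 0 within {0..})"
    and \<beta>: "\<beta> 0 = 1" "\<And>t. t \<ge> 0 \<Longrightarrow> \<beta> t \<in> pos_def_cone"
    and d\<beta>: "(\<beta> has_vector_derivative Y) (at 0 within {0..})"
  shows "((\<lambda>t. power_mean p (\<alpha> t) (\<beta> t)) has_vector_derivative ((1/2) *\<^sub>R (X + Y))) (at 0 within {0..})"
proof -
  define k h Z S where "k t = real_power (\<alpha> t) (-1/2)" and "h t = real_power (\<alpha> t) (1/2)"
    and "Z t = k t * \<beta> t * k t" and "S t = (1/2) *\<^sub>R (1 + real_power (Z t) p)" for t
  have [simp]: "k 0 = 1" "h 0 = 1" "Z 0 = 1" "S 0 = 1"
    by (simp_all add: k_def h_def Z_def S_def \<alpha> \<beta> flip: scaleR_2)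
  have pos: "k t \<in> pos_def_cone" "h t \<in> pos_def_cone" "Z t \<in> pos_def_cone" "S t \<in> pos_def_cone"
    if "t \<ge> 0" for t
  proof -
    show *: "k t \<in> pos_def_cone" "h t \<in> pos_def_cone"
      using \<alpha>(2)[OF that] unfolding k_def h_def by (simp_all only: sqrt_pos_def)
    then show **: "Z t \<in> pos_def_cone" using \<beta>(2)[OF that] by (simp add: Z_def pos_def_congruence_pos_def)
    then show "S t \<in> pos_def_cone" by (simp add: S_def pos_def_scaleR pos_def_add real_power_pos_def)
  qed
  have dk: "(k has_vector_derivative ((-1/2) *\<^sub>R X)) (at 0 within {0..})"
    and dh: "(h has_vector_derivative ((1/2) *\<^sub>R X)) (at 0 within {0..})"
    unfolding k_def[abs_def] h_def[abs_def]
    by (intro real_power_has_vector_derivative d\<alpha> \<alpha>(1) pos_def_star \<alpha>(2); assumption)+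
  have "(Z has_vector_derivative (k 0 * \<beta> 0 * ((-1/2) *\<^sub>R X) + (k 0 * Y + ((-1/2) *\<^sub>R X) * \<beta> 0) * k 0))
      (at 0 within {0..})"
    unfolding Z_def[abs_def] by (intro has_vector_derivative_mult dk d\<beta>)
  then have dZ: "(Z has_vector_derivative (Y - X)) (at 0 within {0..})"
    by (simp add: \<beta> algebra_simps flip: scaleR_add_left)
  have "((\<lambda>t. real_power (Z t) p) has_vector_derivative (p *\<^sub>R (Y - X))) (at 0 within {0..})"
    by (rule real_power_has_vector_derivative) (simp_all add: dZ pos pos_def_star)
  then have "(S has_vector_derivative ((1/2) *\<^sub>R (0 + p *\<^sub>R (Y - X)))) (at 0 within {0..})"
    unfolding S_def[abs_def]
    by (intro bounded_linear.has_vector_derivative[OF bounded_linear_scaleR_right]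
        has_vector_derivative_add has_vector_derivative_const)
  then have "((\<lambda>t. real_power (S t) (1/p)) has_vector_derivative ((1/p) *\<^sub>R ((1/2) *\<^sub>R (0 + p *\<^sub>R (Y - X)))))
      (at 0 within {0..})"
    by (intro real_power_has_vector_derivative) (simp_all add: pos pos_def_star)
  then have dS: "((\<lambda>t. real_power (S t) (1/p)) has_vector_derivative ((1/2) *\<^sub>R (Y - X))) (at 0 within {0..})"
    using p by simp
  have "((\<lambda>t. h t * real_power (S t) (1/p) * h t) has_vector_derivative
      (h 0 * real_power (S 0) (1/p) * ((1/2) *\<^sub>R X)
        + (h 0 * ((1/2) *\<^sub>R (Y - X)) + ((1/2) *\<^sub>R X) * real_power (S 0) (1/p)) * h 0)) (at 0 within {0..})"
    by (intro has_vector_derivative_mult dh dS)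
  moreover have "h 0 * real_power (S 0) (1/p) * ((1/2) *\<^sub>R X)
        + (h 0 * ((1/2) *\<^sub>R (Y - X)) + ((1/2) *\<^sub>R X) * real_power (S 0) (1/p)) * h 0
      = (1/2) *\<^sub>R (X + Y)"
    by (simp add: algebra_simps)
  ultimately show ?thesis
    unfolding power_mean_def h_def S_def Z_def k_def by simp
qed

text \<open>Replaces the chain rule, which would require differentiability of the map applied to the
  curves: a Lipschitz bound on their difference is enough.\<close>

lemma has_vector_derivative_zero_dominated:
  fixes f :: "real \<Rightarrow> 'a::real_normed_vector" and g :: "real \<Rightarrow> 'b::real_normed_vector"
  assumes f: "(f has_vector_derivative 0) (at x within S)" and f0: "f x = 0" and g0: "g x = 0"
    and K: "K > 0" and \<delta>: "\<delta> > 0"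
    and dom: "\<And>t. t \<in> S \<Longrightarrow> \<bar>t - x\<bar> < \<delta> \<Longrightarrow> norm (g t) \<le> K * norm (f t)"
  shows "(g has_vector_derivative 0) (at x within S)"
  unfolding has_vector_derivative_def has_derivative_within_alt
proof (intro conjI allI impI)
  show "bounded_linear (\<lambda>h. h *\<^sub>R (0::'b))" by simp
  fix e :: real assume e: "e > 0"
  then have "e / K > 0" using K by simp
  then obtain d where d: "d > 0" "\<And>t. t \<in> S \<Longrightarrow> \<bar>t - x\<bar> < d \<Longrightarrow> norm (f t) \<le> e / K * \<bar>t - x\<bar>"
    using f unfolding has_vector_derivative_def has_derivative_within_alt by (auto simp: f0)
  have "norm (g t) \<le> e * \<bar>t - x\<bar>" if t: "t \<in> S" "\<bar>t - x\<bar> < min d \<delta>" for t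
  proof -
    have "norm (g t) \<le> K * norm (f t)" using t by (intro dom) auto
    also have "\<dots> \<le> K * (e / K * \<bar>t - x\<bar>)" using t K d(2)[of t] by (intro mult_left_mono) auto
    finally show ?thesis using K by simp
  qed
  then show "\<exists>d>0. \<forall>y\<in>S. norm (y - x) < d \<longrightarrow> norm (g y - g x - (y - x) *\<^sub>R 0) \<le> e * norm (y - x)"
    using d(1) \<delta> g0 by (intro exI[of _ "min d \<delta>"]) auto
qed

lemma ray_has_vector_derivative: "((\<lambda>t. 1 + t *\<^sub>R X) has_vector_derivative X) (at 0 within {0..})"
proof -
  have "((\<lambda>t. 1 + t *\<^sub>R X) has_vector_derivative (0 + 1 *\<^sub>R X)) (at 0 within {0..})"
    by (intro has_vector_derivative_add has_vector_derivative_const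
        bounded_linear.has_vector_derivative[OF bounded_linear_scaleR_left]
        has_vector_derivative_id[unfolded id_def])
  then show ?thesis by simp
qed

lemma ray_pos_def: "X \<in> pos_def_cone \<Longrightarrow> t \<ge> 0 \<Longrightarrow> 1 + t *\<^sub>R X \<in> pos_def_cone"
  using pos_add_pos_def[of "t *\<^sub>R X" 1] pos_scaleR[OF pos_def_pos, of X t] by (simp add: add.commute)

section \<open>The derivative of \<open>\<phi>\<close> at the unit and additivity\<close>

context unital_power_mean_iso
begin

lemma F_scaleR: "B \<in> pos_def_cone \<Longrightarrow> t > 0 \<Longrightarrow> F (t *\<^sub>R B) = t *\<^sub>R F B"
  using p by (simp add: F_def real_power_scaleR scaleR maps real_power_pos_def powr_powr)

lemma F_ray: "X \<in> pos_def_cone \<Longrightarrow> t \<ge> 0 \<Longrightarrow> F (1 + t *\<^sub>R X) = 1 + t *\<^sub>R F X"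
  by (cases "t = 0") (simp_all add: F_one F_add_one F_scaleR pos_def_scaleR)

text \<open>Let \<open>d = norm (A - B)\<close>. Since \<open>B\<close> is at least 1/2,
  \<open>A\<close> lies below \<open>B + d\<close> and hence below \<open>(1 + 2 d) B\<close>.
  Monotonicity and homogeneity give \<open>\<phi> A - \<phi> B\<close> below
  \<open>2 d \<phi> B\<close>, and \<open>\<phi> B\<close> is at most 3/2 because \<open>B\<close>
  is; this is where the 3 comes from.\<close>

lemma phi_diff_le:
  assumes A: "A \<in> pos_def_cone" and B: "B \<in> pos_def_cone" and nB: "norm (B - 1) \<le> 1/2"
  shows "(3 * norm (A - B)) *\<^sub>R 1 - (\<phi> A - \<phi> B) \<in> pos_cone"
proof -
  define d where "d = norm (A - B)"
  have d: "d \<ge> 0" by (simp add: d_def)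
  have st: "star (A - B) = A - B" "star (B - 1) = B - 1"
    using A B by (simp_all add: star_diff pos_def_star)
  have lo: "B - (1/2) *\<^sub>R 1 \<in> pos_cone" and up: "(3/2) *\<^sub>R 1 - B \<in> pos_cone"
  proof -
    have half: "(1::'a) = (1/2) *\<^sub>R 1 + (1/2) *\<^sub>R 1" and three: "(3/2) *\<^sub>R (1::'a) = (1/2) *\<^sub>R 1 + 1"
      using scaleR_add_left[of "1/2" "1/2" "1::'a"] scaleR_add_left[of "1/2" 1 "1::'a"] by simp_all
    have shift: "B - 1 + h = B - h" if "1 = h + h" for h :: 'a
      unfolding that by simp
    have "B - 1 + (1/2) *\<^sub>R 1 = B - (1/2) *\<^sub>R 1" by (rule shift[OF half])
    moreover have "(1/2) *\<^sub>R 1 - (B - 1) = (3/2) *\<^sub>R 1 - B" unfolding three by simp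
    ultimately show "B - (1/2) *\<^sub>R 1 \<in> pos_cone" "(3/2) *\<^sub>R 1 - B \<in> pos_cone"
      using selfadj_le_norm[OF st(2) nB] by (simp_all only:)
  qed
  have "(d *\<^sub>R 1 - (A - B)) + (2 * d) *\<^sub>R (B - (1/2) *\<^sub>R 1) \<in> pos_cone"
    using d by (intro pos_add pos_scaleR lo selfadj_le_norm(1)[OF st(1)]) (simp_all add: d_def)
  also have "(d *\<^sub>R 1 - (A - B)) + (2 * d) *\<^sub>R (B - (1/2) *\<^sub>R 1) = (1 + 2 * d) *\<^sub>R B - A"
    by (simp add: algebra_simps)
  finally have "(1 + 2 * d) *\<^sub>R \<phi> B - \<phi> A \<in> pos_cone"
    using d A B order_iff[of A "(1 + 2 * d) *\<^sub>R B"] by (simp add: scaleR pos_def_scaleR)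
  moreover have "(3/2) *\<^sub>R 1 - \<phi> B \<in> pos_cone"
    using up B order_iff[of B "(3/2) *\<^sub>R 1"] by (simp add: phi_scaleR_one scaleR_one_pos_def)
  then have "(2 * d) *\<^sub>R ((3/2) *\<^sub>R 1 - \<phi> B) \<in> pos_cone" using d by (simp add: pos_scaleR)
  ultimately have "((1 + 2 * d) *\<^sub>R \<phi> B - \<phi> A) + (2 * d) *\<^sub>R ((3/2) *\<^sub>R 1 - \<phi> B) \<in> pos_cone"
    by (rule pos_add)
  then show ?thesis by (simp add: d_def algebra_simps)
qed

lemma phi_Lipschitz:
  assumes "A \<in> pos_def_cone" "B \<in> pos_def_cone" "norm (A - 1) \<le> 1/2" "norm (B - 1) \<le> 1/2"
  shows "norm (\<phi> A - \<phi> B) \<le> 3 * norm (A - B)"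
proof (rule norm_le_of_order)
  show "(3 * norm (A - B)) *\<^sub>R 1 - (\<phi> A - \<phi> B) \<in> pos_cone" using assms by (intro phi_diff_le)
  have "(3 * norm (B - A)) *\<^sub>R 1 - (\<phi> B - \<phi> A) \<in> pos_cone" using assms by (intro phi_diff_le)
  then show "\<phi> A - \<phi> B + (3 * norm (A - B)) *\<^sub>R 1 \<in> pos_cone"
    by (simp add: norm_minus_commute algebra_simps)
qed

text \<open>\<open>F\<close> is the derivative of \<open>\<phi>\<close> at the unit: along the special curves
  \<open>(1 + t p X)\<^sup>1\<^sup>/\<^sup>p\<close> this is the identity \<open>F (1 + t p X) = 1 + t p F X\<close>, and the
  Lipschitz estimate carries it over to all curves with the same tangent.\<close>

lemma phi_curve_has_vector_derivative:
  assumes X: "X \<in> pos_def_cone" and \<gamma>: "\<gamma> 0 = 1" "\<And>t. t \<ge> 0 \<Longrightarrow> \<gamma> t \<in> pos_def_cone"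
    and d\<gamma>: "(\<gamma> has_vector_derivative X) (at 0 within {0..})"
  shows "((\<lambda>t. \<phi> (\<gamma> t)) has_vector_derivative F X) (at 0 within {0..})"
proof -
  have special: "((\<lambda>t. real_power (1 + t *\<^sub>R (p *\<^sub>R Y)) (1/p)) has_vector_derivative Y) (at 0 within {0..})"
    if "Y \<in> pos_def_cone" for Y :: "'c::cstar_algebra"
    using real_power_has_vector_derivative[OF _ _ ray_has_vector_derivative, of "p *\<^sub>R Y" "1/p"] p that
    by (simp add: pos_def_star star_add star_scaleR)
  define \<tau> where "\<tau> t = real_power (1 + t *\<^sub>R (p *\<^sub>R X)) (1/p)" for t
  have pX: "p *\<^sub>R X \<in> pos_def_cone" using X p by (simp add: pos_def_scaleR)
  have \<tau>: "\<tau> 0 = 1" "\<And>t. t \<ge> 0 \<Longrightarrow> \<tau> t \<in> pos_def_cone"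
    unfolding \<tau>_def by (simp, intro real_power_pos_def ray_pos_def pX)
  have d\<tau>: "(\<tau> has_vector_derivative X) (at 0 within {0..})"
    unfolding \<tau>_def[abs_def] by (rule special[OF X])
  have "\<phi> (\<tau> t) = real_power (1 + t *\<^sub>R (p *\<^sub>R F X)) (1/p)" if "t \<ge> 0" for t
    unfolding \<tau>_def using that pX X p
    by (subst root_F[symmetric]) (simp_all only: ray_pos_def F_ray F_scaleR)
  then have d\<phi>\<tau>: "((\<lambda>t. \<phi> (\<tau> t)) has_vector_derivative F X) (at 0 within {0..})"
    by (intro has_vector_derivative_transform[OF _ _ special[OF F_maps[OF X]]]) auto
  have near: "\<exists>d>0. \<forall>t\<in>{0..}. \<bar>t - 0\<bar> < d \<longrightarrow> norm (\<delta> t - 1) \<le> 1/2"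
    if "\<delta> 0 = 1" "(\<delta> has_vector_derivative X) (at 0 within {0..})" for \<delta>
  proof -
    have "continuous (at 0 within {0..}) \<delta>"
      using that(2) by (rule has_vector_derivative_continuous)
    then have "\<exists>d>0. \<forall>t\<in>{0..}. dist t 0 < d \<longrightarrow> dist (\<delta> t) (\<delta> 0) < 1/2"
      unfolding continuous_within_eps_delta by (meson zero_less_divide_1_iff zero_less_numeral)
    then show ?thesis by (force simp: that(1) dist_norm intro: less_imp_le)
  qed
  obtain d1 d2 where d: "d1 > 0" "\<forall>t\<in>{0..}. \<bar>t - 0\<bar> < d1 \<longrightarrow> norm (\<gamma> t - 1) \<le> 1/2"
    "d2 > 0" "\<forall>t\<in>{0..}. \<bar>t - 0\<bar> < d2 \<longrightarrow> norm (\<tau> t - 1) \<le> 1/2"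
    using near[OF \<gamma>(1) d\<gamma>] near[OF \<tau>(1) d\<tau>] by blast
  have Lip: "norm (\<phi> (\<gamma> t) - \<phi> (\<tau> t)) \<le> 3 * norm (\<gamma> t - \<tau> t)"
    if "t \<in> {0..}" "\<bar>t - 0\<bar> < min d1 d2" for t
    using that d by (intro phi_Lipschitz \<gamma> \<tau>) auto
  have "((\<lambda>t. \<gamma> t - \<tau> t) has_vector_derivative 0) (at 0 within {0..})"
    using has_vector_derivative_diff[OF d\<gamma> d\<tau>] by simp
  then have diff: "((\<lambda>t. \<phi> (\<gamma> t) - \<phi> (\<tau> t)) has_vector_derivative 0) (at 0 within {0..})"
    by (rule has_vector_derivative_zero_dominated[where K = 3 and \<delta> = "min d1 d2"])
      (use d Lip in \<open>auto simp: \<gamma> \<tau>\<close>)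
  show ?thesis using has_vector_derivative_add[OF diff d\<phi>\<tau>] by simp
qed

text \<open>The curve \<open>\<phi> (\<gamma> t)\<close> is differentiated in two ways: as the image
  of a curve with tangent \<open>(X + Y)/2\<close>, and as the mean of the images of two rays, whose
  tangents are \<open>F X\<close> and \<open>F Y\<close>. One-sided derivatives are unique.\<close>

lemma F_add:
  assumes X: "X \<in> pos_def_cone" and Y: "Y \<in> pos_def_cone"
  shows "F (X + Y) = F X + F Y"
proof -
  have p0: "p \<noteq> 0" using p by simp
  have XY: "X + Y \<in> pos_def_cone" using X Y by (rule pos_def_add)
  define \<gamma> where "\<gamma> t = power_mean p (1 + t *\<^sub>R X) (1 + t *\<^sub>R Y)" for t
  have "(\<gamma> has_vector_derivative ((1/2) *\<^sub>R (X + Y))) (at 0 within {0..})"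
    unfolding \<gamma>_def[abs_def]
    by (rule power_mean_has_vector_derivative[OF p0]) (simp_all add: ray_has_vector_derivative ray_pos_def X Y)
  moreover have "\<gamma> 0 = 1" by (simp add: \<gamma>_def power_mean_one_left flip: scaleR_2)
  moreover have "\<gamma> t \<in> pos_def_cone" if "t \<ge> 0" for t
    using that X Y by (simp add: \<gamma>_def power_mean_pos_def ray_pos_def)
  ultimately have 1: "((\<lambda>t. \<phi> (\<gamma> t)) has_vector_derivative F ((1/2) *\<^sub>R (X + Y))) (at 0 within {0..})"
    using XY by (intro phi_curve_has_vector_derivative) (simp_all add: pos_def_scaleR)
  have ray: "((\<lambda>t. \<phi> (1 + t *\<^sub>R Z)) has_vector_derivative F Z) (at 0 within {0..})"
    if "Z \<in> pos_def_cone" for Z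
    using that by (intro phi_curve_has_vector_derivative ray_has_vector_derivative) (simp_all add: ray_pos_def)
  have "((\<lambda>t. power_mean p (\<phi> (1 + t *\<^sub>R X)) (\<phi> (1 + t *\<^sub>R Y))) has_vector_derivative
      ((1/2) *\<^sub>R (F X + F Y))) (at 0 within {0..})"
    by (rule power_mean_has_vector_derivative[OF p0]) (simp_all add: ray X Y one maps ray_pos_def)
  then have 2: "((\<lambda>t. \<phi> (\<gamma> t)) has_vector_derivative ((1/2) *\<^sub>R (F X + F Y))) (at 0 within {0..})"
    by (rule has_vector_derivative_transform[rotated -1]) (simp_all add: \<gamma>_def mean ray_pos_def X Y)
  have "at (0::real) within {0..} \<noteq> bot" by (simp add: at_within_Ici_at_right)
  from vector_derivative_unique_within[OF this 1 2] show ?thesis by (simp add: F_scaleR XY)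
qed

text \<open>The inverse of \<open>F\<close>, obtained from the inverse of \<open>\<phi>\<close> by
  the same conjugation with the p-th power; Kadison's inequality is needed for both
  directions.\<close>

definition G :: "'b \<Rightarrow> 'a"
  where "G Y = real_power (inv_into pos_def_cone \<phi> (real_power Y (1/p))) p"

lemma inv_phi:
  assumes "Y \<in> pos_def_cone"
  shows "inv_into pos_def_cone \<phi> Y \<in> pos_def_cone" "\<phi> (inv_into pos_def_cone \<phi> Y) = Y"
  using bij assms by (auto simp: bij_betw_def inv_into_into f_inv_into_f)

lemma G_maps: "Y \<in> pos_def_cone \<Longrightarrow> G Y \<in> pos_def_cone"
  by (simp add: G_def inv_phi real_power_pos_def)

lemma F_G: "Y \<in> pos_def_cone \<Longrightarrow> F (G Y) = Y"
  using p by (simp add: F_def G_def inv_phi real_power_real_power real_power_pos_def)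

lemma G_F: "X \<in> pos_def_cone \<Longrightarrow> G (F X) = X"
  using p bij by (simp add: G_def root_F real_power_real_power real_power_pos_def bij_betw_inv_into_left)

lemma unital_cone_iso: "unital_cone_iso F G"
proof
  show "G (X + Y) = G X + G Y" if "X \<in> pos_def_cone" "Y \<in> pos_def_cone" for X Y
    using G_F[of "G X + G Y"] that by (simp add: F_add F_G G_maps pos_def_add)
  show "G (t *\<^sub>R X) = t *\<^sub>R G X" if "X \<in> pos_def_cone" "t > 0" for X t
    using G_F[of "t *\<^sub>R G X"] that by (simp add: F_scaleR F_G G_maps pos_def_scaleR)
  show "G 1 = 1" using G_F[of 1] by (simp add: F_one)
qed (simp_all add: F_maps G_maps F_add F_scaleR F_one F_G G_F)

lemma jordan_representation: "\<exists>J. jordan_star_iso J \<and> (\<forall>A\<in>pos_def_cone. \<phi> A = J A)"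
proof -
  interpret I: unital_cone_iso F G by (rule unital_cone_iso)
  have "\<phi> A = I.F.ext A" if A: "A \<in> pos_def_cone" for A
    using phi_via_F[OF A] A p jordan_pos_def_iff[OF I.jordan_star_iso_ext, of A]
    by (simp add: I.ext_cone[symmetric] jordan_real_power[OF I.jordan_star_iso_ext]
        real_power_pos_def real_power_real_power)
  then show ?thesis using I.jordan_star_iso_ext by blast
qed

end

lemma (in power_mean_iso) congruence_representation:
  "\<exists>J. \<exists>D\<in>pos_def_cone. jordan_star_iso J \<and> (\<forall>A\<in>pos_def_cone. \<phi> A = D * J A * D)"
proof -
  \<comment> \<open>A representation with \<open>J 1 = 1\<close> forces
    \<open>D * D = \<phi> 1\<close>, so \<open>D\<close> can only be the square root
    \<open>l\<close>; congruence with \<open>k\<close> divides it out.\<close>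
  define k l where "k = real_power (\<phi> 1) (-1/2)" and "l = real_power (\<phi> 1) (1/2)"
  have k: "k \<in> pos_def_cone" "l \<in> pos_def_cone" "l * k = 1" "k * l = 1" "l * l = \<phi> 1"
    using maps[OF one_pos_def] unfolding k_def l_def
    by (simp_all only: sqrt_pos_def sqrt_square sqrt_inverse)
  interpret N: unital_power_mean_iso p "\<lambda>X. k * \<phi> (1 * X * 1) * k"
  proof (rule unital_power_mean_iso.intro[OF congruence[OF one_pos_def k(1)]], unfold_locales)
    show "k * \<phi> (1 * 1 * 1) * k = 1"
      using inverse_congruence_cancel(1)[OF k(3,4), of 1] by (simp add: k(5))
  qed
  obtain J where J: "jordan_star_iso J" "\<And>A. A \<in> pos_def_cone \<Longrightarrow> k * \<phi> A * k = J A"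
    using N.jordan_representation by auto
  have "\<phi> A = l * J A * l" if "A \<in> pos_def_cone" for A
    using inverse_congruence_cancel(2)[OF k(3,4), of "\<phi> A"] by (simp add: J(2)[OF that])
  then show ?thesis using J(1) k(2) by blast
qed

theorem theorem2:
  fixes p :: real
    and \<phi> :: "'a::cstar_algebra \<Rightarrow> 'b::cstar_algebra"
  assumes "-1 \<le> p" and "p \<le> 1" and "p \<noteq> 0"
    and "continuous_on pos_def_cone \<phi>"
    and "bij_betw \<phi> pos_def_cone pos_def_cone"
  shows "(\<forall>A\<in>pos_def_cone. \<forall>B\<in>pos_def_cone.
            \<phi> (power_mean p A B) = power_mean p (\<phi> A) (\<phi> B)) \<longleftrightarrow>
         (\<exists>J :: 'a \<Rightarrow> 'b. \<exists>D\<in>pos_def_cone.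
            jordan_star_iso J \<and> (\<forall>A\<in>pos_def_cone. \<phi> A = D * J A * D))"
proof
  assume "\<exists>J :: 'a \<Rightarrow> 'b. \<exists>D\<in>pos_def_cone.
      jordan_star_iso J \<and> (\<forall>A\<in>pos_def_cone. \<phi> A = D * J A * D)"
  then obtain J :: "'a \<Rightarrow> 'b" and D where
    J: "jordan_star_iso J" "D \<in> pos_def_cone" "\<And>A. A \<in> pos_def_cone \<Longrightarrow> \<phi> A = D * J A * D"
    by blast
  then show "\<forall>A\<in>pos_def_cone. \<forall>B\<in>pos_def_cone.
      \<phi> (power_mean p A B) = power_mean p (\<phi> A) (\<phi> B)"
    by (simp add: power_mean_congruence power_mean_pos_def jordan_power_mean jordan_pos_def_iff)
next
  assume mean: "\<forall>A\<in>pos_def_cone. \<forall>B\<in>pos_def_cone.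
      \<phi> (power_mean p A B) = power_mean p (\<phi> A) (\<phi> B)"
  have phi_pos: "\<phi> A \<in> pos_def_cone" if "A \<in> pos_def_cone" for A
    using assms(5) that bij_betwE by blast
  show "\<exists>J :: 'a \<Rightarrow> 'b. \<exists>D\<in>pos_def_cone.
      jordan_star_iso J \<and> (\<forall>A\<in>pos_def_cone. \<phi> A = D * J A * D)"
  proof (cases "p > 0")
    case True
    then interpret power_mean_iso p \<phi> using assms(5) mean by unfold_locales auto
    show ?thesis by (rule congruence_representation)
  next
    case False
    have cc: "cinv (cinv A) = A" if "A \<in> pos_def_cone" for A :: "'c::cstar_algebra"
      using that by (simp add: cinv_cinv pos_def_invertible)
    have bij_cinv: "bij_betw cinv pos_def_cone (pos_def_cone :: 'c::cstar_algebra set)"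
      by (rule bij_betwI[of _ _ _ cinv]) (auto simp: cinv_pos_def cc)
    interpret power_mean_iso "- p" "\<lambda>A. cinv (\<phi> (cinv A))"
    proof
      show "bij_betw (\<lambda>A. cinv (\<phi> (cinv A))) pos_def_cone pos_def_cone"
        using bij_betw_trans[OF bij_betw_trans[OF bij_cinv assms(5)] bij_cinv] by (simp add: comp_def)
      show "cinv (\<phi> (cinv (power_mean (- p) A B)))
          = power_mean (- p) (cinv (\<phi> (cinv A))) (cinv (\<phi> (cinv B)))"
        if "A \<in> pos_def_cone" "B \<in> pos_def_cone" for A B
        using that mean
        by (simp add: cinv_power_mean[symmetric] cc cinv_pos_def phi_pos power_mean_pos_def)
    qed (use False assms(3) in simp)
    obtain J D where J: "jordan_star_iso J" "D \<in> pos_def_cone"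
      and rep: "\<And>A. A \<in> pos_def_cone \<Longrightarrow> cinv (\<phi> (cinv A)) = D * J A * D"
      using congruence_representation by blast
    have "\<phi> A = cinv D * J A * cinv D" if A: "A \<in> pos_def_cone" for A
    proof -
      have JA: "J A \<in> pos_def_cone" using A J(1) by (simp add: jordan_pos_def_iff)
      \<comment> \<open>Inversion is the power \<open>- 1\<close>, so \<open>J\<close> respects it;
        inverting the representation then turns the congruence factor \<open>D\<close> into
        \<open>cinv D\<close>.\<close>
      have "J (cinv A) = cinv (J A)"
        using jordan_real_power[OF J(1) A, of "- 1"] A JA by (simp add: real_power_minus_1)
      then have "cinv (\<phi> A) = D * cinv (J A) * D" using rep[of "cinv A"] A by (simp add: cc cinv_pos_def)
      then have "cinv (cinv (\<phi> A)) = cinv D * cinv (cinv (J A)) * cinv D"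
        using J(2) JA by (simp add: cinv_triple pos_def_invertible cinv_pos_def)
      then show ?thesis using phi_pos[OF A] JA by (simp add: cc)
    qed
    then show ?thesis using J cinv_pos_def by blast
  qed
qed

end
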